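(* Let $W\in\{S_n,W^{\mathsf{BC}}_n,W^{\mathsf D}_n\}$ with $n\ge2$. Then $\Gamma^{\mathbf m}=(\mathcal G,\omega^{\mathbf m},\mathrm{Asc}^{\mathbf m})$ and $\Gamma^{\mathbf n}=(\mathcal G,\omega^{\mathbf n},\mathrm{Asc}^{\mathbf n})$ are quasi-admissible $W$-graphs, and the linear maps $Y_z\mapsto\underline M_z$ and $Y_z\mapsto\underline N_z$ are $\mathcal H$-module isomorphisms $\mathcal Y(\Gamma^{\mathbf m})\cong\mathcal M$ and $\mathcal Y(\Gamma^{\mathbf n})\cong\mathcal N$.
   Context: For $i>0$ let $s_i=(i,i+1)(-i,-i-1)$, $s_0=(-1,1)$, $s_{-1}=(1,-2)(-1,2)$. $W^{\mathsf{BC}}_N$: permutations $w$ of $\{\pm1,\dots,\pm N\}$ with $w(-i)=-w(i)$ (generators $s_0,\dots,s_{N-1}$); $W^{\mathsf D}_N$: subgroup with $|\{i\in[N]:w(i)<0\}|$ even (generators $s_{-1},s_1,\dots,s_{N-1}$); $S_N=\langle s_1,\dots,s_{N-1}\rangle$; $\ell$ is Coxeter length. $\mathcal F^{\mathsf A}_{n-1}=\{z\in S_{2n}:z=z^{-1},z(i)\ne i\ \forall i\in[2n]\}$; $\mathcal F^{\mathsf{BC}}_n=\{z\in W^{\mathsf{BC}}_{2n}:z=z^{-1},|z(i)|\ne i\ \forall i\in[2n]\}$; $\mathcal F^{\mathsf D}_n=\{z\in\mathcal F^{\mathsf{BC}}_n:|\{i\in[n]:z(i)<-i\}|\text{ even}\}$.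 $i>0$ is a visible descent of $z$ if $z(i+1)<\min\{i,z(i)\}$ or $z(i)<-i$. $\mathcal G=\mathcal G(W)$ is the subset of $\mathcal F^{\mathsf A}_{n-1}$, $\mathcal F^{\mathsf{BC}}_n$, $\mathcal F^{\mathsf D}_n$ (for $W=S_n,W^{\mathsf{BC}}_n,W^{\mathsf D}_n$) with no visible descent $>n$; $\ell(z)$ for $z\in\mathcal G$ is length in $S_{2n}$, $W^{\mathsf{BC}}_{2n}$, $W^{\mathsf D}_{2n}$ respectively. For $z\in\mathcal G$: $\mathrm{Des}^=(z)=\{s\in S:sz=zs\}$, $\mathrm{Asc}^=(z)=\{s\in S:zsz\in\{s_i:i>n\}\}$, $\mathrm{Des}^<(z)=\{s\in S:\ell(sz)<\ell(z)\}\setminus(\mathrm{Des}^=(z)\sqcup\mathrm{Asc}^=(z))$, $\mathrm{Asc}^<(z)=\{s\in S:\ell(sz)>\ell(z)\}\setminus(\mathrm{Des}^=(z)\sqcup\mathrm{Asc}^=(z))$. $\mathcal H$: Iwahori–Hecke algebra of $W$ over $\mathbb Z[x,x^{-1}]$ with basis $H_w$, $H_sH_w=H_{sw}$ if $\ell(sw)>\ell(w)$, else $H_{sw}+(x-x^{-1})H_w$; its bar operator is the antilinear ($x\mapsto x^{-1}$) ring involution with $\overline{H_w}=(H_{w^{-1}})^{-1}$. $\mathcal M$ (resp. $\mathcal N$) is the free $\mathbb Z[x,x^{-1}]$-module with basis $M_z$ (resp. $N_z$), $z\in\mathcal G$, with $\mathcal H$-action $H_sM_z=M_{szs}$, $M_{szs}+(x-x^{-1})M_z$,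 $-x^{-1}M_z$, $xM_z$ according as $s\in\mathrm{Asc}^<(z),\mathrm{Des}^<(z),\mathrm{Asc}^=(z),\mathrm{Des}^=(z)$, and $H_sN_z=N_{szs}$, $N_{szs}+(x-x^{-1})N_z$, $xN_z$, $-x^{-1}N_z$ in the same cases. Each carries the unique antilinear map $\overline{\cdot}$ with $\overline{HA}=\overline H\,\overline A$ fixing $M_z$ (resp. $N_z$) when $\mathrm{Des}^<(z)=\varnothing$; $\{\underline M_z\}$ (resp. $\{\underline N_z\}$) is the unique basis with $\overline{\underline M_z}=\underline M_z\in M_z+\sum_{\ell(y)<\ell(z)}x^{-1}\mathbb Z[x^{-1}]M_y$ (resp. same with $N$). Write $\underline M_z=\sum_y\mathbf m_{yz}M_y$, $\underline N_z=\sum_y\mathbf n_{yz}N_y$, and let $\mu^{\mathbf m}_{yz},\mu^{\mathbf n}_{yz}$ be the coefficients of $x^{-1}$ in $\mathbf m_{yz},\mathbf n_{yz}$. Let $\mathrm{Asc}^{\mathbf m}(z)=\mathrm{Asc}^<(z)\sqcup\mathrm{Asc}^=(z)$, $\mathrm{Asc}^{\mathbf n}(z)=\mathrm{Asc}^<(z)\sqcup\mathrm{Des}^=(z)$; $\omega^{\mathbf m}(y,z)=\mu^{\mathbf m}_{yz}+\mu^{\mathbf m}_{zy}$ if $\mathrm{Asc}^{\mathbf m}(y)\not\subset\mathrm{Asc}^{\mathbf m}(z)$ and $0$ otherwise; $\omega^{\mathbf n}$ likewise with $\mathbf n$. An $S$-labeled graph $\Gamma=(V,\omega,I)$ has maps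 $\omega:V\times V\to\mathbb Z[x,x^{-1}]$, $I:V\to\{\text{subsets of }S\}$ (edges $u\to v$ when $\omega(u,v)\neq0$). It is a $W$-graph if the free module $\mathcal Y(\Gamma)$ with basis $\{Y_v\}$ has an $\mathcal H$-module structure with $H_sY_u=xY_u$ if $s\notin I(u)$ and $H_sY_u=-x^{-1}Y_u+\sum_{v\in V,\ s\notin I(v)}\omega(u,v)Y_v$ if $s\in I(u)$. It is quasi-admissible if (1) its directed graph is bipartite, (2) all $\omega(u,v)\in\mathbb Z$, (3) $\omega(u,v)=0$ whenever $I(u)\subset I(v)$, (4) $\omega(u,v)=\omega(v,u)$ whenever $I(u)\not\subset I(v)\not\subset I(u)$. *)

theory Defs
  imports Main "HOL-Library.Poly_Mapping"
begin

section \<open>Laurent polynomials Z[x,x^-1] as finitely supported functions int => int\<close>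

type_synonym lpoly = "int \<Rightarrow>\<^sub>0 int"
type_synonym perm = "int \<Rightarrow> int"
(* elements of free modules with basis indexed by (signed) permutations *)
type_synonym vec = "perm \<Rightarrow> lpoly"

definition xx :: lpoly where "xx = Poly_Mapping.single 1 1"
definition xinv :: lpoly where "xinv = Poly_Mapping.single (-1) 1"
definition lconst :: "int \<Rightarrow> lpoly" where "lconst c = Poly_Mapping.single 0 c"
definition lbar :: "lpoly \<Rightarrow> lpoly" where "lbar p = Poly_Mapping.map_key uminus p"
definition coeff_xinv :: "lpoly \<Rightarrow> int" where "coeff_xinv p = Poly_Mapping.lookup p (-1)"
definition negpart :: "lpoly set" where "negpart = {p. \<forall>k::int. k \<ge> 0 \<longrightarrow> Poly_Mapping.lookup p k = 0}"

definition vadd :: "vec \<Rightarrow> vec \<Rightarrow> vec" where "vadd u v = (\<lambda>y. u y + v y)"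
definition vscale :: "lpoly \<Rightarrow> vec \<Rightarrow> vec" where "vscale c v = (\<lambda>y. c * v y)"
definition bv :: "perm \<Rightarrow> vec" where "bv z = (\<lambda>y. if y = z then 1 else 0)"
definition fspace :: "perm set \<Rightarrow> vec set" where "fspace V = {f. \<forall>y. y \<notin> V \<longrightarrow> f y = 0}"
definition lin_ext :: "perm set \<Rightarrow> (perm \<Rightarrow> vec) \<Rightarrow> vec \<Rightarrow> vec" where
  "lin_ext V b f = (\<lambda>y. \<Sum>u\<in>V. f u * b u y)"

datatype ctype = TypeA | TypeBC | TypeD

definition sgen :: "int \<Rightarrow> perm" where
  "sgen i = (if i > 0 then
       (\<lambda>k. if k = i then i + 1 else if k = i + 1 then i
            else if k = -i then -i - 1 else if k = -i - 1 then -i else k)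
     else if i = 0 then (\<lambda>k. if k = 1 then -1 else if k = -1 then 1 else k)
     else if i = -1 then
       (\<lambda>k. if k = 1 then -2 else if k = -2 then 1
            else if k = -1 then 2 else if k = 2 then -1 else k)
     else id)"

definition Sgens :: "ctype \<Rightarrow> nat \<Rightarrow> perm set" where
  "Sgens t N = (case t of
      TypeA \<Rightarrow> sgen ` {1..int N - 1}
    | TypeBC \<Rightarrow> sgen ` {0..int N - 1}
    | TypeD \<Rightarrow> insert (sgen (-1)) (sgen ` {1..int N - 1}))"

definition signed_perm :: "nat \<Rightarrow> perm \<Rightarrow> bool" where
  "signed_perm N w \<longleftrightarrow> bij w \<and> (\<forall>i. w (-i) = - w i) \<and> (\<forall>i. \<bar>i\<bar> > int N \<longrightarrow> w i = i)"

(* S_N (embedded via s_i = (i,i+1)(-i,-i-1)), W^BC_N, W^D_N *)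
definition Wgrp :: "ctype \<Rightarrow> nat \<Rightarrow> perm set" where
  "Wgrp t N = {w. signed_perm N w \<and>
     (case t of
        TypeA \<Rightarrow> (\<forall>i\<in>{1..int N}. w i > 0)
      | TypeBC \<Rightarrow> True
      | TypeD \<Rightarrow> even (card {i\<in>{1..int N}. w i < 0}))}"

definition clen :: "perm set \<Rightarrow> perm \<Rightarrow> nat" where
  "clen S w = (LEAST k. \<exists>ws. length ws = k \<and> set ws \<subseteq> S \<and> foldr (\<circ>) ws id = w)"

definition Fset :: "ctype \<Rightarrow> nat \<Rightarrow> perm set" where
  "Fset t n = (case t of
      TypeA \<Rightarrow> {z \<in> Wgrp TypeA (2 * n). inv z = z \<and> (\<forall>i\<in>{1..2 * int n}. z i \<noteq> i)}
    | TypeBC \<Rightarrow> {z \<in> Wgrp TypeBC (2 * n). inv z = z \<and> (\<forall>i\<in>{1..2 * int n}. \<bar>z i\<bar> \<noteq> i)}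
    | TypeD \<Rightarrow> {z \<in> Wgrp TypeBC (2 * n). inv z = z \<and> (\<forall>i\<in>{1..2 * int n}. \<bar>z i\<bar> \<noteq> i)
                  \<and> even (card {i\<in>{1..int n}. z i < - i})})"

definition visdes :: "perm \<Rightarrow> int \<Rightarrow> bool" where
  "visdes z i \<longleftrightarrow> i > 0 \<and> (z (i + 1) < min i (z i) \<or> z i < - i)"

definition Gset :: "ctype \<Rightarrow> nat \<Rightarrow> perm set" where
  "Gset t n = {z \<in> Fset t n. \<forall>i. i > int n \<longrightarrow> \<not> visdes z i}"

definition lenG :: "ctype \<Rightarrow> nat \<Rightarrow> perm \<Rightarrow> nat" where
  "lenG t n z = clen (Sgens t (2 * n)) z"

definition DesEq :: "ctype \<Rightarrow> nat \<Rightarrow> perm \<Rightarrow> perm set" where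
  "DesEq t n z = {s \<in> Sgens t n. s \<circ> z = z \<circ> s}"
definition AscEq :: "ctype \<Rightarrow> nat \<Rightarrow> perm \<Rightarrow> perm set" where
  "AscEq t n z = {s \<in> Sgens t n. \<exists>i. i > int n \<and> z \<circ> s \<circ> z = sgen i}"
definition DesLt :: "ctype \<Rightarrow> nat \<Rightarrow> perm \<Rightarrow> perm set" where
  "DesLt t n z = {s \<in> Sgens t n. lenG t n (s \<circ> z) < lenG t n z} - (DesEq t n z \<union> AscEq t n z)"
definition AscLt :: "ctype \<Rightarrow> nat \<Rightarrow> perm \<Rightarrow> perm set" where
  "AscLt t n z = {s \<in> Sgens t n. lenG t n (s \<circ> z) > lenG t n z} - (DesEq t n z \<union> AscEq t n z)"

definition AscM :: "ctype \<Rightarrow> nat \<Rightarrow> perm \<Rightarrow> perm set" where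
  "AscM t n z = AscLt t n z \<union> AscEq t n z"
definition AscN :: "ctype \<Rightarrow> nat \<Rightarrow> perm \<Rightarrow> perm set" where
  "AscN t n z = AscLt t n z \<union> DesEq t n z"

(* elements sum_w a(w) H_w, with H_w = bv w *)
definition Hset :: "ctype \<Rightarrow> nat \<Rightarrow> vec set" where
  "Hset t n = fspace (Wgrp t n)"

definition hone :: vec where "hone = bv id"

(* left multiplication by H_s *)
definition hs :: "ctype \<Rightarrow> nat \<Rightarrow> perm \<Rightarrow> vec \<Rightarrow> vec" where
  "hs t n s a = (\<lambda>w. a (s \<circ> w) +
      (if clen (Sgens t n) (s \<circ> w) < clen (Sgens t n) w then (xx - xinv) * a w else 0))"

definition redword :: "ctype \<Rightarrow> nat \<Rightarrow> perm \<Rightarrow> perm list" where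
  "redword t n w = (SOME ws. set ws \<subseteq> Sgens t n \<and> foldr (\<circ>) ws id = w
                           \<and> length ws = clen (Sgens t n) w)"

(* action of sum_w a(w) H_w where H_s acts by T s (H_w = H_{s1}...H_{sk}, reduced word) *)
definition hact :: "ctype \<Rightarrow> nat \<Rightarrow> (perm \<Rightarrow> vec \<Rightarrow> vec) \<Rightarrow> vec \<Rightarrow> vec \<Rightarrow> vec" where
  "hact t n T a v = (\<lambda>y. \<Sum>w\<in>Wgrp t n. a w * foldr T (redword t n w) v y)"

definition hmult :: "ctype \<Rightarrow> nat \<Rightarrow> vec \<Rightarrow> vec \<Rightarrow> vec" where
  "hmult t n a b = hact t n (hs t n) a b"

definition hinv :: "ctype \<Rightarrow> nat \<Rightarrow> vec \<Rightarrow> vec" where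
  "hinv t n h = (THE b. b \<in> Hset t n \<and> hmult t n h b = hone \<and> hmult t n b h = hone)"

definition hbar :: "ctype \<Rightarrow> nat \<Rightarrow> vec \<Rightarrow> vec" where
  "hbar t n a = (\<lambda>y. \<Sum>w\<in>Wgrp t n. lbar (a w) * hinv t n (bv (inv w)) y)"

definition is_Hmodule_rep :: "ctype \<Rightarrow> nat \<Rightarrow> vec set \<Rightarrow> (vec \<Rightarrow> vec \<Rightarrow> vec) \<Rightarrow> bool" where
  "is_Hmodule_rep t n V \<rho> \<longleftrightarrow>
     (\<forall>a\<in>Hset t n. \<forall>v\<in>V. \<rho> a v \<in> V) \<and>
     (\<forall>a\<in>Hset t n. \<forall>u\<in>V. \<forall>v\<in>V. \<rho> a (vadd u v) = vadd (\<rho> a u) (\<rho> a v)) \<and>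
     (\<forall>a\<in>Hset t n. \<forall>b\<in>Hset t n. \<forall>v\<in>V. \<rho> (vadd a b) v = vadd (\<rho> a v) (\<rho> b v)) \<and>
     (\<forall>c. \<forall>a\<in>Hset t n. \<forall>v\<in>V.
         \<rho> (vscale c a) v = vscale c (\<rho> a v) \<and> \<rho> a (vscale c v) = vscale c (\<rho> a v)) \<and>
     (\<forall>v\<in>V. \<rho> hone v = v) \<and>
     (\<forall>a\<in>Hset t n. \<forall>b\<in>Hset t n. \<forall>v\<in>V. \<rho> (hmult t n a b) v = \<rho> a (\<rho> b v))"

definition qpb :: "ctype \<Rightarrow> nat \<Rightarrow> lpoly \<Rightarrow> lpoly \<Rightarrow> perm \<Rightarrow> perm \<Rightarrow> vec" where
  "qpb t n cA cD s z =
     (if s \<in> AscLt t n z then bv (s \<circ> z \<circ> s)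
      else if s \<in> DesLt t n z then vadd (bv (s \<circ> z \<circ> s)) (vscale (xx - xinv) (bv z))
      else if s \<in> AscEq t n z then vscale cA (bv z)
      else if s \<in> DesEq t n z then vscale cD (bv z)
      else (\<lambda>_. 0))"

definition Mact :: "ctype \<Rightarrow> nat \<Rightarrow> perm \<Rightarrow> vec \<Rightarrow> vec" where
  "Mact t n s = lin_ext (Gset t n) (qpb t n (- xinv) xx s)"
definition Nact :: "ctype \<Rightarrow> nat \<Rightarrow> perm \<Rightarrow> vec \<Rightarrow> vec" where
  "Nact t n s = lin_ext (Gset t n) (qpb t n xx (- xinv) s)"

definition antilin_on :: "vec set \<Rightarrow> (vec \<Rightarrow> vec) \<Rightarrow> bool" where
  "antilin_on V \<beta> \<longleftrightarrow> (\<forall>v\<in>V. \<beta> v \<in> V) \<and> (\<forall>v. v \<notin> V \<longrightarrow> \<beta> v = (\<lambda>_. 0)) \<and>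
     (\<forall>u\<in>V. \<forall>v\<in>V. \<beta> (vadd u v) = vadd (\<beta> u) (\<beta> v)) \<and>
     (\<forall>c. \<forall>v\<in>V. \<beta> (vscale c v) = vscale (lbar c) (\<beta> v))"

definition modbar :: "ctype \<Rightarrow> nat \<Rightarrow> (perm \<Rightarrow> vec \<Rightarrow> vec) \<Rightarrow> vec \<Rightarrow> vec" where
  "modbar t n T = (THE \<beta>. antilin_on (fspace (Gset t n)) \<beta> \<and>
      (\<forall>a\<in>Hset t n. \<forall>v\<in>fspace (Gset t n). \<beta> (hact t n T a v) = hact t n T (hbar t n a) (\<beta> v)) \<and>
      (\<forall>z\<in>Gset t n. DesLt t n z = {} \<longrightarrow> \<beta> (bv z) = bv z))"

definition canon :: "ctype \<Rightarrow> nat \<Rightarrow> (perm \<Rightarrow> vec \<Rightarrow> vec) \<Rightarrow> perm \<Rightarrow> vec" where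
  "canon t n T z = (THE c. c \<in> fspace (Gset t n) \<and> modbar t n T c = c \<and> c z = 1 \<and>
      (\<forall>y\<in>Gset t n. y \<noteq> z \<longrightarrow> c y \<in> negpart \<and> (c y \<noteq> 0 \<longrightarrow> lenG t n y < lenG t n z)))"

definition mu :: "ctype \<Rightarrow> nat \<Rightarrow> (perm \<Rightarrow> vec \<Rightarrow> vec) \<Rightarrow> perm \<Rightarrow> perm \<Rightarrow> int" where
  "mu t n T y z = coeff_xinv (canon t n T z y)"

definition omega :: "ctype \<Rightarrow> nat \<Rightarrow> (perm \<Rightarrow> vec \<Rightarrow> vec) \<Rightarrow> (perm \<Rightarrow> perm set) \<Rightarrow> perm \<Rightarrow> perm \<Rightarrow> lpoly" where
  "omega t n T Asc y z = (if \<not> Asc y \<subseteq> Asc z then lconst (mu t n T y z + mu t n T z y) else 0)"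

definition YTb :: "perm set \<Rightarrow> (perm \<Rightarrow> perm \<Rightarrow> lpoly) \<Rightarrow> (perm \<Rightarrow> perm set) \<Rightarrow> perm \<Rightarrow> perm \<Rightarrow> vec" where
  "YTb V \<omega> I s u = (if s \<notin> I u then vscale xx (bv u)
      else (\<lambda>v. (if v = u then - xinv else 0) + (if v \<in> V \<and> s \<notin> I v then \<omega> u v else 0)))"

definition YT :: "perm set \<Rightarrow> (perm \<Rightarrow> perm \<Rightarrow> lpoly) \<Rightarrow> (perm \<Rightarrow> perm set) \<Rightarrow> perm \<Rightarrow> vec \<Rightarrow> vec" where
  "YT V \<omega> I s = lin_ext V (YTb V \<omega> I s)"

definition is_Wgraph :: "ctype \<Rightarrow> nat \<Rightarrow> perm set \<Rightarrow> (perm \<Rightarrow> perm \<Rightarrow> lpoly) \<Rightarrow> (perm \<Rightarrow> perm set) \<Rightarrow> bool" where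
  "is_Wgraph t n V \<omega> I \<longleftrightarrow> (\<forall>u\<in>V. I u \<subseteq> Sgens t n) \<and>
     (\<exists>\<rho>. is_Hmodule_rep t n (fspace V) \<rho> \<and>
          (\<forall>s\<in>Sgens t n. \<forall>v\<in>fspace V. \<rho> (bv s) v = YT V \<omega> I s v))"

definition quasi_admissible :: "perm set \<Rightarrow> (perm \<Rightarrow> perm \<Rightarrow> lpoly) \<Rightarrow> (perm \<Rightarrow> perm set) \<Rightarrow> bool" where
  "quasi_admissible V \<omega> I \<longleftrightarrow>
     (\<exists>A B. A \<inter> B = {} \<and> A \<union> B = V \<and>
        (\<forall>u\<in>V. \<forall>v\<in>V. \<omega> u v \<noteq> 0 \<longrightarrow> (u \<in> A \<and> v \<in> B) \<or> (u \<in> B \<and> v \<in> A))) \<and>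
     (\<forall>u\<in>V. \<forall>v\<in>V. \<omega> u v \<in> range lconst) \<and>
     (\<forall>u\<in>V. \<forall>v\<in>V. I u \<subseteq> I v \<longrightarrow> \<omega> u v = 0) \<and>
     (\<forall>u\<in>V. \<forall>v\<in>V. \<not> I u \<subseteq> I v \<and> \<not> I v \<subseteq> I u \<longrightarrow> \<omega> u v = \<omega> v u)"

definition H_iso :: "ctype \<Rightarrow> nat \<Rightarrow> perm set \<Rightarrow> (perm \<Rightarrow> vec \<Rightarrow> vec) \<Rightarrow> (perm \<Rightarrow> vec \<Rightarrow> vec) \<Rightarrow> (vec \<Rightarrow> vec) \<Rightarrow> bool" where
  "H_iso t n V T1 T2 \<phi> \<longleftrightarrow> bij_betw \<phi> (fspace V) (fspace V) \<and>
     (\<forall>a\<in>Hset t n. \<forall>v\<in>fspace V. \<phi> (hact t n T1 a v) = hact t n T2 a (\<phi> v))"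

end

theory Submission
  imports Defs "HOL-Library.Function_Algebras"
begin

text \<open>
  Both modules have a basis indexed by a graph whose edges are conjugations by simple reflections, with
  a height function. Their braid relations need testing only on basis vectors without strict
  descents in the dihedral subgroup concerned, because the set of vectors satisfying such a relation is
  stable under both generators.

  On the full conjugacy class of fixed-point-free involutions the bar operator is
  \<open>M\<^sub>z \<mapsto> C H\<^sub>z\<^sup>-\<^sup>1 M\<^sub>z\<close> with a constant \<open>C\<close>. Each \<open>z\<close> in \<open>\<G>\<close> sends a set \<open>K\<close> of positions beyond \<open>n\<close> into
  \<open>\<plusminus>[n]\<close>; the \<open>M\<^sub>z\<close> with given \<open>K\<close> span a quotient of the module of the full class in rank \<open>2 n\<close>, and the
  kernel of the quotient map is stable under the bar operator, which therefore descends.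

  Given the bar operator, triangularity produces the canonical basis, and as for Kazhdan-Lusztig bases
  \<open>H\<^sub>s\<close> acts on a canonical basis element through the \<open>\<mu>\<close>-coefficients. Bipartiteness comes from the
  twist \<open>x \<mapsto> -x\<close>, which commutes with the bar operator.
\<close>

section \<open>Laurent polynomials\<close>

text \<open>Uniqueness of a bar operator is easy, because ascents reach every basis vector from the
  ones it has to fix. Existence is the obstacle: different chains of ascents may end at the same
  vector. On the full class the formula with the inverse of \<open>H_z\<close> avoids choosing a
  chain, and the constant C cancels the scalar of that inverse at the minimal vector; one constant
  suffices because the full class has at most one such vector. For the smaller set no such formula
  is at hand, since a generator in \<open>Asc^=\<close> is a loop there but moves \<open>z\<close>
  in the full class. Now \<open>z s z = s_j\<close> for some \<open>j > n\<close>, so conjugation by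
  \<open>s\<close> and by \<open>s_j\<close> send \<open>z\<close> to the same involution, and
  imposing \<open>H_j = cA\<close> turns this move into the required loop. This dictates the
  quotient. M and N differ only in the scalars of the two kinds of loops,
  \<open>(cA, cD) = (-x^-1, x)\<close> and \<open>(x, -x^-1)\<close>. The arguments use only that
  each scalar is a root of the quadratic relation, so one development with parameters serves both.
  The relations of the W-graph module are never checked directly but pulled back along the canonical
  basis.\<close>

abbreviation (input) dd :: lpoly where "dd \<equiv> xx - xinv"

lemma lookup_single_mult:
  fixes p :: lpoly
  shows "Poly_Mapping.lookup (Poly_Mapping.single a c * p) k = c * Poly_Mapping.lookup p (k - a)"
proof -
  have eq: "(k = a + q) = (q = k - a)" for q by auto
  have "Poly_Mapping.lookup (Poly_Mapping.single a c * p) k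
      = (\<Sum>l. (c * (\<Sum>q. Poly_Mapping.lookup p q when k = l + q)) when a = l)"
    by (simp add: lookup_mult lookup_single when_mult)
  also have "\<dots> = c * (\<Sum>q. Poly_Mapping.lookup p q when q = k - a)"
    by (simp add: eq)
  finally show ?thesis by simp
qed

lemma lookup_xx_mult: "Poly_Mapping.lookup (xx * p) k = Poly_Mapping.lookup p (k - 1)"
  by (simp add: xx_def lookup_single_mult)

lemma lookup_xinv_mult: "Poly_Mapping.lookup (xinv * p) k = Poly_Mapping.lookup p (k + 1)"
  by (simp add: xinv_def lookup_single_mult)

lemma xx_xinv [simp]: "xx * xinv = 1" "xinv * xx = 1"
  by (simp_all add: xx_def xinv_def mult_single)

lemma lookup_lbar: "Poly_Mapping.lookup (lbar p) k = Poly_Mapping.lookup p (- k)"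
proof -
  have "inj (uminus :: int \<Rightarrow> int)" by (simp add: inj_def)
  then show ?thesis by (simp add: lbar_def map_key.rep_eq)
qed

text \<open>The substitution \<open>x \<mapsto> -x\<close>.\<close>

definition lsgn :: "lpoly \<Rightarrow> lpoly" where
  "lsgn p = Poly_Mapping.mapp (\<lambda>k c. if even k then c else - c) p"

lemma lookup_lsgn:
  "Poly_Mapping.lookup (lsgn p) k = (if even k then 1 else - 1) * Poly_Mapping.lookup p k"
  by (auto simp: lsgn_def lookup_mapp when_def in_keys_iff)

text \<open>Semilinear maps over the identity, \<open>x \<mapsto> x\<^sup>-\<^sup>1\<close> and \<open>x \<mapsto> -x\<close> all occur, so the coefficient map
  \<open>\<sigma>\<close> is a parameter.\<close>

definition ringhom :: "(lpoly \<Rightarrow> lpoly) \<Rightarrow> bool" where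
  "ringhom \<sigma> \<longleftrightarrow> \<sigma> 0 = 0 \<and> \<sigma> 1 = 1 \<and> (\<forall>p q. \<sigma> (p + q) = \<sigma> p + \<sigma> q) \<and> (\<forall>p q. \<sigma> (p * q) = \<sigma> p * \<sigma> q)"

lemma ringhomD:
  assumes "ringhom \<sigma>"
  shows "\<sigma> 0 = 0" "\<sigma> 1 = 1" "\<sigma> (p + q) = \<sigma> p + \<sigma> q" "\<sigma> (p * q) = \<sigma> p * \<sigma> q"
    "\<sigma> (- p) = - \<sigma> p" "\<sigma> (p - q) = \<sigma> p - \<sigma> q"
proof -
  show *: "\<sigma> 0 = 0" "\<sigma> 1 = 1" "\<sigma> (p + q) = \<sigma> p + \<sigma> q" "\<sigma> (p * q) = \<sigma> p * \<sigma> q" for p q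
    using assms by (auto simp: ringhom_def)
  show neg: "\<sigma> (- p) = - \<sigma> p" for p
    using *(3)[of p "- p"] *(1) by (simp add: eq_neg_iff_add_eq_0 add.commute)
  show "\<sigma> (p - q) = \<sigma> p - \<sigma> q"
    using *(3)[of p "- q"] neg by simp
qed

lemma ringhom_id [simp]: "ringhom (\<lambda>c. c)"
  by (simp add: ringhom_def)

text \<open>Both sides respect differences in \<open>p\<close>, so by the induction principle for
  free abelian groups it is enough to test monomials as left factor.\<close>

lemma lpoly_mult_hom:
  fixes \<sigma> :: "lpoly \<Rightarrow> lpoly"
  assumes z: "\<sigma> 0 = 0" and d: "\<And>p q. \<sigma> (p - q) = \<sigma> p - \<sigma> q"
    and m: "\<And>a q. \<sigma> (Poly_Mapping.single a 1 * q) = \<sigma> (Poly_Mapping.single a 1) * \<sigma> q"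
  shows "\<sigma> (p * q) = \<sigma> p * \<sigma> q"
proof -
  have "Poly_Mapping.keys p \<subseteq> UNIV" by simp
  then show ?thesis
  proof (induction p rule: frag_induction)
    case zero then show ?case by (simp add: z)
  next
    case (one a) then show ?case by (simp only: m)
  next
    case (diff a b) then show ?case by (simp add: left_diff_distrib d)
  qed
qed

lemma ringhom_lbar [simp]: "ringhom lbar"
proof -
  have "lbar (p * q) = lbar p * lbar q" for p q
  proof (rule lpoly_mult_hom)
    have s: "lbar (Poly_Mapping.single a 1) = Poly_Mapping.single (- a) 1" for a
      by (rule poly_mapping_eqI) (auto simp: lookup_lbar lookup_single when_def)
    show "lbar (Poly_Mapping.single a 1 * q) = lbar (Poly_Mapping.single a 1) * lbar q" for a q
      by (rule poly_mapping_eqI) (simp add: s lookup_lbar lookup_single_mult)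
  qed (auto intro!: poly_mapping_eqI simp: lookup_lbar lookup_minus)
  then show ?thesis
    by (auto simp: ringhom_def lookup_lbar lookup_add lookup_one when_def intro!: poly_mapping_eqI)
qed

lemma ringhom_lsgn [simp]: "ringhom lsgn"
proof -
  have "lsgn (p * q) = lsgn p * lsgn q" for p q
  proof (rule lpoly_mult_hom)
    have s: "lsgn (Poly_Mapping.single a 1) = Poly_Mapping.single a (if even a then 1 else -1)" for a
      by (rule poly_mapping_eqI) (auto simp: lookup_lsgn lookup_single when_def)
    show "lsgn (Poly_Mapping.single a 1 * q) = lsgn (Poly_Mapping.single a 1) * lsgn q" for a q
      by (rule poly_mapping_eqI) (auto simp: s lookup_lsgn lookup_single_mult)
  qed (auto intro!: poly_mapping_eqI simp: lookup_lsgn lookup_minus)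
  then show ?thesis
    by (auto simp: ringhom_def lookup_lsgn lookup_add lookup_one when_def intro!: poly_mapping_eqI)
qed

lemma lbar_xx [simp]: "lbar xx = xinv" "lbar xinv = xx"
  by (auto intro!: poly_mapping_eqI simp: lookup_lbar xx_def xinv_def lookup_single when_def)

lemma lsgn_xx [simp]: "lsgn xx = - xx" "lsgn xinv = - xinv"
  by (auto intro!: poly_mapping_eqI simp: lookup_lsgn xx_def xinv_def lookup_single when_def)

lemma lbar_lbar [simp]: "lbar (lbar p) = p"
  by (rule poly_mapping_eqI) (simp add: lookup_lbar)

lemma lsgn_lsgn [simp]: "lsgn (lsgn p) = p"
  by (rule poly_mapping_eqI) (simp add: lookup_lsgn)

lemma lbar_lsgn: "lbar (lsgn p) = lsgn (lbar p)"
  by (rule poly_mapping_eqI) (simp add: lookup_lsgn lookup_lbar)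

lemma xx_neq: "xx \<noteq> - xinv"
proof
  assume "xx = - xinv"
  then have "Poly_Mapping.lookup xx 1 = Poly_Mapping.lookup (- xinv) 1" by simp
  then show False by (simp add: xx_def xinv_def lookup_single when_def)
qed

lemma negpart_0 [simp]: "0 \<in> negpart" by (simp add: negpart_def)
lemma negpart_add: "p \<in> negpart \<Longrightarrow> q \<in> negpart \<Longrightarrow> p + q \<in> negpart"
  by (simp add: negpart_def lookup_add)
lemma negpart_diff: "p \<in> negpart \<Longrightarrow> q \<in> negpart \<Longrightarrow> p - q \<in> negpart"
  by (simp add: negpart_def lookup_minus)
lemma negpart_lconst: "p \<in> negpart \<Longrightarrow> lconst c * p \<in> negpart"
  by (simp add: negpart_def lconst_def lookup_single_mult)

definition nonpos_lpoly :: "lpoly set" where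
  "nonpos_lpoly = {p. \<forall>k>0. Poly_Mapping.lookup p k = 0}"

definition coeff0 :: "lpoly \<Rightarrow> int" where "coeff0 p = Poly_Mapping.lookup p 0"

lemma nonpos_sub_coeff0: "p \<in> nonpos_lpoly \<Longrightarrow> p - lconst (coeff0 p) \<in> negpart"
  by (auto simp: nonpos_lpoly_def negpart_def coeff0_def lconst_def lookup_minus lookup_single when_def)

lemma lbar_lconst [simp]: "lbar (lconst c) = lconst c"
  by (rule poly_mapping_eqI) (auto simp: lookup_lbar lconst_def lookup_single when_def)

lemma lconst_simps: "lconst 0 = 0" "lconst 1 = 1" "lconst (- c) = - lconst c"
    "lconst (c + d) = lconst c + lconst d"
  by (simp_all add: lconst_def single_uminus single_add)

lemma negpart_lbar_eq_0:
  assumes "p \<in> negpart" "lbar p = p" shows "p = 0"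
proof (rule poly_mapping_eqI)
  fix k
  have "Poly_Mapping.lookup p k = Poly_Mapping.lookup p (- k)"
    using lookup_lbar[of p k] assms(2) by simp
  then show "Poly_Mapping.lookup p k = Poly_Mapping.lookup 0 k"
    using assms(1) by (cases "k \<ge> 0") (auto simp: negpart_def)
qed

text \<open>The existence half of the Kazhdan-Lusztig argument for one coefficient
  (\<open>negpart_lbar_eq_0\<close> is the uniqueness half): an antisymmetric \<open>p\<close> has
  constant term 0, so its negative half determines it.\<close>

lemma lbar_antisym_split:
  assumes "lbar p = - p" shows "\<exists>q\<in>negpart. q - lbar q = p"
proof
  define q where "q = Poly_Mapping.mapp (\<lambda>k c. if k < 0 then c else 0) p"
  have q: "Poly_Mapping.lookup q k = (if k < 0 then Poly_Mapping.lookup p k else 0)" for k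
    by (auto simp: q_def lookup_mapp when_def in_keys_iff)
  show "q \<in> negpart" by (simp add: negpart_def q)
  have a: "Poly_Mapping.lookup p (- k) = - Poly_Mapping.lookup p k" for k
    using lookup_lbar[of p k] assms by simp
  show "q - lbar q = p"
    using a a[of 0] by (intro poly_mapping_eqI) (auto simp: lookup_minus q lookup_lbar)
qed

text \<open>As a power series in \<open>x^-1\<close> the inverse of \<open>x + x^-1\<close> is
  \<open>x^-1 - x^-3 + x^-5 - ...\<close>, which never terminates. A nonzero \<open>c\<close> would
  force a multiple of it on \<open>p\<close>.\<close>

lemma negpart_xx_plus_xinv:
  assumes n: "p \<in> negpart" and e: "(xx + xinv) * p = lconst c"
  shows "c = 0"
proof (rule ccontr)
  assume c: "c \<noteq> 0"
  have rec: "Poly_Mapping.lookup p (k - 1) + Poly_Mapping.lookup p (k + 1) = (if k = 0 then c else 0)" for k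
    using arg_cong[OF e, of "\<lambda>q. Poly_Mapping.lookup q k"]
    by (simp add: distrib_right lookup_add lookup_xx_mult lookup_xinv_mult lconst_def lookup_single when_def)
  have "\<bar>Poly_Mapping.lookup p (- 1 - 2 * int j)\<bar> = \<bar>c\<bar>" for j
  proof (induction j)
    case 0 then show ?case using rec[of 0] n by (simp add: negpart_def)
  next
    case (Suc j)
    have "- 1 - 2 * int (Suc j) = (- 2 - 2 * int j) - 1" "(- 2 - 2 * int j) + 1 = - 1 - 2 * int j" by simp_all
    then have "Poly_Mapping.lookup p (- 1 - 2 * int (Suc j)) = - Poly_Mapping.lookup p (- 1 - 2 * int j)"
      using rec[of "- 2 - 2 * int j"] by simp
    then show ?case using Suc by simp
  qed
  then have "Poly_Mapping.lookup p (- 1 - 2 * int j) \<noteq> 0" for j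
    using c by (metis abs_eq_0)
  then have "(\<lambda>j::nat. - 1 - 2 * int j) ` UNIV \<subseteq> Poly_Mapping.keys p"
    by (simp only: image_subset_iff in_keys_iff) blast
  moreover have "infinite ((\<lambda>j::nat. - 1 - 2 * int j) ` UNIV)"
    using infinite_UNIV_nat by (subst finite_image_iff) (auto simp: inj_def)
  ultimately show False using finite_subset finite_keys by metis
qed

section \<open>Free modules and semilinear maps\<close>

lemma vadd_plus [simp]: "vadd u v = u + v" by (simp add: vadd_def plus_fun_def)

lemma vscale_apply [simp]: "vscale c v y = c * v y" by (simp add: vscale_def)

lemma vscale_simps:
  "vscale c (u + v) = vscale c u + vscale c v"
  "vscale c (u - v) = vscale c u - vscale c v"
  "vscale (c + d) v = vscale c v + vscale d v"
  "vscale (c - d) v = vscale c v - vscale d v"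
  "vscale c (vscale d v) = vscale (c * d) v"
  "vscale (- c) v = - vscale c v" "vscale c (- v) = - vscale c v"
  "vscale c 0 = 0"
  by (simp_all add: fun_eq_iff algebra_simps)

lemma vscale_1 [simp]: "vscale 1 v = v" "vscale 0 v = 0" "vscale (- 1) v = - v"
  by (simp_all add: fun_eq_iff)

lemma fspace_simps [simp, intro]:
  "0 \<in> fspace V"
  "u \<in> fspace V \<Longrightarrow> v \<in> fspace V \<Longrightarrow> u + v \<in> fspace V"
  "u \<in> fspace V \<Longrightarrow> v \<in> fspace V \<Longrightarrow> u - v \<in> fspace V"
  "u \<in> fspace V \<Longrightarrow> vscale c u \<in> fspace V"
  "u \<in> fspace V \<Longrightarrow> - u \<in> fspace V"
  "z \<in> V \<Longrightarrow> bv z \<in> fspace V"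
  by (auto simp: fspace_def bv_def)

lemma fspace_sum [intro]: "(\<And>i. i \<in> A \<Longrightarrow> f i \<in> fspace V) \<Longrightarrow> sum f A \<in> fspace V"
  by (induction A rule: infinite_finite_induct) auto

lemma sum_apply: "sum f A y = (\<Sum>i\<in>A. f i (y :: 'a) :: 'b::comm_monoid_add)"
  by (induction A rule: infinite_finite_induct) auto

lemma fspace_expand:
  assumes "finite V" "v \<in> fspace V" shows "v = (\<Sum>z\<in>V. vscale (v z) (bv z))"
proof
  fix y
  have "(\<Sum>z\<in>V. vscale (v z) (bv z)) y = (\<Sum>z\<in>V. if z = y then v y else 0)"
    unfolding sum_apply by (rule sum.cong) (auto simp: bv_def)
  also have "\<dots> = v y" using assms by (auto simp: fspace_def)
  finally show "v y = (\<Sum>z\<in>V. vscale (v z) (bv z)) y" by simp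
qed

lemma fspace_induct [consumes 2, case_names zero basis add]:
  assumes "finite V" "v \<in> fspace V" and "P 0" and "\<And>c z. z \<in> V \<Longrightarrow> P (vscale c (bv z))"
    and "\<And>u v. u \<in> fspace V \<Longrightarrow> v \<in> fspace V \<Longrightarrow> P u \<Longrightarrow> P v \<Longrightarrow> P (u + v)"
  shows "P v"
proof -
  have "P (\<Sum>z\<in>A. vscale (v z) (bv z))" if "finite A" "A \<subseteq> V" for A
    using that by (induction A) (auto intro!: assms(3-5))
  from this[of V] show ?thesis using fspace_expand[OF assms(1,2)] assms(1) by simp
qed

definition slin :: "(lpoly \<Rightarrow> lpoly) \<Rightarrow> perm set \<Rightarrow> perm set \<Rightarrow> (vec \<Rightarrow> vec) \<Rightarrow> bool" where
  "slin \<sigma> V V' T \<longleftrightarrow> (\<forall>v\<in>fspace V. T v \<in> fspace V') \<and>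
     (\<forall>u\<in>fspace V. \<forall>v\<in>fspace V. T (u + v) = T u + T v) \<and>
     (\<forall>c. \<forall>v\<in>fspace V. T (vscale c v) = vscale (\<sigma> c) (T v))"

abbreviation lin :: "perm set \<Rightarrow> perm set \<Rightarrow> (vec \<Rightarrow> vec) \<Rightarrow> bool" where
  "lin \<equiv> slin (\<lambda>c. c)"

lemma slinD:
  assumes "slin \<sigma> V V' T"
  shows "v \<in> fspace V \<Longrightarrow> T v \<in> fspace V'"
    "u \<in> fspace V \<Longrightarrow> v \<in> fspace V \<Longrightarrow> T (u + v) = T u + T v"
    "v \<in> fspace V \<Longrightarrow> T (vscale c v) = vscale (\<sigma> c) (T v)"
  using assms by (auto simp: slin_def)

lemma slin_zero: "slin \<sigma> V V' T \<Longrightarrow> T 0 = 0"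
  using slinD(2)[of \<sigma> V V' T 0 0] by simp

lemma slin_uminus: "slin \<sigma> V V' T \<Longrightarrow> v \<in> fspace V \<Longrightarrow> T (- v) = - T v"
  using slinD(2)[of \<sigma> V V' T v "- v"] slin_zero[of \<sigma> V V' T]
  by (simp add: eq_neg_iff_add_eq_0 add.commute)

lemma slin_minus: "slin \<sigma> V V' T \<Longrightarrow> u \<in> fspace V \<Longrightarrow> v \<in> fspace V \<Longrightarrow> T (u - v) = T u - T v"
  using slinD(2)[of \<sigma> V V' T u "- v"] slin_uminus[of \<sigma> V V' T v] by simp

lemma slin_sum:
  assumes "slin \<sigma> V V' T" "\<And>i. i \<in> A \<Longrightarrow> f i \<in> fspace V"
  shows "T (sum f A) = (\<Sum>i\<in>A. T (f i))"
  using assms(2)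
  by (induction A rule: infinite_finite_induct)
    (simp_all add: slin_zero[OF assms(1)] slinD(2)[OF assms(1)] fspace_sum)

lemma slin_eqI:
  assumes "finite V" "slin \<sigma> V V' A" "slin \<sigma> V V'' B" "\<And>z. z \<in> V \<Longrightarrow> A (bv z) = B (bv z)"
    and "v \<in> fspace V"
  shows "A v = B v"
  using assms(1,5)
proof (induction v rule: fspace_induct)
  case zero show ?case by (simp only: slin_zero[OF assms(2)] slin_zero[OF assms(3)])
next
  case (basis c z)
  then show ?case
    by (simp only: slinD(3)[OF assms(2)] slinD(3)[OF assms(3)] assms(4) fspace_simps)
next
  case (add u v)
  then show ?case by (simp only: slinD(2)[OF assms(2)] slinD(2)[OF assms(3)])
qed

lemma slin_ident: "lin V V (\<lambda>v. v)" by (simp add: slin_def)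

lemma slin_comp:
  "slin \<sigma> V V' A \<Longrightarrow> slin \<tau> V' V'' B \<Longrightarrow> slin (\<lambda>c. \<tau> (\<sigma> c)) V V'' (\<lambda>v. B (A v))"
  by (simp add: slin_def)

lemma slin_plus: "slin \<sigma> V V' A \<Longrightarrow> slin \<sigma> V V' B \<Longrightarrow> slin \<sigma> V V' (\<lambda>v. A v + B v)"
  by (simp add: slin_def vscale_simps algebra_simps)

lemma slin_diff: "slin \<sigma> V V' A \<Longrightarrow> slin \<sigma> V V' B \<Longrightarrow> slin \<sigma> V V' (\<lambda>v. A v - B v)"
  by (simp add: slin_def vscale_simps algebra_simps)

lemma slin_scale: "slin \<sigma> V V' A \<Longrightarrow> slin \<sigma> V V' (\<lambda>v. vscale d (A v))"
  by (simp add: slin_def vscale_simps algebra_simps mult.commute)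

definition slin_ext :: "(lpoly \<Rightarrow> lpoly) \<Rightarrow> perm set \<Rightarrow> (perm \<Rightarrow> vec) \<Rightarrow> vec \<Rightarrow> vec" where
  "slin_ext \<sigma> V b f = (\<lambda>y. \<Sum>u\<in>V. \<sigma> (f u) * b u y)"

lemma lin_ext_slin_ext: "lin_ext V b = slin_ext (\<lambda>c. c) V b"
  by (simp add: lin_ext_def slin_ext_def fun_eq_iff)

lemma slin_slin_ext:
  assumes "ringhom \<sigma>" "\<And>u. u \<in> V \<Longrightarrow> b u \<in> fspace V'"
  shows "slin \<sigma> V V' (slin_ext \<sigma> V b)"
  using assms(2)
  by (auto simp: slin_def slin_ext_def fspace_def fun_eq_iff ringhomD[OF assms(1)] distrib_right
      sum.distrib sum_distrib_left mult.assoc intro!: sum.neutral)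

lemma slin_ext_bv:
  assumes "ringhom \<sigma>" "finite V" "z \<in> V"
  shows "slin_ext \<sigma> V b (bv z) = b z"
proof
  fix y
  have "slin_ext \<sigma> V b (bv z) y = (\<Sum>u\<in>V. if u = z then b z y else 0)"
    unfolding slin_ext_def by (rule sum.cong) (auto simp: bv_def ringhomD[OF assms(1)])
  then show "slin_ext \<sigma> V b (bv z) y = b z y" using assms by simp
qed

lemma lin_lin_ext: "(\<And>u. u \<in> V \<Longrightarrow> b u \<in> fspace V') \<Longrightarrow> lin V V' (lin_ext V b)"
  by (simp add: lin_ext_slin_ext slin_slin_ext)

lemma lin_ext_bv: "finite V \<Longrightarrow> z \<in> V \<Longrightarrow> lin_ext V b (bv z) = b z"
  by (simp add: lin_ext_slin_ext slin_ext_bv)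

text \<open>The induction method produces eta-expanded vectors, which these rules would take apart.\<close>

lemmas vec_apply = zero_fun_apply plus_fun_apply vscale_apply minus_apply uminus_apply

declare vec_apply [simp del]

section \<open>Modules given by generator graphs\<close>

text \<open>The step \<open>h (act s z) = h z + 2\<close> matches conjugation, which changes Coxeter length by two.\<close>

locale hgraph =
  fixes V S :: "perm set" and act :: "perm \<Rightarrow> perm \<Rightarrow> perm" and Up Dn :: "perm \<Rightarrow> perm \<Rightarrow> bool"
    and lc :: "perm \<Rightarrow> perm \<Rightarrow> lpoly" and h :: "perm \<Rightarrow> nat"
  assumes finV: "finite V"
    and up: "\<lbrakk>s \<in> S; z \<in> V; Up s z\<rbrakk> \<Longrightarrow>
        act s z \<in> V \<and> \<not> Dn s z \<and> Dn s (act s z) \<and> act s (act s z) = z \<and> h (act s z) = h z + 2"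
    and dn: "\<lbrakk>s \<in> S; z \<in> V; Dn s z\<rbrakk> \<Longrightarrow> act s z \<in> V \<and> Up s (act s z) \<and> act s (act s z) = z"
    and loop: "\<lbrakk>s \<in> S; z \<in> V; \<not> Up s z; \<not> Dn s z\<rbrakk> \<Longrightarrow> lc s z = xx \<or> lc s z = - xinv"
begin

definition qb :: "perm \<Rightarrow> perm \<Rightarrow> vec" where
  "qb s z = (if Up s z then bv (act s z) else if Dn s z then bv (act s z) + vscale dd (bv z)
     else vscale (lc s z) (bv z))"

definition T :: "perm \<Rightarrow> vec \<Rightarrow> vec" where "T s = lin_ext V (qb s)"

text \<open>By \<open>T_quad\<close> this is the inverse of \<open>T s\<close>, hence the action of
  the bar of \<open>H_s\<close>.\<close>

definition T' :: "perm \<Rightarrow> vec \<Rightarrow> vec" where "T' s v = T s v - vscale dd v"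

lemma dn_h: "\<lbrakk>s \<in> S; z \<in> V; Dn s z\<rbrakk> \<Longrightarrow> h z = h (act s z) + 2"
  using dn[of s z] up[of s "act s z"] by auto

lemma up_dn: "\<lbrakk>s \<in> S; z \<in> V; Dn s z\<rbrakk> \<Longrightarrow> \<not> Up s z"
  using up by blast

lemma T_lin: "s \<in> S \<Longrightarrow> lin V V (T s)"
  unfolding T_def by (rule lin_lin_ext) (use up dn in \<open>auto simp: qb_def\<close>)

lemma T'_lin: "s \<in> S \<Longrightarrow> lin V V (T' s)"
  unfolding T'_def by (intro slin_diff T_lin slin_scale slin_ident)

lemmas T_closed = slinD(1)[OF T_lin] and T_add = slinD(2)[OF T_lin] and T_vscale = slinD(3)[OF T_lin]
lemmas T'_add = slinD(2)[OF T'_lin] and T'_vscale = slinD(3)[OF T'_lin]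

lemma T_bv: "z \<in> V \<Longrightarrow> T s (bv z) = qb s z"
  by (simp add: T_def lin_ext_bv finV)

lemma T_up: "\<lbrakk>z \<in> V; Up s z\<rbrakk> \<Longrightarrow> T s (bv z) = bv (act s z)"
  by (simp add: T_bv qb_def)
lemma T_dn: "\<lbrakk>s \<in> S; z \<in> V; Dn s z\<rbrakk> \<Longrightarrow> T s (bv z) = bv (act s z) + vscale dd (bv z)"
  using up_dn by (simp add: T_bv qb_def)
lemma T_loop: "\<lbrakk>z \<in> V; \<not> Up s z; \<not> Dn s z\<rbrakk> \<Longrightarrow> T s (bv z) = vscale (lc s z) (bv z)"
  by (simp add: T_bv qb_def)

lemma lin_comp: "lin V V A \<Longrightarrow> lin V V B \<Longrightarrow> lin V V (\<lambda>v. B (A v))"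
  by (simp add: slin_def)

lemma T_quad:
  assumes s: "s \<in> S" and v: "v \<in> fspace V"
  shows "T s (T s v) = v + vscale dd (T s v)"
proof (rule slin_eqI[OF finV _ _ _ v])
  show "lin V V (\<lambda>v. T s (T s v))" using slin_comp[OF T_lin T_lin] s by simp
  show "lin V V (\<lambda>v. v + vscale dd (T s v))" by (intro slin_plus slin_ident slin_scale T_lin s)
  fix z assume z: "z \<in> V"
  consider "Up s z" | "Dn s z" | "\<not> Up s z" "\<not> Dn s z" by blast
  then show "T s (T s (bv z)) = bv z + vscale dd (T s (bv z))"
  proof cases
    case 1 then show ?thesis using up[OF s z 1] s z by (simp add: T_up T_dn)
  next
    case 2
    then show ?thesis using dn[OF s z 2] s z by (simp add: T_up T_dn T_add T_vscale)
  next
    case 3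
    have "lc s z * lc s z = 1 + dd * lc s z"
      using loop[OF s z 3] by (auto simp: algebra_simps)
    then show ?thesis using 3 s z by (simp add: T_loop T_vscale vscale_simps flip: vscale_simps(3))
        (simp add: vec_apply fun_eq_iff algebra_simps)
  qed
qed

text \<open>Descents lower \<open>h\<close>, so every element is reached by ascents from one without
  descents. The set \<open>R\<close> may be a dihedral pair, as in the braid relations, or all of
  \<open>S\<close>.\<close>

lemma height_induct [consumes 1, case_names min up]:
  assumes "z \<in> V"
    and "\<And>z. z \<in> V \<Longrightarrow> \<forall>s\<in>R. \<not> Dn s z \<Longrightarrow> P z"
    and "\<And>s z. \<lbrakk>s \<in> R; z \<in> V; Up s z; P z\<rbrakk> \<Longrightarrow> P (act s z)"
    and "R \<subseteq> S"
  shows "P z"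
  using assms(1)
proof (induction "h z" arbitrary: z rule: less_induct)
  case less
  show ?case
  proof (cases "\<forall>s\<in>R. \<not> Dn s z")
    case True then show ?thesis using assms(2) less.prems by blast
  next
    case False
    then obtain s where s: "s \<in> R" "Dn s z" by blast
    then have s': "s \<in> S" using assms(4) by blast
    note d = dn[OF s' less.prems s(2)]
    have "P (act s z)" using less.hyps[of "act s z"] d dn_h[OF s' less.prems s(2)] by simp
    then show ?thesis using assms(3)[of s "act s z"] d s by auto
  qed
qed

text \<open>For each braid relation the set of vectors satisfying it is stable under both generators,
  so it suffices to test basis vectors without strict descents.\<close>

lemma braid2I:
  assumes st: "s \<in> S" "t \<in> S"
    and base: "\<And>z. z \<in> V \<Longrightarrow> \<not> Dn s z \<Longrightarrow> \<not> Dn t z \<Longrightarrow> T s (T t (bv z)) = T t (T s (bv z))"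
    and v: "v \<in> fspace V"
  shows "T s (T t v) = T t (T s v)"
proof (rule slin_eqI[OF finV _ _ _ v])
  show "lin V V (\<lambda>v. T s (T t v))" "lin V V (\<lambda>v. T t (T s v))"
    using lin_comp[OF T_lin T_lin] st by auto
  fix z assume "z \<in> V"
  then show "T s (T t (bv z)) = T t (T s (bv z))"
  proof (induction z rule: height_induct[where R="{s,t}"])
    case (min z) then show ?case using base by auto
  next
    case (up r z)
    have "T a (T b (T a (bv z))) = T b (T a (T a (bv z)))" if "{a,b} = {s,t}" for a b
    proof -
      have ab: "a \<in> S" "b \<in> S" using that st by auto
      have e: "T a (T b (bv z)) = T b (T a (bv z))"
        using up that by (auto simp: doubleton_eq_iff)
      have "T a (T b (T a (bv z))) = T a (T a (T b (bv z)))" by (simp only: e)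
      also have "\<dots> = T b (T a (T a (bv z)))"
        using ab up by (simp add: T_quad T_closed T_add T_vscale flip: e)
      finally show ?thesis .
    qed
    from this[of s t] this[of t s] show ?case
      using up(1) T_up[OF up(2,3)] by (auto simp: insert_commute)
  qed (use st in auto)
qed

lemma braid3I:
  assumes st: "s \<in> S" "t \<in> S"
    and base: "\<And>z. z \<in> V \<Longrightarrow> \<not> Dn s z \<Longrightarrow> \<not> Dn t z \<Longrightarrow>
      T s (T t (T s (bv z))) = T t (T s (T t (bv z)))"
    and v: "v \<in> fspace V"
  shows "T s (T t (T s v)) = T t (T s (T t v))"
proof (rule slin_eqI[OF finV _ _ _ v])
  show "lin V V (\<lambda>v. T s (T t (T s v)))" "lin V V (\<lambda>v. T t (T s (T t v)))"
    using lin_comp[OF lin_comp[OF T_lin T_lin] T_lin] st by auto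
  fix z assume "z \<in> V"
  then show "T s (T t (T s (bv z))) = T t (T s (T t (bv z)))"
  proof (induction z rule: height_induct[where R="{s,t}"])
    case (min z) then show ?case using base by auto
  next
    case (up r z)
    have "T a (T b (T a (T a (bv z)))) = T b (T a (T b (T a (bv z))))"
      if "{a,b} = {s,t}" for a b
    proof -
      have ab: "a \<in> S" "b \<in> S" using that st by auto
      have e: "T a (T b (T a (bv z))) = T b (T a (T b (bv z)))"
        using up that by (auto simp: doubleton_eq_iff)
      \<comment> \<open>Given the relation at \<open>bv z\<close>, \<open>T_quad\<close> brings both
        sides at \<open>T a (bv z)\<close> to \<open>T a (T b (bv z))\<close> plus \<open>dd\<close>
        times the common value of the relation at \<open>bv z\<close>.\<close>
      have "T b (T a (T b (T a (bv z)))) = T b (T b (T a (T b (bv z))))" by (simp only: e)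
      also have "\<dots> = T a (T b (bv z)) + vscale dd (T a (T b (T a (bv z))))"
        using ab up by (simp add: T_quad T_closed e)
      also have "\<dots> = T a (T b (T a (T a (bv z))))"
        using ab up by (simp add: T_quad T_closed T_add T_vscale)
      finally show ?thesis by simp
    qed
    from this[of s t] this[of t s] show ?case
      using up(1) T_up[OF up(2,3)] by (auto simp: insert_commute)
  qed (use st in auto)
qed

lemma braid4I:
  assumes st: "s \<in> S" "t \<in> S"
    and base: "\<And>z. z \<in> V \<Longrightarrow> \<not> Dn s z \<Longrightarrow> \<not> Dn t z \<Longrightarrow>
      T s (T t (T s (T t (bv z)))) = T t (T s (T t (T s (bv z))))"
    and v: "v \<in> fspace V"
  shows "T s (T t (T s (T t v))) = T t (T s (T t (T s v)))"
proof -
  define L where "L v = T s (T t (T s (T t v)))" for v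
  define R where "R v = T t (T s (T t (T s v)))" for v
  have "L v = R v"
  proof (rule slin_eqI[OF finV _ _ _ v])
    show "lin V V L" "lin V V R" unfolding L_def R_def
    using lin_comp[OF lin_comp[OF lin_comp[OF T_lin T_lin] T_lin] T_lin] st by auto
  fix z assume "z \<in> V"
  then show "L (bv z) = R (bv z)"
  proof (induction z rule: height_induct[where R="{s,t}"])
    case (min z) then show ?case using base by (auto simp: L_def R_def)
  next
    case (up r z)
    have "T b (T a (T b (T a (T a (bv z))))) = T a (T b (T a (T b (T a (bv z)))))"
      if "{a,b} = {s,t}" for a b
    proof -
      have ab: "a \<in> S" "b \<in> S" using that st by auto
      have e: "T b (T a (T b (T a (bv z)))) = T a (T b (T a (T b (bv z))))"
        using up that by (auto simp: doubleton_eq_iff L_def R_def)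
      have "T a (T b (T a (T b (T a (bv z))))) = T a (T a (T b (T a (T b (bv z)))))" by (simp only: e)
      also have "\<dots> = T b (T a (T b (bv z))) + vscale dd (T b (T a (T b (T a (bv z)))))"
        using ab up by (simp add: T_quad T_closed e)
      also have "\<dots> = T b (T a (T b (T a (T a (bv z)))))"
        using ab up by (simp add: T_quad T_closed T_add T_vscale)
      finally show ?thesis by simp
    qed
    from this[of s t] this[of t s] show ?case
      using up(1) T_up[OF up(2,3)] by (auto simp: insert_commute L_def R_def)
  qed (use st in auto)
  qed
  then show ?thesis by (simp only: L_def R_def)
qed

text \<open>Ascents carry basis vectors to basis vectors, so an intertwining map is determined by
  its values at the minimal ones. This gives the uniqueness of the bar operator, that it is an
  involution, and that it commutes with the sign twist.\<close>

lemma slin_determined: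
  assumes A: "slin \<sigma> V V' A" and B: "slin \<sigma> V V'' B"
    and AX: "\<And>s z. s \<in> S \<Longrightarrow> z \<in> V \<Longrightarrow> A (T s (bv z)) = X s (A (bv z))"
    and BX: "\<And>s z. s \<in> S \<Longrightarrow> z \<in> V \<Longrightarrow> B (T s (bv z)) = X s (B (bv z))"
    and min: "\<And>z. z \<in> V \<Longrightarrow> \<forall>s\<in>S. \<not> Dn s z \<Longrightarrow> A (bv z) = B (bv z)"
    and v: "v \<in> fspace V"
  shows "A v = B v"
proof (rule slin_eqI[OF finV A B _ v])
  fix z assume "z \<in> V"
  then show "A (bv z) = B (bv z)"
  proof (induction z rule: height_induct[where R=S])
    case (min z) then show ?case using assms(5) by auto
  next
    case (up s z) then show ?case using AX[of s z] BX[of s z] by (simp add: T_up)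
  qed auto
qed

text \<open>On a pair \<open>{y, act s y}\<close> the matrix of \<open>T s\<close> is symmetric,
  with rows \<open>(0, 1)\<close> and \<open>(1, dd)\<close>; coefficients therefore obey the same
  rule as basis vectors.\<close>

lemma T_coeff:
  assumes s: "s \<in> S" and y: "y \<in> V" and v: "v \<in> fspace V"
  shows "T s v y = (if Up s y then v (act s y) else if Dn s y then v (act s y) + dd * v y
     else lc s y * v y)"
  using finV v
proof (induction v rule: fspace_induct)
  case zero then show ?case unfolding slin_zero[OF T_lin[OF s]] by (simp add: vec_apply)
next
  case (add u v) then show ?case unfolding T_add[OF s add(1,2)] by (simp add: vec_apply algebra_simps)
next
  case (basis c z)
  have "T s (bv z) y = (if Up s y then bv z (act s y) else if Dn s y then bv z (act s y) + dd * bv z y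
     else lc s y * bv z y)"
    using up[OF s basis] dn[OF s basis] up[OF s y] dn[OF s y]
    unfolding T_bv[OF basis] qb_def
    by (cases "Up s y"; cases "Dn s y"; cases "Up s z"; cases "Dn s z") (auto simp: bv_def vec_apply)
  then show ?case using basis s by (simp only: T_vscale fspace_simps) (simp add: vec_apply algebra_simps)
qed

end

section \<open>Canonical bases and W-graphs\<close>

locale bar_graph = hgraph +
  fixes \<beta> :: "vec \<Rightarrow> vec"
  assumes bar_slin: "slin lbar V V \<beta>"
    and bar_T_bv: "s \<in> S \<Longrightarrow> z \<in> V \<Longrightarrow> \<beta> (T s (bv z)) = T' s (\<beta> (bv z))"
    and bar_min: "z \<in> V \<Longrightarrow> \<forall>s\<in>S. \<not> Dn s z \<Longrightarrow> \<beta> (bv z) = bv z"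
begin

lemmas bar_closed = slinD(1)[OF bar_slin] and bar_add = slinD(2)[OF bar_slin]
  and bar_vscale = slinD(3)[OF bar_slin]
  and bar_minus = slin_minus[OF bar_slin] and bar_uminus = slin_uminus[OF bar_slin]

lemma bar_T: "s \<in> S \<Longrightarrow> v \<in> fspace V \<Longrightarrow> \<beta> (T s v) = T' s (\<beta> v)"
  using slin_eqI[OF finV slin_comp[OF T_lin bar_slin] slin_comp[OF bar_slin T'_lin], of s s v] bar_T_bv
  by simp

lemma bar_T': "s \<in> S \<Longrightarrow> v \<in> fspace V \<Longrightarrow> \<beta> (T' s v) = T s (\<beta> v)"
  by (simp add: T'_def bar_minus bar_vscale T_closed bar_T ringhomD)
    (simp add: vec_apply fun_eq_iff algebra_simps)

lemma bar_bar: "v \<in> fspace V \<Longrightarrow> \<beta> (\<beta> v) = v"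
  by (rule slin_determined[where \<sigma>="\<lambda>c. c" and A="\<lambda>v. \<beta> (\<beta> v)" and B="\<lambda>v. v" and X=T])
    (use slin_comp[OF bar_slin bar_slin] in
      \<open>auto intro: slin_ident simp: bar_T bar_T' bar_closed bar_min\<close>)

lemma T'_filtered:
  assumes s: "s \<in> S" and v: "v \<in> fspace {y \<in> V. h y < d}"
  shows "T' s v \<in> fspace {y \<in> V. h y < d + 2}"
proof -
  have fin: "finite {y \<in> V. h y < d}" using finV by simp
  show ?thesis using fin v
  proof (induction v rule: fspace_induct)
    case zero then show ?case by (simp add: slin_zero[OF T'_lin[OF s]])
  next
    case (add u v)
    then have "u \<in> fspace V" "v \<in> fspace V" by (auto simp: fspace_def)
    then show ?case using add by (simp add: T'_add s)
  next
    case (basis c z)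
    have "T' s (bv z) \<in> fspace {y \<in> V. h y < d + 2}"
      unfolding T'_def using basis up[OF s, of z] dn[OF s, of z] dn_h[OF s, of z] s
      by (auto simp: T_bv qb_def intro!: fspace_simps)
    then show ?case using basis s by (simp add: T'_vscale)
  qed
qed

text \<open>An ascent applies \<open>T' s\<close>. This raises the heights of the lower terms by at
  most 2, while the leading term moves up by exactly 2, so strict inequality survives.\<close>

lemma bar_triangular: "z \<in> V \<Longrightarrow> \<beta> (bv z) - bv z \<in> fspace {y \<in> V. h y < h z}"
proof (induction z rule: height_induct[where R=S])
  case (min z) then show ?case by (simp add: bar_min)
next
  case (up s z)
  have "\<beta> (bv (act s z)) = T' s (\<beta> (bv z))"
    using bar_T_bv[of s z] up by (simp add: T_up)
  also have "\<dots> = T' s (bv z) + T' s (\<beta> (bv z) - bv z)"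
    using up bar_closed T'_add[of s "bv z" "\<beta> (bv z) - bv z"] by simp
  finally have "\<beta> (bv (act s z)) - bv (act s z) = T' s (\<beta> (bv z) - bv z) - vscale dd (bv z)"
    using up by (simp add: T'_def[of s "bv z"] T_up)
  moreover have "T' s (\<beta> (bv z) - bv z) \<in> fspace {y \<in> V. h y < h z + 2}"
    using up T'_filtered by blast
  moreover have "h (act s z) = h z + 2" using up hgraph.up[OF hgraph_axioms] by blast
  ultimately show ?case using up by (auto intro!: fspace_simps)
qed simp

section \<open>Existence and uniqueness of the canonical basis\<close>

lemma bar_coeff:
  assumes v: "v \<in> fspace {z \<in> V. h z \<le> h y}" and y: "y \<in> V"
  shows "\<beta> v y = lbar (v y)"
proof -
  have "finite {z \<in> V. h z \<le> h y}" using finV by simp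
  then show ?thesis using v
  proof (induction v rule: fspace_induct)
    case zero then show ?case unfolding slin_zero[OF bar_slin] by (simp add: ringhomD vec_apply)
  next
    case (add u v)
    then have "u \<in> fspace V" "v \<in> fspace V" by (auto simp: fspace_def)
    then show ?case unfolding bar_add[OF \<open>u \<in> fspace V\<close> \<open>v \<in> fspace V\<close>]
      using add by (simp only: vec_apply ringhomD[OF ringhom_lbar])
  next
    case (basis c z)
    have "(\<beta> (bv z) - bv z) y = 0" using bar_triangular[of z] basis by (auto simp: fspace_def)
    then have "\<beta> (bv z) y = bv z y" by (simp add: vec_apply)
    also have "\<dots> = lbar (bv z y)" by (simp add: bv_def ringhomD)
    finally have "\<beta> (bv z) y = lbar (bv z y)" .
    have m: "\<beta> (vscale c (bv z)) = vscale (lbar c) (\<beta> (bv z))" using basis by (simp add: bar_vscale)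
    show ?case unfolding m unfolding vscale_apply by (simp add: ringhomD \<open>\<beta> (bv z) y = lbar (bv z y)\<close>)
  qed
qed

text \<open>At a place of greatest height in the support, \<beta> acts on the coefficient by
  \<open>lbar\<close>; this coefficient would be bar-invariant with negative exponents only.\<close>

lemma neg_invariant_eq_0:
  assumes v: "v \<in> fspace V" "\<beta> v = v" and neg: "\<And>y. y \<in> V \<Longrightarrow> v y \<in> negpart"
  shows "v = 0"
proof (rule ccontr)
  assume "v \<noteq> 0"
  then obtain x where "v x \<noteq> 0" by (auto simp: fun_eq_iff vec_apply)
  then have ne: "{y \<in> V. v y \<noteq> 0} \<noteq> {}" using v(1) by (auto simp: fspace_def)
  have fin: "finite (h ` {y \<in> V. v y \<noteq> 0})" using finV by simp
  with ne have "Max (h ` {y \<in> V. v y \<noteq> 0}) \<in> h ` {y \<in> V. v y \<noteq> 0}" by (intro Max_in) auto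
  then obtain y where y: "y \<in> V" "v y \<noteq> 0" and my: "h y = Max (h ` {y \<in> V. v y \<noteq> 0})" by auto
  have max: "h z \<le> h y" if "z \<in> V" "v z \<noteq> 0" for z
    unfolding my using that fin by (intro Max_ge) auto
  have "v \<in> fspace {z \<in> V. h z \<le> h y}" using v(1) max by (auto simp: fspace_def)
  from bar_coeff[OF this y(1)] v(2) have "lbar (v y) = v y" by simp
  then show False using negpart_lbar_eq_0 neg y by blast
qed

text \<open>The equation is solved from the top height downwards: there it decouples into
  antisymmetric coefficients, settled by \<open>lbar_antisym_split\<close>, and the rest stays
  anti-invariant because \<beta> is an involution. No coefficients of the bar operator have to be
  known.\<close>

lemma antiinvariant_split:
  assumes "u \<in> fspace {y \<in> V. h y < d}" "\<beta> u = - u"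
  shows "\<exists>p\<in>fspace {y \<in> V. h y < d}. (\<forall>y. p y \<in> negpart) \<and> p - \<beta> p = u"
  using assms
proof (induction d arbitrary: u)
  case 0
  then have "u = 0" by (auto simp: fspace_def fun_eq_iff vec_apply)
  moreover have "(0 :: vec) y \<in> negpart" for y by (simp add: vec_apply)
  ultimately show ?case using slin_zero[OF bar_slin] by (intro bexI[of _ 0]) auto
next
  case (Suc d)
  have uV: "u \<in> fspace V" using Suc.prems by (auto simp: fspace_def)
  have ub: "lbar (u y) = - u y" if "y \<in> V" "h y = d" for y
    using bar_coeff[of u y] that Suc.prems by (auto simp: fspace_def less_Suc_eq_le vec_apply)
  define q where "q = (\<lambda>y. if y \<in> V \<and> h y = d then SOME q. q \<in> negpart \<and> q - lbar q = u y else 0)"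
  have q: "q y \<in> negpart \<and> q y - lbar (q y) = u y" if "y \<in> V" "h y = d" for y
    using someI_ex[of "\<lambda>q. q \<in> negpart \<and> q - lbar q = u y"] lbar_antisym_split[OF ub[OF that]] that
    by (auto simp: q_def)
  have qn: "q y \<in> negpart" for y using q[of y] by (cases "y \<in> V \<and> h y = d") (auto simp: q_def)
  have qS: "q \<in> fspace {y \<in> V. h y \<le> d}" by (auto simp: fspace_def q_def)
  have qV: "q \<in> fspace V" by (auto simp: fspace_def q_def)
  have qS': "q \<in> fspace {y \<in> V. h y < Suc d}" by (auto simp: fspace_def q_def)
  define u' where "u' = u - (q - \<beta> q)"
  have bq: "\<beta> q y = lbar (q y)" if "y \<in> V" "h y \<ge> d" for y
    by (rule bar_coeff) (use qS that in \<open>auto simp: fspace_def\<close>)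
  have "u' y = 0" if "y \<notin> {y \<in> V. h y < d}" for y
  proof (cases "y \<in> V")
    case False
    then show ?thesis using uV qV bar_closed[OF qV] by (simp add: u'_def fspace_def vec_apply)
  next
    case True
    with that have "h y \<ge> d" by simp
    then show ?thesis
      using bq[OF True] q[OF True] Suc.prems(1) by (cases "h y = d") (auto simp: u'_def fspace_def q_def ringhomD vec_apply)
  qed
  then have "u' \<in> fspace {y \<in> V. h y < d}" by (simp add: fspace_def)
  moreover have "\<beta> u' = - u'"
    using Suc.prems(2) by (simp add: u'_def bar_minus uV qV bar_closed bar_bar)
  ultimately obtain p where p: "p \<in> fspace {y \<in> V. h y < d}" "\<And>y. p y \<in> negpart" "p - \<beta> p = u'"
    using Suc.IH by blast
  have pV: "p \<in> fspace V" and pS: "p \<in> fspace {y \<in> V. h y < Suc d}" using p(1) by (auto simp: fspace_def)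
  show ?case
  proof (intro bexI[of _ "p + q"] conjI allI)
    show "p + q \<in> fspace {y \<in> V. h y < Suc d}" using pS qS' by simp
    show "(p + q) y \<in> negpart" for y using p(2) qn by (simp add: negpart_add vec_apply)
    have "\<beta> (p + q) = \<beta> p + \<beta> q" using pV qV by (simp add: bar_add)
    then have "p + q - \<beta> (p + q) = (p - \<beta> p) + (q - \<beta> q)" by simp
    then show "p + q - \<beta> (p + q) = u" unfolding p(3) u'_def by simp
  qed
qed

definition is_can :: "perm \<Rightarrow> vec \<Rightarrow> bool" where
  "is_can z c \<longleftrightarrow> c \<in> fspace V \<and> \<beta> c = c \<and> c z = 1 \<and>
     (\<forall>y\<in>V. y \<noteq> z \<longrightarrow> c y \<in> negpart \<and> (c y \<noteq> 0 \<longrightarrow> h y < h z))"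

definition can :: "perm \<Rightarrow> vec" where "can z = (THE c. is_can z c)"

lemma is_can_unique:
  assumes "is_can z c" "is_can z c'" shows "c = c'"
proof -
  have "c - c' = 0"
  proof (rule neg_invariant_eq_0)
    show "c - c' \<in> fspace V" using assms by (auto simp: is_can_def)
    show "\<beta> (c - c') = c - c'"
      using assms bar_minus[of c c'] by (auto simp: is_can_def)
    show "(c - c') y \<in> negpart" if "y \<in> V" for y
      using assms that by (cases "y = z") (simp_all add: is_can_def negpart_diff vec_apply)
  qed
  then show ?thesis by simp
qed

lemma is_can_ex: assumes z: "z \<in> V" shows "\<exists>c. is_can z c"
proof -
  \<comment> \<open>\<open>bv z + p\<close> is bar-invariant exactly when
    \<open>p - \<beta> p\<close> is this vector.\<close>
  let ?u = "\<beta> (bv z) - bv z"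
  have "\<beta> ?u = - ?u" using z by (simp add: bar_minus bar_closed bar_bar)
  then obtain p where p: "p \<in> fspace {y \<in> V. h y < h z}" "\<And>y. p y \<in> negpart" "p - \<beta> p = ?u"
    using antiinvariant_split[OF bar_triangular[OF z]] by blast
  have pV: "p \<in> fspace V" using p(1) by (auto simp: fspace_def)
  have "is_can z (bv z + p)"
    unfolding is_can_def
  proof (intro conjI ballI impI)
    show "bv z + p \<in> fspace V" using z pV by simp
    have "\<beta> p = p - ?u" using p(3) by (simp add: algebra_simps)
    then show "\<beta> (bv z + p) = bv z + p" using z pV by (simp add: bar_add)
    show "(bv z + p) z = 1" using p(1) by (simp add: bv_def fspace_def vec_apply)
    fix y assume y: "y \<in> V" "y \<noteq> z"
    then show "(bv z + p) y \<in> negpart" using p(2) by (simp add: bv_def vec_apply)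
    assume "(bv z + p) y \<noteq> 0"
    then show "h y < h z" using y p(1) by (auto simp: bv_def fspace_def vec_apply)
  qed
  then show ?thesis by blast
qed

lemma can: "z \<in> V \<Longrightarrow> is_can z (can z)"
  unfolding can_def by (rule theI'[of "is_can z"], rule ex_ex1I[OF is_can_ex is_can_unique])

lemma canD:
  assumes "z \<in> V"
  shows "can z \<in> fspace V" "\<beta> (can z) = can z" "can z z = 1"
    "y \<in> V \<Longrightarrow> y \<noteq> z \<Longrightarrow> can z y \<in> negpart" "can z y \<noteq> 0 \<Longrightarrow> y = z \<or> h y < h z"
  using can[OF assms] by (auto simp: is_can_def fspace_def)

text \<open>Subtracting canonical elements with the constant terms as coefficients leaves an
  invariant vector with negative exponents only, which vanishes.\<close>

lemma invariant_expand:
  assumes v: "v \<in> fspace V" "\<beta> v = v" and np: "\<And>y. y \<in> V \<Longrightarrow> v y \<in> nonpos_lpoly"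
  shows "v = (\<Sum>y\<in>V. vscale (lconst (coeff0 (v y))) (can y))"
proof -
  let ?s = "\<Sum>y\<in>V. vscale (lconst (coeff0 (v y))) (can y)"
  have s: "?s \<in> fspace V" by (intro fspace_sum fspace_simps canD)
  have "v - ?s = 0"
  proof (rule neg_invariant_eq_0)
    show "v - ?s \<in> fspace V" using v s by simp
    have "\<beta> ?s = ?s"
      by (subst slin_sum[OF bar_slin]) (auto simp: canD bar_vscale intro!: sum.cong)
    then show "\<beta> (v - ?s) = v - ?s" using v s by (simp add: bar_minus)
    fix y assume y: "y \<in> V"
    have "?s y = (\<Sum>z\<in>V. lconst (coeff0 (v z)) * can z y)" by (simp add: sum_apply vec_apply)
    also have "\<dots> = lconst (coeff0 (v y)) * can y y + (\<Sum>z\<in>V - {y}. lconst (coeff0 (v z)) * can z y)"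
      by (rule sum.remove) (use finV y in auto)
    finally have e: "(v - ?s) y = (v y - lconst (coeff0 (v y))) - (\<Sum>z\<in>V - {y}. lconst (coeff0 (v z)) * can z y)"
      using y by (simp add: canD vec_apply)
    have "(\<Sum>z\<in>A. lconst (coeff0 (v z)) * can z y) \<in> negpart" if "A \<subseteq> V - {y}" for A
      using that
    proof (induction A rule: infinite_finite_induct)
      case (insert z A)
      then have "lconst (coeff0 (v z)) * can z y \<in> negpart"
        using canD(4)[of z y] y by (intro negpart_lconst) auto
      then show ?case using insert by (simp add: negpart_add)
    qed simp_all
    from negpart_diff[OF nonpos_sub_coeff0[OF np[OF y]] this] show "(v - ?s) y \<in> negpart"
      unfolding e by simp
  qed
  then show ?thesis by simp
qed

section \<open>Generators acting on the canonical basis\<close>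

definition In :: "perm \<Rightarrow> perm \<Rightarrow> bool" where
  "In s z \<longleftrightarrow> Up s z \<or> (\<not> Up s z \<and> \<not> Dn s z \<and> lc s z = - xinv)"

lemma can_nonpos: "z \<in> V \<Longrightarrow> y \<in> V \<Longrightarrow> can z y \<in> nonpos_lpoly"
  using canD(3)[of z] canD(4)[of z y] by (cases "y = z") (auto simp: nonpos_lpoly_def negpart_def lookup_one when_def)

lemma sum_can_top:
  assumes max: "\<And>w'. w' \<in> V \<Longrightarrow> c w' \<noteq> 0 \<Longrightarrow> h w' \<le> h x" and x: "x \<in> V"
  shows "(\<Sum>w\<in>V. vscale (lconst (c w)) (can w)) x = lconst (c x)"
proof -
  have "(\<Sum>w\<in>V. vscale (lconst (c w)) (can w)) x = (\<Sum>w\<in>V. if w = x then lconst (c x) else 0)"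
    unfolding sum_apply
  proof (rule sum.cong)
    fix w assume w: "w \<in> V"
    show "vscale (lconst (c w)) (can w) x = (if w = x then lconst (c x) else 0)"
    proof (cases "w = x")
      case True then show ?thesis using canD(3)[OF w] by (simp add: vec_apply)
    next
      case False
      then have "c w = 0 \<or> can w x = 0" using max[OF w] canD(5)[OF w, of x] by force
      then show ?thesis using False by (auto simp: vec_apply lconst_simps)
    qed
  qed simp
  then show ?thesis using x finV by simp
qed

text \<open>The difference of the two sides is bar-invariant with exponents at most 0, hence an
  integral combination of canonical elements. At an element of greatest height in this combination,
  each possible behaviour of \<open>s\<close> contradicts a nonzero coefficient. No recursion over
  canonical elements is involved.\<close>

lemma can_eigen:
  assumes s: "s \<in> S" and y: "y \<in> V" and nI: "\<not> In s y"
  shows "T s (can y) = vscale xx (can y)"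
proof -
  define u where "u = T s (can y) - vscale xx (can y)"
  note [simp] = canD(1,2)[OF y]
  have uV: "u \<in> fspace V" using s by (simp add: u_def T_closed)
  have ub: "\<beta> u = u"
    unfolding u_def using s
    by (simp add: bar_minus bar_vscale bar_T T_closed) (simp add: T'_def vscale_simps)
  have u: "u w = (if Up s w then can y (act s w) - xx * can y w
      else if Dn s w then can y (act s w) - xinv * can y w else (lc s w - xx) * can y w)" if "w \<in> V" for w
    unfolding u_def using T_coeff[OF s that, of "can y"] by (simp add: vec_apply algebra_simps)
  have neg: "can y w \<in> negpart" if "w \<in> V" "In s w" for w
    using canD(4)[OF y] that nI by blast
  have np: "u w \<in> nonpos_lpoly" if w: "w \<in> V" for w
  proof -
    consider "Up s w" | "Dn s w" "\<not> Up s w" | "\<not> Up s w" "\<not> Dn s w" "lc s w = xx"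
      | "\<not> Up s w" "\<not> Dn s w" "lc s w = - xinv" using loop[OF s w] by blast
    then show ?thesis
    proof cases
      case 1
      then have "can y (act s w) \<in> nonpos_lpoly" "can y w \<in> negpart"
        using can_nonpos[OF y] up[OF s w] neg[OF w] by (auto simp: In_def)
      then show ?thesis using 1
        by (simp add: u w nonpos_lpoly_def negpart_def lookup_minus lookup_xx_mult)
    next
      case 2
      then have "can y (act s w) \<in> nonpos_lpoly" "can y w \<in> nonpos_lpoly"
        using can_nonpos[OF y] dn[OF s w] w by auto
      then show ?thesis using 2
        by (simp add: u w nonpos_lpoly_def lookup_minus lookup_xinv_mult)
    next
      case 3 then show ?thesis by (simp add: u w nonpos_lpoly_def)
    next
      case 4
      then have "can y w \<in> negpart" using neg[OF w] by (auto simp: In_def)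
      then show ?thesis using 4
        by (simp add: u w left_diff_distrib nonpos_lpoly_def negpart_def lookup_minus lookup_xx_mult lookup_xinv_mult)
    qed
  qed
  define c where "c w = coeff0 (u w)" for w
  have exp: "u = (\<Sum>w\<in>V. vscale (lconst (c w)) (can w))"
    unfolding c_def by (rule invariant_expand[OF uV ub np])
  have "c w = 0" if "w \<in> V" for w
  proof (rule ccontr)
    assume "c w \<noteq> 0"
    with that have ne: "{w \<in> V. c w \<noteq> 0} \<noteq> {}" by blast
    have fin: "finite (h ` {w \<in> V. c w \<noteq> 0})" using finV by simp
    with ne have "Max (h ` {w \<in> V. c w \<noteq> 0}) \<in> h ` {w \<in> V. c w \<noteq> 0}" by (intro Max_in) auto
    then obtain w where w: "w \<in> V" "c w \<noteq> 0" and mw: "h w = Max (h ` {w \<in> V. c w \<noteq> 0})" by auto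
    have max: "h w' \<le> h w" if "w' \<in> V" "c w' \<noteq> 0" for w'
      unfolding mw using that fin by (intro Max_ge) auto
    have uw: "u w = lconst (c w)" by (subst exp, rule sum_can_top[OF max w(1)])
    consider "Up s w" | "Dn s w" "\<not> Up s w" | "\<not> Up s w" "\<not> Dn s w" "lc s w = xx"
      | "\<not> Up s w" "\<not> Dn s w" "lc s w = - xinv" using loop[OF s w(1)] by blast
    then show False
    proof cases
      case 1
      note U = up[OF s w(1) 1]
      have m2: "h w' \<le> h (act s w)" if "w' \<in> V" "c w' \<noteq> 0" for w'
        using max[OF that] U by simp
      \<comment> \<open>\<open>u\<close> lies in the image of \<open>T s - x\<close>, so
        \<open>T s\<close> multiplies it by \<open>-x^-1\<close>. By maximality of \<open>w\<close>
        the entries at \<open>w\<close> and at the higher \<open>act s w\<close> are both constants,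
        and nonzero constants cannot differ by this factor.\<close>
      have "u (act s w) = - (xinv * u w)"
        using U up_dn[OF s, of "act s w"] 1
        by (simp add: u w(1) right_diff_distrib mult.assoc[symmetric])
      moreover have "u (act s w) = lconst (c (act s w))"
        by (subst exp, rule sum_can_top[OF m2]) (use U in auto)
      ultimately have "Poly_Mapping.lookup (lconst (c (act s w))) (- 1)
          = Poly_Mapping.lookup (- (xinv * lconst (c w))) (- 1)" using uw by simp
      then show False using w(2) by (simp add: lookup_xinv_mult lconst_def lookup_single)
    next
      case 2
      then have "can y (act s w) \<in> negpart" "can y w \<in> nonpos_lpoly"
        using dn[OF s w(1)] neg[of "act s w"] can_nonpos[OF y w(1)] by (auto simp: In_def)
      then show False using 2 w
        by (simp add: c_def coeff0_def u negpart_def nonpos_lpoly_def lookup_minus lookup_xinv_mult)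
    next
      case 3 then show False using w by (simp add: c_def coeff0_def u)
    next
      case 4
      then have "(xx + xinv) * can y w = lconst (- c w)"
      proof -
        have "(xx + xinv) * can y w = - u w" using 4 by (simp add: u w algebra_simps)
        then show ?thesis using uw by (simp add: lconst_simps)
      qed
      moreover have "can y w \<in> negpart" using neg[OF w(1)] 4 by (auto simp: In_def)
      ultimately show False using negpart_xx_plus_xinv w(2) by fastforce
    qed
  qed
  then have "u = 0" by (subst exp) (simp add: lconst_simps)
  then show ?thesis by (simp add: u_def)
qed

text \<open>Comparison of coefficients at \<open>z\<close> in the eigenvector equation for
  \<open>can y\<close>. It shows that in the symmetric sum defining an edge weight the term with the
  roles reversed matters only for \<open>y = act s z\<close>.\<close>

lemma coeff_below:
  assumes s: "s \<in> S" and z: "z \<in> V" and y: "y \<in> V" and i: "In s z" "\<not> In s y"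
  shows "coeff_xinv (can y z) = (if Up s z \<and> y = act s z then 1 else 0)"
proof -
  have e: "T s (can y) z = xx * can y z" unfolding can_eigen[OF s y i(2)] by (simp add: vec_apply)
  note c = T_coeff[OF s z canD(1)[OF y], unfolded e]
  have neg: "can y z \<in> negpart" using canD(4)[OF y z] i by blast
  show ?thesis
  proof (cases "Up s z")
    case True
    with c have "xx * can y z = can y (act s z)" by simp
    then have "coeff_xinv (can y z) = coeff0 (can y (act s z))"
      unfolding coeff0_def coeff_xinv_def using lookup_xx_mult[of "can y z" 0] by simp
    moreover have "coeff0 (can y (act s z)) = (if y = act s z then 1 else 0)"
      using canD(3)[OF y] canD(4)[OF y, of "act s z"] up[OF s z True]
      by (auto simp: coeff0_def negpart_def)
    ultimately show ?thesis using True by simp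
  next
    case False
    with i have l: "\<not> Dn s z" "lc s z = - xinv" by (auto simp: In_def)
    with c False have "xx * can y z + xinv * can y z = 0" by simp
    from arg_cong[OF this, of "\<lambda>p. Poly_Mapping.lookup p 0"] neg show ?thesis
      using False by (simp add: lookup_add lookup_xx_mult lookup_xinv_mult coeff_xinv_def negpart_def)
  qed
qed

lemma can_action:
  assumes s: "s \<in> S" and z: "z \<in> V" and i: "In s z"
  shows "T s (can z) = vscale (- xinv) (can z) + (\<Sum>y\<in>V. vscale (if In s y then 0
     else lconst (coeff_xinv (can y z) + coeff_xinv (can z y))) (can y))"
proof -
  define v where "v = T s (can z) + vscale xinv (can z)"
  note [simp] = canD(1,2)[OF z]
  have vV: "v \<in> fspace V" using s by (simp add: v_def T_closed)
  have vb: "\<beta> v = v"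
    unfolding v_def using s
    by (simp add: bar_add bar_vscale bar_T T_closed) (simp add: T'_def vscale_simps)
  have v: "v w = (if Up s w then can z (act s w) + xinv * can z w
      else if Dn s w then can z (act s w) + xx * can z w else (lc s w + xinv) * can z w)" if "w \<in> V" for w
    unfolding v_def using T_coeff[OF s that, of "can z"] by (simp add: vec_apply algebra_simps)
  have neg: "can z w \<in> negpart" if "w \<in> V" "\<not> In s w" for w
    using canD(4)[OF z] that i by blast
  note lk = nonpos_lpoly_def negpart_def lookup_add lookup_xx_mult lookup_xinv_mult distrib_right
  have np: "v w \<in> nonpos_lpoly \<and> lconst (coeff0 (v w)) = (if In s w then 0
      else lconst (coeff_xinv (can w z) + coeff_xinv (can z w)))" if w: "w \<in> V" for w
  proof -
    consider "Up s w" | "Dn s w" "\<not> Up s w" | "\<not> Up s w" "\<not> Dn s w" "lc s w = xx"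
      | "\<not> Up s w" "\<not> Dn s w" "lc s w = - xinv" using loop[OF s w] by blast
    then show ?thesis
    proof cases
      case 1
      then have "can z (act s w) \<in> negpart" "can z w \<in> nonpos_lpoly"
        using can_nonpos[OF z w] up[OF s w] neg[of "act s w"] loop[OF s] up_dn[OF s] by (auto simp: In_def)
      then show ?thesis using 1
        by (auto simp: v w coeff0_def In_def lconst_simps lk)
    next
      case 2
      then have nI: "\<not> In s w" by (auto simp: In_def)
      note D = dn[OF s w 2(1)]
      have a: "can z (act s w) \<in> nonpos_lpoly" using can_nonpos[OF z] D by blast
      \<comment> \<open>The constant term of \<open>v w\<close> has two sources:
        \<open>xx * can z w\<close> contributes the coefficient of \<open>x^-1\<close> in
        \<open>can z w\<close>, and the neighbour contributes 1 exactly if it is \<open>z\<close>,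
        which \<open>coeff_below\<close> expresses by the reversed coefficient.\<close>
      have "coeff0 (can z (act s w)) = coeff_xinv (can w z)"
        using canD(3)[OF z] canD(4)[OF z, of "act s w"] D coeff_below[OF s z w i nI] up[OF s z]
        by (cases "act s w = z") (auto simp: coeff0_def negpart_def)
      then show ?thesis using 2 a neg[OF w nI] nI
        by (auto simp: v w coeff0_def coeff_xinv_def lk)
    next
      case 3
      then have nI: "\<not> In s w" using xx_neq by (auto simp: In_def)
      have "coeff_xinv (can w z) = 0"
        using coeff_below[OF s z w i nI] up[OF s z] 3 by auto
      then show ?thesis using 3 neg[OF w nI] nI
        by (auto simp: v w coeff0_def coeff_xinv_def lk)
    next
      case 4
      then show ?thesis by (auto simp: v w In_def lconst_simps coeff0_def lk)
    qed
  qed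
  have "v = (\<Sum>w\<in>V. vscale (lconst (coeff0 (v w))) (can w))"
    by (rule invariant_expand[OF vV vb]) (use np in blast)
  also have "\<dots> = (\<Sum>y\<in>V. vscale (if In s y then 0
     else lconst (coeff_xinv (can y z) + coeff_xinv (can z y))) (can y))"
    by (rule sum.cong) (use np in auto)
  finally show ?thesis by (simp add: v_def vscale_simps algebra_simps)
qed

text \<open>The twist \<open>x \<mapsto> -x\<close>, \<open>bv z \<mapsto> (-1)^(h z div 2) bv z\<close> commutes with the bar operator, so
  it fixes the canonical basis up to sign; this yields bipartiteness.\<close>

lemma can_parity:
  assumes z: "z \<in> V" and y: "y \<in> V" and c: "coeff_xinv (can z y) \<noteq> 0"
  shows "odd (h y div 2 + h z div 2)"
proof -
  define e where "e z = (- 1 :: lpoly) ^ (h z div 2)" for z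
  have e2: "e z * e z = 1" for z by (simp add: e_def flip: power_add mult_2)
  have lsgn_e: "lsgn (e z) = e z" "lbar (e z) = e z" for z
    by (cases "even (h z div 2)", simp_all add: e_def ringhomD)+
  define tw where "tw = slin_ext lsgn V (\<lambda>z. vscale (e z) (bv z))"
  have tw: "slin lsgn V V tw" unfolding tw_def by (rule slin_slin_ext) auto
  have tw_bv: "tw (bv z) = vscale (e z) (bv z)" if "z \<in> V" for z
    unfolding tw_def by (rule slin_ext_bv) (use finV that in auto)
  have tw_coeff: "tw v y = e y * lsgn (v y)" if "y \<in> V" for v y
  proof -
    have "tw v y = (\<Sum>u\<in>V. if u = y then e y * lsgn (v y) else 0)"
      unfolding tw_def slin_ext_def by (rule sum.cong) (auto simp: vec_apply bv_def)
    then show ?thesis using that finV by simp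
  qed
  \<comment> \<open>Along an edge the sign \<open>e\<close> changes, while \<open>dd\<close> and the
    loop scalars are odd in \<open>x\<close>; every term of \<open>T s\<close> thus acquires the
    same minus sign.\<close>
  have twT: "tw (T s v) = - T s (tw v)" if s: "s \<in> S" and v: "v \<in> fspace V" for s v
  proof (rule slin_eqI[OF finV slin_comp[OF T_lin[OF s] tw] _ _ v])
    show "slin lsgn V V (\<lambda>v. - T s (tw v))"
      using slin_scale[OF slin_comp[OF tw T_lin[OF s]], of "- 1"] by simp
    fix z assume z: "z \<in> V"
    have ea: "e (act s z) = - e z" if "Up s z \<or> Dn s z"
      using that up[OF s z] dn_h[OF s z] by (auto simp: e_def)
    show "tw (T s (bv z)) = - T s (tw (bv z))"
      using s z ea up[OF s z] dn[OF s z] loop[OF s z]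
      by (auto simp: T_bv qb_def tw_bv T_vscale slinD(2,3)[OF tw] slin_minus[OF tw] vscale_simps ringhomD)
        (auto simp: vec_apply fun_eq_iff algebra_simps ringhomD)
  qed
  have twtw: "tw (tw v) = v" if v: "v \<in> fspace V" for v
    by (rule slin_eqI[OF finV slin_comp[OF tw tw] _ _ v, where V''=V])
      (auto intro: slin_ident simp: tw_bv slinD(3)[OF tw] vscale_simps lsgn_e e2)
  have comm: "\<beta> (tw v) = tw (\<beta> v)" if v: "v \<in> fspace V" for v
  proof (rule slin_determined[where X="\<lambda>s v. - T' s v", OF _ slin_comp[OF bar_slin tw] _ _ _ v])
    show "slin (\<lambda>c. lsgn (lbar c)) V V (\<lambda>v. \<beta> (tw v))"
      using slin_comp[OF tw bar_slin] by (simp add: lbar_lsgn)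
    fix s z assume s: "s \<in> S" and z: "z \<in> V"
    then show "\<beta> (tw (T s (bv z))) = - T' s (\<beta> (tw (bv z)))"
      by (simp add: twT bar_uminus T_closed slinD(1)[OF tw] bar_T)
    have "tw (T' s w) = - T' s (tw w)" if "w \<in> fspace V" for w
      unfolding T'_def using that s
      by (simp add: slin_minus[OF tw] T_closed slinD(3)[OF tw] twT ringhomD)
        (simp add: fun_eq_iff vec_apply algebra_simps)
    then show "tw (\<beta> (T s (bv z))) = - T' s (tw (\<beta> (bv z)))"
      using s z by (simp add: bar_T bar_closed)
  next
    fix z assume "z \<in> V" "\<forall>s\<in>S. \<not> Dn s z"
    then show "\<beta> (tw (bv z)) = tw (\<beta> (bv z))"
      by (simp add: bar_min tw_bv bar_vscale lsgn_e)
  qed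
  \<comment> \<open>By uniqueness the twisted element is \<open>can z\<close> itself, so each of its
    coefficients is even or odd in \<open>x\<close> as the heights prescribe.\<close>
  have "is_can z (vscale (e z) (tw (can z)))"
    unfolding is_can_def
  proof (intro conjI ballI impI)
    show "vscale (e z) (tw (can z)) \<in> fspace V"
      using canD(1)[OF z] by (simp add: slinD(1)[OF tw])
    show "\<beta> (vscale (e z) (tw (can z))) = vscale (e z) (tw (can z))"
      using canD(1,2)[OF z] by (simp add: bar_vscale slinD(1)[OF tw] comm lsgn_e)
    show "vscale (e z) (tw (can z)) z = 1"
      using canD(3)[OF z] z by (simp add: vec_apply tw_coeff e2 ringhomD mult.assoc[symmetric])
    fix y assume y: "y \<in> V" "y \<noteq> z"
    have "e w = 1 \<or> e w = - 1" for w by (simp add: e_def minus_one_power_iff)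
    then have "e z * e y = 1 \<or> e z * e y = - 1" by (metis mult_minus1 mult_minus1_right mult_1 minus_minus)
    then have eq: "vscale (e z) (tw (can z)) y = lsgn (can z y) \<or>
        vscale (e z) (tw (can z)) y = - lsgn (can z y)"
      using y by (auto simp: vec_apply tw_coeff mult.assoc[symmetric])
    show "vscale (e z) (tw (can z)) y \<in> negpart"
      using eq canD(4)[OF z y] by (auto simp: negpart_def lookup_lsgn)
    assume "vscale (e z) (tw (can z)) y \<noteq> 0"
    then show "h y < h z" using eq canD(5)[OF z, of y] y by (cases "can z y = 0") (auto simp: ringhomD)
  qed
  then have "can z = vscale (e z) (tw (can z))" using is_can_unique can[OF z] by blast
  then have "can z y = e z * (e y * lsgn (can z y))"
    using tw_coeff[OF y] by (metis vscale_apply)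
  then have "coeff_xinv (can z y) = coeff_xinv (e z * e y * lsgn (can z y))" by (simp add: mult.assoc)
  also have "e z * e y = (- 1) ^ (h y div 2 + h z div 2)" by (simp add: e_def power_add)
  finally show ?thesis
    using c by (cases "even (h y div 2 + h z div 2)") (auto simp: coeff_xinv_def lookup_lsgn)
qed

end

section \<open>Length and descents in the classical Weyl groups\<close>

declare comp_apply [simp del]

definition swp :: "int \<Rightarrow> int \<Rightarrow> perm" where
  "swp a b k = (if k = a then b else if k = b then a else if k = - a then - b
     else if k = - b then - a else k)"

text \<open>The pair \<open>(a, b)\<close> stands for the simple root \<open>e\<^sub>b - e\<^sub>a\<close>, with \<open>e\<close> odd in its index; \<open>w\<close> sends this
  root to a negative one iff \<open>w a > w b\<close>.\<close>

definition spair :: "ctype \<Rightarrow> nat \<Rightarrow> (int \<times> int) set" where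
  "spair t n = {(i, i + 1) | i. 1 \<le> i \<and> i < int n} \<union>
     (case t of TypeA \<Rightarrow> {} | TypeBC \<Rightarrow> {(-1, 1)} | TypeD \<Rightarrow> {(-1, 2)})"

text \<open>The pairs for which \<open>e_d - e_c\<close> is a root of type \<open>t\<close> up to a
  positive factor; \<open>c = - d\<close> gives the roots along an axis, which type D lacks.\<close>

definition rel :: "ctype \<Rightarrow> int \<Rightarrow> int \<Rightarrow> bool" where
  "rel t c d \<longleftrightarrow> c \<noteq> 0 \<and> d \<noteq> 0 \<and> c \<noteq> d \<and> (t = TypeA \<longrightarrow> (c > 0 \<longleftrightarrow> d > 0)) \<and> (t = TypeD \<longrightarrow> c \<noteq> - d)"

lemma spair_cases [consumes 1, case_names shift zero minus]:
  assumes "(a, b) \<in> spair t n"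
  obtains "b = a + 1" "1 \<le> a" "a < int n" | "t = TypeBC" "a = -1" "b = 1" | "t = TypeD" "a = -1" "b = 2"
  using assms by (auto simp: spair_def split: ctype.splits)

lemma sgen_swp: "i > 0 \<Longrightarrow> sgen i = swp i (i + 1)" "sgen 0 = swp (-1) 1" "sgen (-1) = swp (-1) 2"
  by (auto simp: sgen_def swp_def fun_eq_iff)

lemma Sgens_spair:
  assumes "n \<ge> 2" shows "Sgens t n = (\<lambda>(a, b). swp a b) ` spair t n"
proof -
  have A: "sgen ` {1..int n - 1} = (\<lambda>(a, b). swp a b) ` {(i, i + 1) | i. 1 \<le> i \<and> i < int n}"
  proof -
    have "{(i, i + 1) | i. 1 \<le> i \<and> i < int n} = (\<lambda>i. (i, i + 1)) ` {1..int n - 1}" by auto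
    then show ?thesis by (auto simp: image_image sgen_swp)
  qed
  have "{0..int n - 1} = insert 0 {1..int n - 1}" using assms by auto
  then show ?thesis using A
    by (cases t) (auto simp: Sgens_def spair_def sgen_swp image_Un)
qed

lemma swp_swp: "(a, b) \<in> spair t n \<Longrightarrow> swp a b (swp a b k) = k"
  by (erule spair_cases) (auto simp: swp_def)
lemma swp_odd: "(a, b) \<in> spair t n \<Longrightarrow> swp a b (- k) = - swp a b k"
  by (erule spair_cases) (auto simp: swp_def)
lemma swp_0: "(a, b) \<in> spair t n \<Longrightarrow> swp a b k = 0 \<longleftrightarrow> k = 0"
  by (erule spair_cases) (auto simp: swp_def)
lemma swp_outside: "n \<ge> 2 \<Longrightarrow> (a, b) \<in> spair t n \<Longrightarrow> \<bar>k\<bar> > int n \<Longrightarrow> swp a b k = k"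
  by (erule spair_cases) (auto simp: swp_def)
lemma swp_bound: "n \<ge> 2 \<Longrightarrow> (a, b) \<in> spair t n \<Longrightarrow> \<bar>swp a b k\<bar> \<le> int n \<longleftrightarrow> \<bar>k\<bar> \<le> int n"
  by (erule spair_cases) (auto simp: swp_def)
lemma swp_bij: "(a, b) \<in> spair t n \<Longrightarrow> bij (swp a b)"
  using swp_swp[of a b t n] by (intro o_bij[of "swp a b"]) (auto simp: fun_eq_iff comp_apply id_apply)
lemma swp_inj: "(a, b) \<in> spair t n \<Longrightarrow> swp a b k = swp a b l \<longleftrightarrow> k = l"
  using swp_swp[of a b t n k] swp_swp[of a b t n l] by metis
lemma swp_comp: "(a, b) \<in> spair t n \<Longrightarrow> swp a b \<circ> swp a b = id"
  using swp_swp[of a b t n] by (auto simp: fun_eq_iff comp_apply id_apply)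
lemma inv_swp: "(a, b) \<in> spair t n \<Longrightarrow> inv (swp a b) = swp a b"
  by (simp add: inv_unique_comp swp_comp)
lemma swp_ab [simp]: "swp a b a = b" "swp a b b = a"
  by (auto simp: swp_def)
lemma spair_bound: "n \<ge> 2 \<Longrightarrow> (a, b) \<in> spair t n \<Longrightarrow> \<bar>a\<bar> \<le> int n \<and> \<bar>b\<bar> \<le> int n \<and> a < b \<and> a \<noteq> 0 \<and> b > 0"
  by (erule spair_cases) auto
lemma spair_rel: "(a, b) \<in> spair t n \<Longrightarrow> rel t a b"
  by (erule spair_cases) (auto simp: rel_def)

text \<open>A simple reflection permutes the positive roots other than its own; the two excluded
  pairs are the two names of that root.\<close>

lemma swp_order:
  assumes "(a, b) \<in> spair t n" "rel t c d" "c < d" "\<not> (c = a \<and> d = b)" "\<not> (c = - b \<and> d = - a)"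
  shows "swp a b c < swp a b d"
  using assms(1)
proof (cases rule: spair_cases)
  case shift
  then show ?thesis using assms(3-5) unfolding swp_def rel_def by (smt (verit))
next
  case zero
  then show ?thesis using assms(2-5) unfolding swp_def rel_def by (smt (verit))
next
  case minus
  then show ?thesis using assms(2-5) unfolding swp_def rel_def by (smt (verit))
qed

lemma swp_rel:
  assumes "(a, b) \<in> spair t n" "rel t c d" shows "rel t (swp a b c) (swp a b d)"
proof -
  have "t = TypeA \<Longrightarrow> (swp a b k > 0) = (k > 0)" for k
    using assms(1) by (cases rule: spair_cases) (auto simp: swp_def)
  then show ?thesis
    using assms(2) swp_inj[OF assms(1), of c d] swp_inj[OF assms(1), of c "- d"] swp_odd[OF assms(1), of d]
    by (simp add: rel_def swp_0[OF assms(1)])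
qed

definition prodw :: "perm list \<Rightarrow> perm" where "prodw ws = List.foldr (\<circ>) ws id"

lemma prodw_Nil [simp]: "prodw [] = id" and prodw_Cons: "prodw (s # ws) = s \<circ> prodw ws"
  by (simp_all add: prodw_def comp_apply)

lemma prodw_append: "prodw (vs @ ws) = prodw vs \<circ> prodw ws"
  by (induction vs) (simp_all only: prodw_Nil prodw_Cons append.simps id_o comp_assoc)

lemma prodw_single: "prodw [s] = s"
  by (simp only: prodw_Cons prodw_Nil comp_id)

text \<open>Twice the number of positive roots made negative: a root \<open>(c, d)\<close> is counted together with its other
  name \<open>(-d, -c)\<close>, so a root \<open>(-d, d)\<close> has to be counted twice.\<close>

definition Inv :: "ctype \<Rightarrow> nat \<Rightarrow> perm \<Rightarrow> (int \<times> int) set" where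
  "Inv t n w = {(c, d). \<bar>c\<bar> \<le> int n \<and> \<bar>d\<bar> \<le> int n \<and> c < d \<and> rel t c d \<and> w c > w d}"

definition L2 :: "ctype \<Rightarrow> nat \<Rightarrow> perm \<Rightarrow> nat" where
  "L2 t n w = (\<Sum>(c, d)\<in>Inv t n w. if c = - d then 2 else 1)"

lemma finite_Inv: "finite (Inv t n w)"
  by (rule finite_subset[of _ "{- int n..int n} \<times> {- int n..int n}"]) (auto simp: Inv_def)

lemma WgrpD:
  assumes "w \<in> Wgrp t n"
  shows "bij w" "w (- i) = - w i" "\<bar>i\<bar> > int n \<Longrightarrow> w i = i" "w i = w j \<longleftrightarrow> i = j"
    "t = TypeA \<Longrightarrow> i > 0 \<Longrightarrow> w i > 0"
proof -
  have w: "signed_perm n w" using assms by (simp add: Wgrp_def)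
  then show "bij w" "w (- i) = - w i" "\<bar>i\<bar> > int n \<Longrightarrow> w i = i" by (auto simp: signed_perm_def)
  then show "w i = w j \<longleftrightarrow> i = j" by (auto dest: bij_is_inj injD)
  show "t = TypeA \<Longrightarrow> i > 0 \<Longrightarrow> w i > 0"
    using assms w by (cases "i \<le> int n") (auto simp: Wgrp_def signed_perm_def)
qed

lemma Wgrp_0 [simp]: assumes "w \<in> Wgrp t n" shows "w i = 0 \<longleftrightarrow> i = 0"
  using WgrpD(2)[OF assms, of 0] WgrpD(4)[OF assms, of i 0] by simp

lemma Wgrp_bound:
  assumes "w \<in> Wgrp t n" shows "\<bar>w i\<bar> \<le> int n \<longleftrightarrow> \<bar>i\<bar> \<le> int n"
  using WgrpD(3)[OF assms, of i] WgrpD(3)[OF assms, of "w i"] WgrpD(4)[OF assms, of "w i" i] by linarith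

lemma Wgrp_rel: assumes w: "w \<in> Wgrp t n" and r: "rel t c d" shows "rel t (w c) (w d)"
proof -
  have "(w i > 0) = (i > 0)" if "t = TypeA" "i \<noteq> 0" for i
    using WgrpD(5)[OF w that(1), of i] WgrpD(5)[OF w that(1), of "- i"] WgrpD(2)[OF w, of i] that by fastforce
  then show ?thesis
    using r WgrpD(4)[OF w, of c d] WgrpD(4)[OF w, of c "- d"] WgrpD(2)[OF w, of d] w
    by (simp add: rel_def)
qed

lemma id_Wgrp: "id \<in> Wgrp t n"
proof -
  have e: "{i \<in> {1..int n}. id i < 0} = {}" by auto
  have "signed_perm n id" by (simp add: signed_perm_def id_apply)
  then show ?thesis unfolding Wgrp_def mem_Collect_eq e by (simp add: id_apply split: ctype.splits)
qed

locale weyl =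
  fixes t :: ctype and n :: nat
  assumes n2: "n \<ge> 2"
begin

abbreviation "W \<equiv> Wgrp t n"
abbreviation "S \<equiv> Sgens t n"
abbreviation "len \<equiv> clen S"
abbreviation "P \<equiv> spair t n"

lemma S_swp: "s \<in> S \<longleftrightarrow> (\<exists>a b. (a, b) \<in> P \<and> s = swp a b)"
  by (auto simp: Sgens_spair[OF n2])

lemma W_right_mult:
  assumes w: "w \<in> W" and ab: "(a, b) \<in> P" shows "w \<circ> swp a b \<in> W"
proof -
  let ?s = "swp a b"
  have sp: "signed_perm n w" using w by (simp add: Wgrp_def)
  have "signed_perm n (w \<circ> ?s)"
    using sp ab by (auto simp: comp_apply signed_perm_def swp_odd swp_outside[OF n2] intro: bij_comp swp_bij)
  moreover have "?s i > 0" if "t = TypeA" "i > 0" for i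
    using ab that by (cases rule: spair_cases) (auto simp: swp_def)
  then have "\<forall>i\<in>{1..int n}. (w \<circ> ?s) i > 0" if "t = TypeA"
    using that WgrpD(5)[OF w] by (auto simp: comp_apply)
  moreover have "even (card {i\<in>{1..int n}. (w \<circ> ?s) i < 0})" if t: "t = TypeD"
  proof -
    have ev: "even (card {i\<in>{1..int n}. w i < 0})" using w t by (simp add: Wgrp_def)
    show ?thesis using ab
    proof (cases rule: spair_cases)
      case shift
      then have pos: "?s i \<in> {1..int n} \<longleftrightarrow> i \<in> {1..int n}" for i by (auto simp: swp_def)
      have "{i\<in>{1..int n}. (w \<circ> ?s) i < 0} = ?s ` {i\<in>{1..int n}. w i < 0}"
      proof (intro set_eqI iffI)
        fix i assume "i \<in> {i\<in>{1..int n}. (w \<circ> ?s) i < 0}"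
        then show "i \<in> ?s ` {i\<in>{1..int n}. w i < 0}"
          using pos swp_swp[OF ab] by (intro image_eqI[of _ _ "?s i"]) (auto simp: comp_apply)
      qed (use pos swp_swp[OF ab] in \<open>auto simp: comp_apply\<close>)
      then show ?thesis using ev
        by (subst (asm) card_image[symmetric, of ?s]) (auto simp: inj_on_def swp_inj[OF ab])
    next
      case minus
      \<comment> \<open>Only positions 1 and 2 are affected, and the values there become
        \<open>- w 2\<close> and \<open>- w 1\<close>. If \<open>k\<close> of the old ones were
        negative, \<open>2 - k\<close> of the new ones are.\<close>
      define X where "X = {i\<in>{3..int n}. w i < 0}"
      have X: "finite X" "1 \<notin> X" "2 \<notin> X" by (auto simp: X_def intro: finite_subset[of _ "{3..int n}"])
      have *: "{i\<in>{1..int n}. v i < 0} = (if v 1 < 0 then {1} else {}) \<union> (if v 2 < 0 then {2} else {}) \<union> X"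
        if "\<And>i. i \<ge> 3 \<Longrightarrow> v i = w i" for v :: perm
      proof (rule set_eqI)
        fix i :: int
        consider "i = 1" | "i = 2" | "i \<ge> 3" | "i \<le> 0" by linarith
        then show "i \<in> {i\<in>{1..int n}. v i < 0} \<longleftrightarrow>
            i \<in> (if v 1 < 0 then {1} else {}) \<union> (if v 2 < 0 then {2} else {}) \<union> X"
          using n2 that[of i] by cases (auto simp: X_def)
      qed
      have v: "(w \<circ> ?s) 1 = - w 2" "(w \<circ> ?s) 2 = - w 1" "\<And>i. i \<ge> 3 \<Longrightarrow> (w \<circ> ?s) i = w i"
        using minus WgrpD(2)[OF w, of 2] WgrpD(2)[OF w, of 1] by (auto simp: swp_def comp_apply)
      have nz: "w 1 \<noteq> 0" "w 2 \<noteq> 0" using w by auto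
      define A B where "A v = (if v < 0 then {1} else {} :: int set)"
        and "B v = (if v < 0 then {2} else {} :: int set)" for v :: int
      have "{i\<in>{1..int n}. w i < 0} = A (w 1) \<union> B (w 2) \<union> X"
        unfolding A_def B_def by (rule *) simp
      with ev have "even (card (A (w 1) \<union> B (w 2) \<union> X))" by simp
      then have "even (card (A (- w 2) \<union> B (- w 1) \<union> X))"
        using X nz by (auto simp: A_def B_def)
      moreover have "{i\<in>{1..int n}. (w \<circ> ?s) i < 0} = A (- w 2) \<union> B (- w 1) \<union> X"
        unfolding A_def B_def v(1,2)[symmetric] by (rule *) (rule v(3))
      ultimately show ?thesis by simp
    qed (use t in auto)
  qed
  ultimately show ?thesis by (auto simp: Wgrp_def split: ctype.splits)
qed

text \<open>The reflection is a bijection between the inversions of \<open>w\<close> and of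
  \<open>w \<circ> swp a b\<close> outside \<open>R\<close>, the set of names of its own root.
  \<open>R\<close> has total weight 2 also when the two names coincide.\<close>

lemma L2_right:
  assumes w: "w \<in> W" and ab: "(a, b) \<in> P"
  shows "w a < w b \<Longrightarrow> L2 t n (w \<circ> swp a b) = L2 t n w + 2"
    "w a > w b \<Longrightarrow> L2 t n w = L2 t n (w \<circ> swp a b) + 2"
proof -
  let ?s = "swp a b" and ?wt = "\<lambda>(c, d). if c = - d then 2 else (1::nat)"
  define R where "R = {(a, b), (- b, - a)}"
  have bd: "\<bar>a\<bar> \<le> int n" "\<bar>b\<bar> \<le> int n" "a < b" using spair_bound[OF n2 ab] by auto
  have Rsum: "sum ?wt R = 2"
    using bd by (cases "a = - b") (simp_all add: R_def)
  have rab: "rel t a b" "rel t (- b) (- a)" using spair_rel[OF ab] by (auto simp: rel_def)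
  have split: "L2 t n u = (if u a > u b then 2 else 0) + sum ?wt (Inv t n u - R)" if u: "u \<in> W" for u
  proof -
    have "Inv t n u \<inter> R = (if u a > u b then R else {})"
      using bd rab WgrpD(2)[OF u] by (auto simp: R_def Inv_def)
    then have "sum ?wt (Inv t n u \<inter> R) = (if u a > u b then 2 else 0)" using Rsum by simp
    moreover have "L2 t n u = sum ?wt (Inv t n u \<inter> R) + sum ?wt (Inv t n u - R)"
      unfolding L2_def by (rule sum.Int_Diff[OF finite_Inv])
    ultimately show ?thesis by simp
  qed
  have sR: "(?s c, ?s d) \<notin> R" if "c < d" for c d
  proof
    assume "(?s c, ?s d) \<in> R"
    then have "c = b \<and> d = a \<or> c = - a \<and> d = - b"
      using swp_swp[OF ab, of c] swp_swp[OF ab, of d] swp_odd[OF ab, of a] swp_odd[OF ab, of b] by (auto simp: R_def)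
    then show False using that bd by auto
  qed
  have imp: "(?s c, ?s d) \<in> Inv t n v - R" if "(c, d) \<in> Inv t n u - R" "v = u \<circ> ?s" for c d u v
    using that sR[of c d] swp_order[OF ab, of c d] swp_rel[OF ab, of c d]
    by (auto simp: comp_apply Inv_def R_def swp_bound[OF n2 ab] swp_swp[OF ab])
  have ss: "w = (w \<circ> ?s) \<circ> ?s" by (simp add: comp_assoc swp_comp[OF ab])
  have "sum ?wt (Inv t n (w \<circ> ?s) - R) = sum ?wt (Inv t n w - R)"
  proof (rule sum.reindex_bij_witness[of _ "\<lambda>(c, d). (?s c, ?s d)" "\<lambda>(c, d). (?s c, ?s d)"])
    fix x assume x: "x \<in> Inv t n (w \<circ> ?s) - R"
    then show "(case x of (c, d) \<Rightarrow> (?s c, ?s d)) \<in> Inv t n w - R"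
      using imp[OF _ ss] by (cases x) auto
    obtain c d where cd: "x = (c, d)" by fastforce
    show "?wt (case x of (c, d) \<Rightarrow> (?s c, ?s d)) = ?wt x"
      using swp_inj[OF ab, of c "- d"] swp_odd[OF ab, of d] by (simp add: cd)
  next
    fix x assume x: "x \<in> Inv t n w - R"
    then show "(case x of (c, d) \<Rightarrow> (?s c, ?s d)) \<in> Inv t n (w \<circ> ?s) - R"
      using imp[OF _ refl] by (cases x) auto
  qed (auto simp: swp_swp[OF ab])
  then have "L2 t n (w \<circ> ?s) + (if w a > w b then 2 else 0) = L2 t n w + (if w b > w a then 2 else 0)"
    using split[OF w] split[OF W_right_mult[OF w ab]] by (simp add: comp_apply)
  then show "w a < w b \<Longrightarrow> L2 t n (w \<circ> ?s) = L2 t n w + 2"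
    "w a > w b \<Longrightarrow> L2 t n w = L2 t n (w \<circ> ?s) + 2" by auto
qed

lemma increasing_id:
  assumes w: "w \<in> W" and inc: "\<And>a b. (a, b) \<in> P \<Longrightarrow> w a < w b"
  shows "w = id"
proof -
  have step: "w i < w (i + 1)" if "1 \<le> i" "i < int n" for i
    using inc[of i "i + 1"] that by (auto simp: spair_def)
  have pos1: "w 1 > 0"
  proof (cases t)
    case TypeA then show ?thesis using WgrpD(5)[OF w] by simp
  next
    case TypeBC
    then have "w (- 1) < w 1" using inc by (auto simp: spair_def)
    then show ?thesis using WgrpD(2)[OF w, of 1] by simp
  next
    case TypeD
    then have 12: "w (- 1) < w 2" "w 1 < w 2" using inc[of "- 1" 2] step[of 1] n2 by (auto simp: spair_def)
    have ge: "w i > 0" if "i \<in> {2..int n}" for i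
    proof -
      have "2 \<le> i" "i \<le> int n" using that by auto
      then show ?thesis
      proof (induction i rule: int_ge_induct)
        case base then show ?case using 12 WgrpD(2)[OF w, of 1] by simp
      next
        case (step i) then show ?case using \<open>\<And>i. 1 \<le> i \<Longrightarrow> i < int n \<Longrightarrow> w i < w (i + 1)\<close>[of i] by simp
      qed
    qed
    \<comment> \<open>The inequalities for the simple roots admit a negative \<open>w 1\<close>.
      Then 1 would be the only negative position, against the parity condition of type D.\<close>
    show ?thesis
    proof (rule ccontr)
      assume "\<not> w 1 > 0"
      then have n1: "w 1 < 0" using w Wgrp_0[OF w, of 1] by linarith
      have "i = 1" if "i \<in> {1..int n}" "w i < 0" for i
        using ge[of i] that by (cases "i = 1") auto
      then have "{i\<in>{1..int n}. w i < 0} = {1}" using n1 n2 by auto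
      then show False using w TypeD by (simp add: Wgrp_def)
    qed
  qed
  have ge: "1 \<le> i \<Longrightarrow> i \<le> int n \<Longrightarrow> w i \<ge> i" for i
  proof (induction i rule: int_ge_induct)
    case base then show ?case using pos1 by simp
  next
    case (step i) then show ?case using \<open>\<And>i. 1 \<le> i \<Longrightarrow> i < int n \<Longrightarrow> w i < w (i + 1)\<close>[of i] by simp
  qed
  have le: "i \<le> int n \<Longrightarrow> 1 \<le> i \<Longrightarrow> w i \<le> i" for i
  proof (induction i rule: int_le_induct)
    case base then show ?case using Wgrp_bound[OF w, of "int n"] by simp
  next
    case (step i) then show ?case using \<open>\<And>i. 1 \<le> i \<Longrightarrow> i < int n \<Longrightarrow> w i < w (i + 1)\<close>[of "i - 1"] by simp
  qed
  have that: "w i = i" if "i > 0" for i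
    using ge[of i] le[of i] WgrpD(3)[OF w, of i] that by (cases "i \<le> int n") auto
  have "w i = i" for i
    using WgrpD(2)[OF w, of "- i"] that[of i] that[of "- i"] Wgrp_0[OF w, of i]
    by (cases i "0::int" rule: linorder_cases) simp_all
  then show ?thesis by (simp add: fun_eq_iff id_apply)
qed

lemma word_W: "set ws \<subseteq> S \<Longrightarrow> prodw ws \<in> W"
proof (induction ws rule: rev_induct)
  case Nil then show ?case by (simp only: prodw_Nil id_Wgrp)
next
  case (snoc s ws)
  then obtain a b where "(a, b) \<in> P" "s = swp a b" using S_swp by auto
  with snoc show ?case using W_right_mult by (simp add: prodw_append prodw_single)
qed

lemma word_L2: "set ws \<subseteq> S \<Longrightarrow> L2 t n (prodw ws) \<le> 2 * length ws"
proof (induction ws rule: rev_induct)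
  case Nil
  have "Inv t n id = {}" by (auto simp: Inv_def id_apply)
  then show ?case by (simp only: L2_def prodw_Nil sum.empty zero_le)
next
  case (snoc s ws)
  then obtain a b where ab: "(a, b) \<in> P" "s = swp a b" using S_swp by auto
  let ?w = "prodw ws"
  have w: "?w \<in> W" using snoc by (auto intro: word_W)
  have "?w a \<noteq> ?w b" using WgrpD(4)[OF w] spair_bound[OF n2 ab(1)] by auto
  then have "L2 t n (?w \<circ> s) \<le> L2 t n ?w + 2"
    using L2_right[OF w ab(1)] ab(2) by (cases "?w a < ?w b") auto
  then show ?case using snoc by (simp add: prodw_append prodw_single)
qed

lemma word_ex: "w \<in> W \<Longrightarrow> \<exists>ws. set ws \<subseteq> S \<and> prodw ws = w \<and> 2 * length ws = L2 t n w"
proof (induction "L2 t n w" arbitrary: w rule: less_induct)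
  case less
  show ?case
  proof (cases "w = id")
    case True
    have "Inv t n id = {}" by (auto simp: Inv_def id_apply)
    then show ?thesis using True by (intro exI[of _ "[]"]) (simp add: L2_def)
  next
    case False
    then obtain a b where ab: "(a, b) \<in> P" "\<not> w a < w b" using increasing_id[OF less.prems] by blast
    then have gt: "w a > w b"
      using WgrpD(4)[OF less.prems, of a b] spair_bound[OF n2 ab(1)] by force
    let ?v = "w \<circ> swp a b"
    note L = L2_right(2)[OF less.prems ab(1) gt]
    obtain ws where ws: "set ws \<subseteq> S" "prodw ws = ?v" "2 * length ws = L2 t n ?v"
      using less.hyps[of ?v] W_right_mult[OF less.prems ab(1)] L by auto
    have "prodw (ws @ [swp a b]) = w"
      by (simp add: prodw_append prodw_single ws(2) comp_assoc swp_comp[OF ab(1)])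
    then show ?thesis
      using ws L ab S_swp by (intro exI[of _ "ws @ [swp a b]"]) auto
  qed
qed

text \<open>One letter changes \<open>L2\<close> by 2, which bounds the length from below; removing
  right descents one at a time attains the bound.\<close>

lemma clen_L2: assumes "w \<in> W" shows "2 * len w = L2 t n w"
proof -
  obtain ws where ws: "set ws \<subseteq> S" "prodw ws = w" "2 * length ws = L2 t n w"
    using word_ex[OF assms] by blast
  have "len w = length ws"
    unfolding clen_def prodw_def[symmetric]
  proof (rule Least_equality)
    show "\<exists>vs. length vs = length ws \<and> set vs \<subseteq> S \<and> prodw vs = w" using ws by blast
    fix k assume "\<exists>vs. length vs = k \<and> set vs \<subseteq> S \<and> prodw vs = w"
    then show "length ws \<le> k" using word_L2 ws(3) by fastforce
  qed
  then show ?thesis using ws by simp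
qed

lemma len_word: "w \<in> W \<Longrightarrow> \<exists>ws. set ws \<subseteq> S \<and> prodw ws = w \<and> length ws = len w"
  using word_ex clen_L2 by fastforce

lemma len_word_le: "set ws \<subseteq> S \<Longrightarrow> len (prodw ws) \<le> length ws"
  using word_L2 clen_L2 word_W by (metis mult_le_cancel1 zero_less_numeral)

lemma W_comp: assumes "v \<in> W" "w \<in> W" shows "v \<circ> w \<in> W"
proof -
  obtain vs ws where "set vs \<subseteq> S" "prodw vs = v" "set ws \<subseteq> S" "prodw ws = w"
    using len_word assms by blast
  then show ?thesis using word_W[of "vs @ ws"] by (simp add: prodw_append)
qed

lemma S_W: "s \<in> S \<Longrightarrow> s \<in> W"
  using word_W[of "[s]"] by (simp add: prodw_single)

lemma inv_word: "set ws \<subseteq> S \<Longrightarrow> inv (prodw ws) = prodw (rev ws)"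
proof (induction ws)
  case Nil then show ?case by simp
next
  case (Cons s ws)
  then obtain a b where ab: "(a, b) \<in> P" "s = swp a b" using S_swp by auto
  have "bij (prodw ws)" using word_W[of ws] Cons WgrpD(1) by auto
  then have "inv (s \<circ> prodw ws) = inv (prodw ws) \<circ> s"
    using o_inv_distrib[OF swp_bij[OF ab(1)]] inv_swp[OF ab(1)] by (simp only: ab(2))
  moreover have "inv (prodw ws) = prodw (rev ws)" using Cons by simp
  ultimately show ?case by (simp only: prodw_append prodw_single prodw_Cons[of s ws] rev.simps)
qed

lemma W_inv: assumes "w \<in> W" shows "inv w \<in> W" "len (inv w) = len w"
proof -
  have *: "inv w \<in> W \<and> len (inv w) \<le> len w" if w: "w \<in> W" for w
  proof -
    obtain ws where ws: "set ws \<subseteq> S" "prodw ws = w" "length ws = len w"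
      using len_word w by blast
    then have i: "inv w = prodw (rev ws)" using inv_word by auto
    show ?thesis using ws word_W[of "rev ws"] len_word_le[of "rev ws"] by (simp add: i)
  qed
  then show "inv w \<in> W" using assms by blast
  then show "len (inv w) = len w"
    using *[OF assms] *[of "inv w"] WgrpD(1)[OF assms] by (simp add: inv_inv_eq)
qed

lemma len_right:
  assumes "w \<in> W" "(a, b) \<in> P"
  shows "w a < w b \<Longrightarrow> len (w \<circ> swp a b) = len w + 1" "w a > w b \<Longrightarrow> len w = len (w \<circ> swp a b) + 1"
  using L2_right[OF assms] clen_L2[OF assms(1)] clen_L2[OF W_right_mult[OF assms]] by auto

lemma len_left:
  assumes w: "w \<in> W" and ab: "(a, b) \<in> P"
  shows "inv w a < inv w b \<Longrightarrow> len (swp a b \<circ> w) = len w + 1"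
    "inv w a > inv w b \<Longrightarrow> len w = len (swp a b \<circ> w) + 1"
proof -
  have "inv (swp a b \<circ> w) = inv w \<circ> swp a b"
    using WgrpD(1)[OF w] swp_bij[OF ab] by (simp add: o_inv_distrib inv_swp[OF ab])
  moreover have "swp a b \<circ> w \<in> W" using W_comp S_W S_swp w ab by blast
  ultimately have "len (swp a b \<circ> w) = len (inv w \<circ> swp a b)" using W_inv by metis
  then show "inv w a < inv w b \<Longrightarrow> len (swp a b \<circ> w) = len w + 1"
    "inv w a > inv w b \<Longrightarrow> len w = len (swp a b \<circ> w) + 1"
    using len_right[OF W_inv(1)[OF w] ab] W_inv(2)[OF w] by auto
qed

definition LD :: "perm \<Rightarrow> perm \<Rightarrow> bool" where "LD s w \<longleftrightarrow> len (s \<circ> w) < len w"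

lemma inv_neq: assumes "w \<in> W" "(a, b) \<in> P" shows "inv w a \<noteq> inv w b"
  using WgrpD(4)[OF W_inv(1)[OF assms(1)], of a b] spair_bound[OF n2 assms(2)] by auto

lemma LD_iff: assumes "w \<in> W" "(a, b) \<in> P" shows "LD (swp a b) w \<longleftrightarrow> inv w a > inv w b"
  using len_left[OF assms] inv_neq[OF assms] by (cases "inv w a < inv w b") (auto simp: LD_def)

lemma S_S: assumes "s \<in> S" shows "s \<circ> s = id"
proof -
  obtain a b where "(a, b) \<in> P" "s = swp a b" using assms S_swp by auto
  then show ?thesis using swp_comp by simp
qed

lemma S_S_comp: "s \<in> S \<Longrightarrow> s \<circ> (s \<circ> w) = w"
  by (simp add: S_S flip: comp_assoc)

lemma SW: "s \<in> S \<Longrightarrow> w \<in> W \<Longrightarrow> s \<circ> w \<in> W"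
  using W_comp S_W by blast

lemma len_S:
  assumes "w \<in> W" "s \<in> S"
  shows "LD s w \<Longrightarrow> len w = len (s \<circ> w) + 1" "\<not> LD s w \<Longrightarrow> len (s \<circ> w) = len w + 1"
proof -
  obtain a b where ab: "(a, b) \<in> P" "s = swp a b" using assms S_swp by auto
  show "LD s w \<Longrightarrow> len w = len (s \<circ> w) + 1" "\<not> LD s w \<Longrightarrow> len (s \<circ> w) = len w + 1"
    using len_left[OF assms(1) ab(1)] inv_neq[OF assms(1) ab(1)] LD_iff[OF assms(1) ab(1)] ab(2) by auto
qed

lemma LD_flip:
  assumes "w \<in> W" "s \<in> S" shows "LD s (s \<circ> w) \<longleftrightarrow> \<not> LD s w"
proof -
  have "LD s (s \<circ> w) \<longleftrightarrow> len w < len (s \<circ> w)" unfolding LD_def S_S_comp[OF assms(2)] ..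
  then show ?thesis using len_S[OF assms] by (cases "LD s w") simp_all
qed

lemma finite_W: "finite W"
proof -
  let ?A = "{- int n..int n}"
  \<comment> \<open>Elements of \<open>W\<close> are the identity far out, whereas
    \<open>finite_set_of_finite_funs\<close> counts functions with a constant default.\<close>
  let ?f = "\<lambda>w x. if x \<in> ?A then w x else (0::int)"
  have inj: "inj_on ?f W"
  proof (rule inj_onI)
    fix v w assume vw: "v \<in> W" "w \<in> W" "?f v = ?f w"
    have "v x = w x" for x
      using fun_cong[OF vw(3), of x] WgrpD(3)[OF vw(1), of x] WgrpD(3)[OF vw(2), of x]
      by (cases "x \<in> ?A") auto
    then show "v = w" by auto
  qed
  have sub: "?f ` W \<subseteq> {f. \<forall>x. (x \<in> ?A \<longrightarrow> f x \<in> ?A) \<and> (x \<notin> ?A \<longrightarrow> f x = 0)}"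
  proof (clarify, intro conjI impI)
    fix w x assume w: "w \<in> W"
    assume "x \<in> ?A"
    then have "\<bar>w x\<bar> \<le> int n" using Wgrp_bound[OF w, of x] by auto
    then show "?f w x \<in> ?A" by auto
  qed auto
  have fin: "finite {f. \<forall>x. (x \<in> ?A \<longrightarrow> f x \<in> ?A) \<and> (x \<notin> ?A \<longrightarrow> f x = (0::int))}"
    using finite_set_of_finite_funs[of ?A ?A 0] by (simp only: finite_atLeastAtMost_int)
  show ?thesis by (rule finite_imageD[OF finite_subset[OF sub fin] inj])
qed

end

section \<open>Braid relations and modules over the Hecke algebra\<close>

text \<open>\<open>comp_apply\<close> has left the simpset so that products of group elements stay
  products. The recursion equation of \<open>foldr\<close> is stated with \<circ>, so this pointwise
  form takes its place.\<close>

lemma foldr_step [simp]: "List.foldr f (x # xs) v = f x (List.foldr f xs v)"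
  by (simp add: comp_apply)

declare foldr.simps(2) [simp del]

context weyl
begin

text \<open>Two distinct simple reflections have product of order 2, 3 or 4 according to these shapes.\<close>

definition cf2 :: "perm \<Rightarrow> perm \<Rightarrow> bool" where
  "cf2 r s \<longleftrightarrow> (\<exists>a b c d. (a, b) \<in> P \<and> (c, d) \<in> P \<and> r = swp a b \<and> s = swp c d \<and>
     (r c = c \<and> r d = d \<and> s a = a \<and> s b = b \<or> r c = - d \<and> r d = - c \<and> s a = - b \<and> s b = - a))"

definition cf3 :: "perm \<Rightarrow> perm \<Rightarrow> bool" where
  "cf3 r s \<longleftrightarrow> (\<exists>a b c. (a, b) \<in> P \<and> (b, c) \<in> P \<and> a \<noteq> - b \<and> r = swp a b \<and> s = swp b c)"

definition cf4 :: "perm \<Rightarrow> perm \<Rightarrow> bool" where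
  "cf4 r s \<longleftrightarrow> t = TypeBC \<and> r = swp (- 1) 1 \<and> s = swp 1 2"

text \<open>In type D the reflections for \<open>(1, 2)\<close> and \<open>(-1, 2)\<close> move the
  same positions and still commute; the second alternative in \<open>cf2\<close> exists for
  them.\<close>

lemma cf_cases:
  assumes "r \<in> S" "s \<in> S" "r \<noteq> s"
  obtains "cf2 r s" | "cf3 r s" | "cf3 s r" | "cf4 r s" | "cf4 s r"
proof -
  obtain a b c d where P: "(a, b) \<in> P" "(c, d) \<in> P" and rs: "r = swp a b" "s = swp c d"
    using assms S_swp by auto
  have 2: "cf2 r s" if "r c = c \<and> r d = d \<and> s a = a \<and> s b = b \<or> r c = - d \<and> r d = - c \<and> s a = - b \<and> s b = - a"
    using that P rs unfolding cf2_def by blast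
  have 3: "b = c \<Longrightarrow> a \<noteq> - b \<Longrightarrow> cf3 r s" "d = a \<Longrightarrow> c \<noteq> - d \<Longrightarrow> cf3 s r" using P rs unfolding cf3_def by blast+
  have 4: "t = TypeBC \<Longrightarrow> a = -1 \<Longrightarrow> b = 1 \<Longrightarrow> c = 1 \<Longrightarrow> d = 2 \<Longrightarrow> cf4 r s"
    "t = TypeBC \<Longrightarrow> c = -1 \<Longrightarrow> d = 1 \<Longrightarrow> a = 1 \<Longrightarrow> b = 2 \<Longrightarrow> cf4 s r" using rs unfolding cf4_def by simp_all
  have ne: "a \<noteq> c" using assms(3) P rs by (auto elim!: spair_cases)
  from P(1) show ?thesis
  proof (cases rule: spair_cases)
    case shift note ab = shift
    from P(2) show ?thesis
    proof (cases rule: spair_cases)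
      case shift
      show ?thesis
      proof (cases "b = c \<or> d = a")
        case True then show ?thesis using 3 that ab shift by force
      next
        case False
        then have "cf2 r s" using ab shift ne by (intro 2) (auto simp: rs swp_def)
        then show ?thesis using that by blast
      qed
    next
      case zero
      show ?thesis
      proof (cases "a = 1")
        case True then show ?thesis using 4 that ab zero by auto
      next
        case False
        then have "cf2 r s" using ab zero ne by (intro 2) (auto simp: rs swp_def)
        then show ?thesis using that by blast
      qed
    next
      case minus
      show ?thesis
      proof (cases "a = 2")
        case True then show ?thesis using 3 that ab minus by auto
      next
        case False
        then have "cf2 r s" using ab minus ne by (intro 2) (auto simp: rs swp_def)
        then show ?thesis using that by blast
      qed
    qed
  next
    case zero note ab = zero
    from P(2) show ?thesis
    proof (cases rule: spair_cases)
      case shift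
      show ?thesis
      proof (cases "c = 1")
        case True then show ?thesis using 4 that ab shift by auto
      next
        case False
        then have "cf2 r s" using ab shift ne by (intro 2) (auto simp: rs swp_def)
        then show ?thesis using that by blast
      qed
    qed (use ab ne in auto)
  next
    case minus note ab = minus
    from P(2) show ?thesis
    proof (cases rule: spair_cases)
      case shift
      show ?thesis
      proof (cases "c = 2")
        case True then show ?thesis using 3 that ab shift by auto
      next
        case False
        then have "cf2 r s" using ab shift ne by (intro 2) (auto simp: rs swp_def)
        then show ?thesis using that by blast
      qed
    qed (use ab ne in auto)
  qed
qed

lemma cf_S: "cf2 r s \<Longrightarrow> r \<in> S \<and> s \<in> S" "cf3 r s \<Longrightarrow> r \<in> S \<and> s \<in> S" "cf4 r s \<Longrightarrow> r \<in> S \<and> s \<in> S"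
proof -
  show "cf2 r s \<Longrightarrow> r \<in> S \<and> s \<in> S" "cf3 r s \<Longrightarrow> r \<in> S \<and> s \<in> S" unfolding cf2_def cf3_def S_swp by blast+
  assume "cf4 r s"
  moreover from this have "(- 1, 1) \<in> P" "(1, 2) \<in> P" using n2 by (auto simp: cf4_def spair_def)
  ultimately show "r \<in> S \<and> s \<in> S" unfolding cf4_def S_swp by blast
qed

lemma comp_swp:
  assumes "inj f" "\<And>i. f (- i) = - f i" "a \<noteq> 0" "b \<noteq> 0"
  shows "f \<circ> swp a b = swp (f a) (f b) \<circ> f"
proof
  fix k
  show "(f \<circ> swp a b) k = (swp (f a) (f b) \<circ> f) k"
    using assms(2-4) inj_eq[OF assms(1), of k "- a"] inj_eq[OF assms(1), of k "- b"]
      inj_eq[OF assms(1), of k a] inj_eq[OF assms(1), of k b]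
    by (simp add: swp_def comp_apply)
qed

lemma S_comp_swp: "r \<in> S \<Longrightarrow> a \<noteq> 0 \<Longrightarrow> b \<noteq> 0 \<Longrightarrow> r \<circ> swp a b = swp (r a) (r b) \<circ> r"
  by (rule comp_swp) (use S_W WgrpD[of r t n] bij_is_inj in auto)

lemma swp_neg: "a \<noteq> 0 \<Longrightarrow> b \<noteq> 0 \<Longrightarrow> swp (- b) (- a) = swp a b"
  by (auto simp: swp_def fun_eq_iff)

lemma cf2_comm: assumes "cf2 r s" shows "r \<circ> s = s \<circ> r"
proof -
  obtain a b c d where P: "(c, d) \<in> P" and rs: "r = swp a b" "s = swp c d" and
     e: "r c = c \<and> r d = d \<or> r c = - d \<and> r d = - c"
    using assms unfolding cf2_def by blast
  have "swp (r c) (r d) = s" using e swp_neg[of c d] spair_bound[OF n2 P] by (auto simp: rs(2))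
  then show ?thesis using S_comp_swp[of r c d] cf_S(1)[OF assms] rs(2) spair_bound[OF n2 P] by simp
qed

lemma cf3_braid: assumes "cf3 r s" shows "r \<circ> (s \<circ> r) = s \<circ> (r \<circ> s)"
proof -
  obtain a b c where P: "(a, b) \<in> P" "(b, c) \<in> P" and ab: "a \<noteq> - b" and rs: "r = swp a b" "s = swp b c"
    using assms(1) unfolding cf3_def by blast
  have S: "r \<in> S" "s \<in> S" using cf_S assms by auto
  have v: "r b = a" "r c = c" "s a = a" "s b = c"
    using P ab by (auto elim!: spair_cases simp: swp_def rs)
  have nz: "a \<noteq> 0" "b \<noteq> 0" "c \<noteq> 0" using spair_bound[OF n2 P(1)] spair_bound[OF n2 P(2)] by auto
  have "r \<circ> (s \<circ> r) = (r \<circ> swp b c) \<circ> r" by (simp only: rs(2) comp_assoc)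
  also have "\<dots> = swp a c" by (simp only: S_comp_swp[OF S(1) nz(2,3)] v comp_assoc S_S[OF S(1)] comp_id)
  also have "\<dots> = (s \<circ> swp a b) \<circ> s" by (simp only: S_comp_swp[OF S(2) nz(1,2)] v comp_assoc S_S[OF S(2)] comp_id)
  finally show ?thesis by (simp only: rs(1) comp_assoc)
qed

lemma cf4_braid: "cf4 r s \<Longrightarrow> r \<circ> (s \<circ> (r \<circ> s)) = s \<circ> (r \<circ> (s \<circ> r))"
  unfolding cf4_def by (auto simp: fun_eq_iff comp_apply swp_def)

lemma inv_comp_S:
  assumes "r \<in> S" "w \<in> W" shows "inv (r \<circ> w) = inv w \<circ> r"
proof -
  obtain a b where ab: "(a, b) \<in> P" "r = swp a b" using assms S_swp by auto
  show ?thesis using o_inv_distrib[OF swp_bij[OF ab(1)] WgrpD(1)[OF assms(2)]] inv_swp[OF ab(1)] ab(2) by simp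
qed

lemma cf2_LD: assumes "cf2 r s" "w \<in> W" shows "LD s (r \<circ> w) \<longleftrightarrow> LD s w" "LD r (s \<circ> w) \<longleftrightarrow> LD r w"
proof -
  obtain a b c d where P: "(a, b) \<in> P" "(c, d) \<in> P" and rs: "r = swp a b" "s = swp c d" and
     e: "r c = c \<and> r d = d \<and> s a = a \<and> s b = b \<or> r c = - d \<and> r d = - c \<and> s a = - b \<and> s b = - a"
    using assms unfolding cf2_def by blast
  have S: "r \<in> S" "s \<in> S" using cf_S assms by auto
  note u = WgrpD(2)[OF W_inv(1)[OF assms(2)]]
  show "LD s (r \<circ> w) \<longleftrightarrow> LD s w"
    using e LD_iff[OF SW[OF S(1) assms(2)] P(2)] LD_iff[OF assms(2) P(2)] u
    by (auto simp: inv_comp_S[OF S(1) assms(2)] comp_apply rs(2)[symmetric])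
  show "LD r (s \<circ> w) \<longleftrightarrow> LD r w"
    using e LD_iff[OF SW[OF S(2) assms(2)] P(1)] LD_iff[OF assms(2) P(1)] u
    by (auto simp: inv_comp_S[OF S(2) assms(2)] comp_apply rs(1)[symmetric])
qed

text \<open>The parameter \<open>p\<close> covers both ends of a coset of the dihedral subgroup.
  With \<open>p\<close> true one starts at its longest element and goes down, as in
  \<open>dihedral_descents\<close>; with \<open>p\<close> false one starts at the shortest and goes
  up, as in the regular representation.\<close>

lemma cf3_LD:
  assumes "cf3 r s" "w \<in> W" "LD r w \<longleftrightarrow> p" "LD s w \<longleftrightarrow> p"
  shows "LD s (r \<circ> w) \<longleftrightarrow> p" "LD r (s \<circ> (r \<circ> w)) \<longleftrightarrow> p" "LD r (s \<circ> w) \<longleftrightarrow> p" "LD s (r \<circ> (s \<circ> w)) \<longleftrightarrow> p"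
proof -
  obtain a b c where P: "(a, b) \<in> P" "(b, c) \<in> P" and ab: "a \<noteq> - b" and rs: "r = swp a b" "s = swp b c"
    using assms(1) unfolding cf3_def by blast
  have S: "r \<in> S" "s \<in> S" using cf_S assms by auto
  have v: "swp a b c = c" "swp b c a = a" using P ab by (auto elim!: spair_cases simp: swp_def)
  note W = SW[OF S(1) assms(2)] SW[OF S(2) assms(2)]
  note W2 = SW[OF S(2) W(1)] SW[OF S(1) W(2)]
  note I = inv_comp_S[OF S(1) assms(2)] inv_comp_S[OF S(2) assms(2)]
  note I2 = inv_comp_S[OF S(2) W(1)] inv_comp_S[OF S(1) W(2)]
  have L: "LD r w \<longleftrightarrow> inv w a > inv w b" "LD s w \<longleftrightarrow> inv w b > inv w c"
    "inv w a \<noteq> inv w b" "inv w b \<noteq> inv w c"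
    unfolding rs by (rule LD_iff[OF assms(2) P(1)] LD_iff[OF assms(2) P(2)] inv_neq[OF assms(2) P(1)] inv_neq[OF assms(2) P(2)])+
  show "LD s (r \<circ> w) \<longleftrightarrow> p" "LD r (s \<circ> w) \<longleftrightarrow> p"
    using LD_iff[OF W(1) P(2)] LD_iff[OF W(2) P(1)] L assms(3,4) v
    by (cases p; simp add: I comp_apply rs[symmetric]; simp add: rs)+
  show "LD r (s \<circ> (r \<circ> w)) \<longleftrightarrow> p" "LD s (r \<circ> (s \<circ> w)) \<longleftrightarrow> p"
    using LD_iff[OF W2(1) P(1)] LD_iff[OF W2(2) P(2)] L assms(3,4) v
    by (cases p; simp add: I I2 comp_apply rs[symmetric]; simp add: rs)+
qed

lemma cf4_LD:
  assumes "cf4 r s" "w \<in> W" "LD r w \<longleftrightarrow> p" "LD s w \<longleftrightarrow> p"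
  shows "LD s (r \<circ> w) \<longleftrightarrow> p" "LD r (s \<circ> (r \<circ> w)) \<longleftrightarrow> p" "LD s (r \<circ> (s \<circ> (r \<circ> w))) \<longleftrightarrow> p"
    "LD r (s \<circ> w) \<longleftrightarrow> p" "LD s (r \<circ> (s \<circ> w)) \<longleftrightarrow> p" "LD r (s \<circ> (r \<circ> (s \<circ> w))) \<longleftrightarrow> p"
proof -
  have rs: "r = swp (- 1) 1" "s = swp 1 2" and P: "(- 1, 1) \<in> P" "(1, 2) \<in> P"
    using assms(1) n2 unfolding cf4_def by (auto simp: spair_def)
  have S: "r \<in> S" "s \<in> S" using cf_S assms by auto
  have v: "swp (- 1) 1 2 = 2" "swp (- 1) 1 (- 2) = - 2" "swp 1 2 (- 1) = - 2" "swp 1 2 (- 2) = - 1"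
    "swp (- 1) 1 1 = - 1" "swp (- 1) 1 (- 1) = 1" by (auto simp: swp_def)
  note W = SW[OF S(1) assms(2)] SW[OF S(2) assms(2)]
  note W2 = SW[OF S(2) W(1)] SW[OF S(1) W(2)]
  note W3 = SW[OF S(1) W2(1)] SW[OF S(2) W2(2)]
  note I = inv_comp_S[OF S(1) assms(2)] inv_comp_S[OF S(2) assms(2)]
    inv_comp_S[OF S(2) W(1)] inv_comp_S[OF S(1) W(2)] inv_comp_S[OF S(1) W2(1)] inv_comp_S[OF S(2) W2(2)]
  have L: "LD r w \<longleftrightarrow> inv w (- 1) > inv w 1" "LD s w \<longleftrightarrow> inv w 1 > inv w 2"
    "inv w (- 1) \<noteq> inv w 1" "inv w 1 \<noteq> inv w 2"
    unfolding rs by (rule LD_iff[OF assms(2) P(1)] LD_iff[OF assms(2) P(2)] inv_neq[OF assms(2) P(1)] inv_neq[OF assms(2) P(2)])+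
  note u = WgrpD(2)[OF W_inv(1)[OF assms(2)], of 1] WgrpD(2)[OF W_inv(1)[OF assms(2)], of 2]
  note L' = L[unfolded u] assms(3,4)
  note D = LD_iff[OF _ P(1), folded rs] LD_iff[OF _ P(2), folded rs]
  show "LD s (r \<circ> w) \<longleftrightarrow> p" "LD r (s \<circ> w) \<longleftrightarrow> p"
    using L' by (cases p; simp add: D W I comp_apply; simp add: rs v u)+
  show "LD r (s \<circ> (r \<circ> w)) \<longleftrightarrow> p" "LD s (r \<circ> (s \<circ> w)) \<longleftrightarrow> p"
    using L' by (cases p; simp add: D W W2 I comp_apply; simp add: rs v u)+
  show "LD s (r \<circ> (s \<circ> (r \<circ> w))) \<longleftrightarrow> p" "LD r (s \<circ> (r \<circ> (s \<circ> w))) \<longleftrightarrow> p"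
    using L' by (cases p; simp add: D W W2 W3 I comp_apply; simp add: rs v u)+
qed

text \<open>The relations are relative to an invariant set \<open>X\<close> because the operators
  are functions on all vectors and are controlled only on \<open>fspace V\<close>.\<close>

definition braided :: "(perm \<Rightarrow> vec \<Rightarrow> vec) \<Rightarrow> vec set \<Rightarrow> bool" where
  "braided T X \<longleftrightarrow> (\<forall>s\<in>S. \<forall>v\<in>X. T s v \<in> X) \<and>
    (\<forall>r s. cf2 r s \<longrightarrow> (\<forall>v\<in>X. T r (T s v) = T s (T r v))) \<and>
    (\<forall>r s. cf3 r s \<longrightarrow> (\<forall>v\<in>X. T r (T s (T r v)) = T s (T r (T s v)))) \<and>
    (\<forall>r s. cf4 r s \<longrightarrow> (\<forall>v\<in>X. T r (T s (T r (T s v))) = T s (T r (T s (T r v)))))"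

text \<open>An element with two left descents begins with the longest element of the dihedral
  subgroup they generate. \<open>r # p\<close> and \<open>s # q\<close> are the two alternating
  words for that element, and \<open>w0\<close> is what remains.\<close>

lemma dihedral_descents:
  assumes rs: "r \<in> S" "s \<in> S" "r \<noteq> s" and w: "w \<in> W" and D: "LD r w" "LD s w"
  shows "\<exists>p q w0. w0 \<in> W \<and> set p \<subseteq> S \<and> set q \<subseteq> S \<and> length p = length q \<and>
    w = prodw (r # p) \<circ> w0 \<and> w = prodw (s # q) \<circ> w0 \<and> len w = Suc (length p) + len w0 \<and>
    (\<forall>T X. braided T X \<longrightarrow> (\<forall>x\<in>X. List.foldr T (r # p) x = List.foldr T (s # q) x))"
    (is "?Q r s")
proof -
  note prodw_simps = prodw_Cons prodw_Nil comp_id comp_assoc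
  have q2: "?Q r s" if c: "cf2 r s" and D: "LD r w" "LD s w" for r s
  proof (intro exI conjI allI impI ballI)
    have S: "r \<in> S" "s \<in> S" using cf_S c by auto
    let ?w0 = "s \<circ> (r \<circ> w)"
    show "?w0 \<in> W" "set [s] \<subseteq> S" "set [r] \<subseteq> S" "length [s] = length [r]" using S w by (auto intro: SW)
    have "LD s (r \<circ> w)" using cf2_LD[OF c w] D by simp
    then show "len w = Suc (length [s]) + len ?w0"
      using len_S(1)[OF w S(1)] len_S(1)[OF SW[OF S(1) w] S(2)] D by simp
    show "w = prodw (r # [s]) \<circ> ?w0" by (simp only: prodw_simps S_S_comp[OF S(1)] S_S_comp[OF S(2)])
    then show "w = prodw (s # [r]) \<circ> ?w0" by (simp only: prodw_simps cf2_comm[OF c])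
    fix T X x assume "braided T X" "x \<in> X"
    then show "List.foldr T (r # [s]) x = List.foldr T (s # [r]) x"
      using c unfolding braided_def by simp blast
  qed
  have q3: "?Q r s" if c: "cf3 r s" and D: "LD r w" "LD s w" for r s
  proof (intro exI conjI allI impI ballI)
    have S: "r \<in> S" "s \<in> S" using cf_S c by auto
    let ?w0 = "r \<circ> (s \<circ> (r \<circ> w))"
    show "?w0 \<in> W" "set [s, r] \<subseteq> S" "set [r, s] \<subseteq> S" "length [s, r] = length [r, s]" using S w by (auto intro: SW)
    have "LD s (r \<circ> w)" "LD r (s \<circ> (r \<circ> w))" using cf3_LD[OF c w, of True] D by simp_all
    then show "len w = Suc (length [s, r]) + len ?w0"
      using len_S(1)[OF w S(1)] len_S(1)[OF SW[OF S(1) w] S(2)] len_S(1)[OF SW[OF S(2) SW[OF S(1) w]] S(1)] D by simp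
    show "w = prodw (r # [s, r]) \<circ> ?w0" by (simp only: prodw_simps S_S_comp[OF S(1)] S_S_comp[OF S(2)])
    then have "w = (r \<circ> (s \<circ> r)) \<circ> ?w0" by (simp only: prodw_simps)
    then show "w = prodw (s # [r, s]) \<circ> ?w0" unfolding cf3_braid[OF c] by (simp only: prodw_simps)
    fix T X x assume "braided T X" "x \<in> X"
    then show "List.foldr T (r # [s, r]) x = List.foldr T (s # [r, s]) x"
      using c unfolding braided_def by simp blast
  qed
  have q4: "?Q r s" if c: "cf4 r s" and D: "LD r w" "LD s w" for r s
  proof (intro exI conjI allI impI ballI)
    have S: "r \<in> S" "s \<in> S" using cf_S c by auto
    let ?w0 = "s \<circ> (r \<circ> (s \<circ> (r \<circ> w)))"
    show "?w0 \<in> W" "set [s, r, s] \<subseteq> S" "set [r, s, r] \<subseteq> S" "length [s, r, s] = length [r, s, r]"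
      using S w by (auto intro: SW)
    have "LD s (r \<circ> w)" "LD r (s \<circ> (r \<circ> w))" "LD s (r \<circ> (s \<circ> (r \<circ> w)))" using cf4_LD[OF c w, of True] D by simp_all
    then show "len w = Suc (length [s, r, s]) + len ?w0"
      using len_S(1)[OF w S(1)] len_S(1)[OF SW[OF S(1) w] S(2)] len_S(1)[OF SW[OF S(2) SW[OF S(1) w]] S(1)]
        len_S(1)[OF SW[OF S(1) SW[OF S(2) SW[OF S(1) w]]] S(2)] D by simp
    show "w = prodw (r # [s, r, s]) \<circ> ?w0" by (simp only: prodw_simps S_S_comp[OF S(1)] S_S_comp[OF S(2)])
    then have "w = (r \<circ> (s \<circ> (r \<circ> s))) \<circ> ?w0" by (simp only: prodw_simps)
    then show "w = prodw (s # [r, s, r]) \<circ> ?w0" unfolding cf4_braid[OF c] by (simp only: prodw_simps)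
    fix T X x assume "braided T X" "x \<in> X"
    then show "List.foldr T (r # [s, r, s]) x = List.foldr T (s # [r, s, r]) x"
      using c unfolding braided_def by simp blast
  qed
  have sym: "?Q r s" if "?Q s r" for r s
  proof -
    from that obtain p q w0 where "w0 \<in> W" "set p \<subseteq> S" "set q \<subseteq> S" "length p = length q"
      "w = prodw (s # p) \<circ> w0" "w = prodw (r # q) \<circ> w0" "len w = Suc (length p) + len w0"
      "\<forall>T X. braided T X \<longrightarrow> (\<forall>x\<in>X. List.foldr T (s # p) x = List.foldr T (r # q) x)" by blast
    then show ?thesis by (intro exI[of _ q] exI[of _ p] exI[of _ w0]) auto
  qed
  from rs show ?thesis
    by (rule cf_cases) (blast intro: q2[OF _ D] q3[OF _ D] q4[OF _ D] sym[OF q3[OF _ D(2,1)]] sym[OF q4[OF _ D(2,1)]])+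
qed

section \<open>Matsumoto's theorem and operators along reduced words\<close>

definition reduced :: "perm list \<Rightarrow> bool" where
  "reduced ws \<longleftrightarrow> set ws \<subseteq> S \<and> length ws = len (prodw ws)"

lemma reduced_Cons:
  assumes "reduced (s # ws)" shows "reduced ws" "LD s (prodw (s # ws))" "s \<in> S"
proof -
  have s: "s \<in> S" and ws: "set ws \<subseteq> S" and l: "Suc (length ws) = len (s \<circ> prodw ws)"
    using assms by (auto simp: reduced_def prodw_Cons)
  note w = word_W[OF ws]
  have "len (prodw ws) \<le> length ws" using len_word_le[OF ws] .
  then have "length ws = len (prodw ws)" using len_S[OF w s] l by (cases "LD s (prodw ws)") auto
  then show "reduced ws" using ws by (simp add: reduced_def)
  then show "LD s (prodw (s # ws))"
    unfolding prodw_Cons using LD_flip[OF w s] len_S(1)[OF w s] l by (auto simp: reduced_def)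
  show "s \<in> S" by fact
qed

lemma foldr_closed: "braided T X \<Longrightarrow> set ws \<subseteq> S \<Longrightarrow> v \<in> X \<Longrightarrow> List.foldr T ws v \<in> X"
  by (induction ws) (auto simp: braided_def)

text \<open>If the first letters \<open>r\<close> and \<open>s\<close> differ, both are descents,
  and there are reduced words \<open>(r # p) @ vs\<close> and \<open>(s # q) @ vs\<close> of the
  same element that differ by one braid relation. Induction compares each given word with the one
  that shares its first letter.\<close>

lemma matsumoto:
  assumes T: "braided T X" and "reduced ws" "reduced ws'" "prodw ws = prodw ws'" "v \<in> X"
  shows "List.foldr T ws v = List.foldr T ws' v"
  using assms(2-5)
proof (induction "length ws" arbitrary: ws ws' rule: less_induct)
  case less
  have l: "length ws = length ws'" using less.prems by (simp add: reduced_def)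
  show ?case
  proof (cases ws)
    case Nil then show ?thesis using l by simp
  next
    case (Cons r us)
    then obtain s us' where ws': "ws' = s # us'" using l by (cases ws') auto
    note R = reduced_Cons[OF less.prems(1)[unfolded Cons]] reduced_Cons[OF less.prems(2)[unfolded ws']]
    define w where "w = prodw ws"
    have w: "w \<in> W" unfolding w_def using less.prems by (auto intro: word_W simp: reduced_def)
    have wr: "w = r \<circ> prodw us" and ws: "w = s \<circ> prodw us'"
      using less.prems(3) by (simp_all add: w_def Cons ws' prodw_Cons)
    then have pu: "prodw us = r \<circ> w" "prodw us' = s \<circ> w"
      using S_S_comp[OF R(3), of "prodw us"] S_S_comp[OF R(6), of "prodw us'"] by simp_all
    show ?thesis
    proof (cases "r = s")
      case True
      then have "List.foldr T us v = List.foldr T us' v"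
        using less.hyps[of us us'] R less.prems pu Cons by auto
      then show ?thesis using True by (simp add: Cons ws')
    next
      case False
      have D: "LD r w" "LD s w" using R(2,5) less.prems(3) by (simp_all add: w_def Cons ws')
      obtain p q w0 where d: "w0 \<in> W" "set p \<subseteq> S" "set q \<subseteq> S" "length p = length q"
        "w = prodw (r # p) \<circ> w0" "w = prodw (s # q) \<circ> w0" "len w = Suc (length p) + len w0"
        "\<And>x. x \<in> X \<Longrightarrow> List.foldr T (r # p) x = List.foldr T (s # q) x"
        using dihedral_descents[OF R(3,6) False w D] T by metis
      obtain vs where vs: "set vs \<subseteq> S" "prodw vs = w0" "length vs = len w0" using len_word[OF d(1)] by blast
      have vX: "List.foldr T vs v \<in> X" using foldr_closed[OF T vs(1)] less.prems by simp
      have 1: "prodw us = prodw (p @ vs)" "prodw us' = prodw (q @ vs)"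
        unfolding pu prodw_append vs(2)
        by (subst d(5), simp only: prodw_Cons comp_assoc S_S_comp[OF R(3)],
            subst d(6), simp only: prodw_Cons comp_assoc S_S_comp[OF R(6)])
      have "length us = length (p @ vs)" "length us' = length (q @ vs)"
        using d(4,7) vs(3) less.prems(1) l by (auto simp: reduced_def Cons ws' w_def)
      then have 2: "reduced (p @ vs)" "reduced (q @ vs)"
        using R(1,4) 1 d(2,3) vs(1) by (auto simp: reduced_def)
      have "List.foldr T us v = List.foldr T (p @ vs) v" "List.foldr T us' v = List.foldr T (q @ vs) v"
        using less.hyps[of us "p @ vs"] less.hyps[of us' "q @ vs"] R 1 2 less.prems(4) Cons ws' l by auto
      then show ?thesis using d(8)[OF vX] by (simp add: Cons ws' foldr_append)
    qed
  qed
qed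

definition Tw :: "(perm \<Rightarrow> vec \<Rightarrow> vec) \<Rightarrow> perm \<Rightarrow> vec \<Rightarrow> vec" where
  "Tw T w v = List.foldr T (redword t n w) v"

lemma redword: assumes "w \<in> W" shows "reduced (redword t n w)" "prodw (redword t n w) = w"
proof -
  have "\<exists>ws. set ws \<subseteq> S \<and> List.foldr (\<circ>) ws id = w \<and> length ws = len w"
    using len_word[OF assms] by (simp add: prodw_def)
  from someI_ex[OF this] show "reduced (redword t n w)" "prodw (redword t n w) = w"
    by (auto simp: redword_def reduced_def prodw_def)
qed

lemma Tw_reduced: "braided T X \<Longrightarrow> reduced ws \<Longrightarrow> v \<in> X \<Longrightarrow> Tw T (prodw ws) v = List.foldr T ws v"
  unfolding Tw_def
  by (rule matsumoto) (use redword word_W in \<open>auto simp: reduced_def\<close>)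

lemma Tw_closed: "braided T X \<Longrightarrow> w \<in> W \<Longrightarrow> v \<in> X \<Longrightarrow> Tw T w v \<in> X"
  unfolding Tw_def using foldr_closed redword by (auto simp: reduced_def)

lemma Tw_id: assumes "braided T X" "v \<in> X" shows "Tw T id v = v"
proof -
  have "len id \<le> 0" using len_word_le[of "[]"] by (simp only: prodw_Nil) simp
  then have "reduced []" by (simp add: reduced_def)
  from Tw_reduced[OF assms(1) this assms(2)] show ?thesis by (simp only: prodw_Nil) simp
qed

lemma Tw_left:
  assumes "braided T X" "w \<in> W" "s \<in> S" "\<not> LD s w" "v \<in> X"
  shows "Tw T (s \<circ> w) v = T s (Tw T w v)"
proof -
  let ?ws = "redword t n w"
  have "reduced (s # ?ws)" using redword[OF assms(2)] assms(3) len_S(2)[OF assms(2,3,4)]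
    by (auto simp: reduced_def prodw_Cons)
  from Tw_reduced[OF assms(1) this assms(5)] show ?thesis
    by (simp add: prodw_Cons redword[OF assms(2)] Tw_def)
qed

lemma Tw_S: assumes "braided T X" "s \<in> S" "v \<in> X" shows "Tw T s v = T s v"
proof -
  have "\<not> LD s id" using len_word_le[of "[]"] by (auto simp: LD_def simp flip: id_def)
  from Tw_left[OF assms(1) id_Wgrp assms(2) this assms(3)] Tw_id[OF assms(1,3)]
  show ?thesis by (simp only: comp_id)
qed

lemma Tw_right:
  assumes T: "braided T X" and w: "w \<in> W" and s: "s \<in> S" and l: "len (w \<circ> s) = len w + 1" and v: "v \<in> X"
  shows "Tw T (w \<circ> s) v = Tw T w (T s v)"
proof -
  let ?ws = "redword t n w"
  have "reduced (?ws @ [s])" using redword[OF w] s l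
    by (auto simp: reduced_def prodw_append prodw_single)
  from Tw_reduced[OF T this v] show ?thesis
    by (simp add: prodw_append prodw_single redword[OF w] Tw_def foldr_append)
qed

subsection \<open>Linear representations\<close>

definition Hact :: "(perm \<Rightarrow> vec \<Rightarrow> vec) \<Rightarrow> vec \<Rightarrow> vec \<Rightarrow> vec" where
  "Hact T a v = (\<Sum>w\<in>W. vscale (a w) (Tw T w v))"

lemma hact_Hact: "hact t n T a v = Hact T a v"
  by (simp add: hact_def Hact_def Tw_def fun_eq_iff sum_apply vec_apply)

lemma lin_foldr:
  assumes "\<And>s. s \<in> S \<Longrightarrow> lin V V (T s)" "set ws \<subseteq> S" shows "lin V V (List.foldr T ws)"
  using assms(2)
proof (induction ws)
  case Nil show ?case by (simp add: slin_def)
next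
  case (Cons s ws) then show ?case using assms(1) by (simp add: slin_def comp_apply)
qed

lemma lin_Tw: "(\<And>s. s \<in> S \<Longrightarrow> lin V V (T s)) \<Longrightarrow> w \<in> W \<Longrightarrow> lin V V (Tw T w)"
  unfolding Tw_def using lin_foldr[of V T "redword t n w"] redword(1)[of w] by (simp add: reduced_def)

lemma slin_Hact_right:
  assumes "\<And>s. s \<in> S \<Longrightarrow> lin V V (T s)" shows "lin V V (Hact T a)"
proof -
  have "lin V V (\<lambda>v. \<Sum>w\<in>A. vscale (a w) (Tw T w v))" if "finite A" "A \<subseteq> W" for A
    using that
  proof (induction A rule: finite_induct)
    case empty show ?case by (simp add: slin_def vscale_simps)
  next
    case (insert w A)
    then have "lin V V (\<lambda>v. vscale (a w) (Tw T w v) + (\<Sum>w\<in>A. vscale (a w) (Tw T w v)))"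
      using assms by (intro slin_plus slin_scale lin_Tw) auto
    then show ?case using insert by simp
  qed
  from this[OF finite_W] show ?thesis unfolding Hact_def by simp
qed

lemma slin_Hact_left:
  assumes "\<And>s. s \<in> S \<Longrightarrow> lin V V (T s)" "v \<in> fspace V" shows "lin W V (\<lambda>a. Hact T a v)"
proof -
  have "Tw T w v \<in> fspace V" if "w \<in> W" for w using slinD(1)[OF lin_Tw] assms that by blast
  then show ?thesis
    unfolding slin_def Hact_def
    by (auto simp: vscale_simps vec_apply sum.distrib fun_eq_iff sum_apply sum_distrib_left mult.assoc
      distrib_right intro!: fspace_sum)
qed

lemma Hact_bv: assumes "w \<in> W" shows "Hact T (bv w) v = Tw T w v"
proof -
  have "Hact T (bv w) v = (\<Sum>u\<in>W. if u = w then Tw T w v else 0)"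
    unfolding Hact_def by (rule sum.cong) (auto simp: bv_def)
  then show ?thesis using assms finite_W by simp
qed

lemma Hact_intertwine:
  assumes \<phi>: "slin \<sigma> V V' \<phi>" and \<sigma>: "ringhom \<sigma>" and cl: "\<And>s v. s \<in> S \<Longrightarrow> v \<in> fspace V \<Longrightarrow> T1 s v \<in> fspace V"
    and eq: "\<And>s v. s \<in> S \<Longrightarrow> v \<in> fspace V \<Longrightarrow> \<phi> (T1 s v) = T2 s (\<phi> v)" and v: "v \<in> fspace V"
  shows "\<phi> (Hact T1 a v) = Hact T2 (\<lambda>w. \<sigma> (a w)) (\<phi> v)"
proof -
  have *: "List.foldr T1 ws v \<in> fspace V \<and> \<phi> (List.foldr T1 ws v) = List.foldr T2 ws (\<phi> v)" if "set ws \<subseteq> S" for ws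
    using that v by (induction ws) (auto simp: cl eq)
  then have T: "Tw T1 w v \<in> fspace V" "\<phi> (Tw T1 w v) = Tw T2 w (\<phi> v)" if "w \<in> W" for w
    unfolding Tw_def using redword(1)[OF that] by (auto simp: reduced_def)
  show ?thesis
    unfolding Hact_def
    by (subst slin_sum[OF \<phi>]) (auto simp: T slinD(3)[OF \<phi>] intro!: sum.cong)
qed

end

locale hecke_module = weyl t n for t n +
  fixes V :: "perm set" and T :: "perm \<Rightarrow> vec \<Rightarrow> vec"
  assumes finV: "finite V"
    and T_lin: "\<And>s. s \<in> S \<Longrightarrow> lin V V (T s)"
    and T_quad: "\<And>s v. s \<in> S \<Longrightarrow> v \<in> fspace V \<Longrightarrow> T s (T s v) = v + vscale dd (T s v)"
    and T_braid2: "\<And>r s v. cf2 r s \<Longrightarrow> v \<in> fspace V \<Longrightarrow> T r (T s v) = T s (T r v)"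
    and T_braid3: "\<And>r s v. cf3 r s \<Longrightarrow> v \<in> fspace V \<Longrightarrow> T r (T s (T r v)) = T s (T r (T s v))"
    and T_braid4: "\<And>r s v. cf4 r s \<Longrightarrow> v \<in> fspace V \<Longrightarrow> T r (T s (T r (T s v))) = T s (T r (T s (T r v)))"
begin

lemmas T_closed = slinD(1)[OF T_lin]

lemma T_braided: "braided T (fspace V)"
  unfolding braided_def using T_closed T_braid2 T_braid3 T_braid4 by blast

definition Ti :: "perm \<Rightarrow> vec \<Rightarrow> vec" where "Ti s v = T s v - vscale dd v"

lemma Ti_lin: "s \<in> S \<Longrightarrow> lin V V (Ti s)"
  unfolding Ti_def by (intro slin_diff T_lin slin_scale slin_ident)

lemmas Ti_closed = slinD(1)[OF Ti_lin]

lemma T_Ti: "s \<in> S \<Longrightarrow> v \<in> fspace V \<Longrightarrow> T s (Ti s v) = v"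
  by (simp add: Ti_def slin_minus[OF T_lin] slinD(3)[OF T_lin] T_closed T_quad)
lemma Ti_T: "s \<in> S \<Longrightarrow> v \<in> fspace V \<Longrightarrow> Ti s (T s v) = v"
  by (simp add: Ti_def T_quad)

text \<open>Inversion turns a braid relation into one for the inverses: with \<open>x\<close> one
  side of it at \<open>v\<close>, the operators \<open>T\<close> lead from \<open>x\<close> back to
  \<open>v\<close>, and their relation allows the return to \<open>v\<close> to be undone in the
  other order.\<close>

lemma Ti_braided: "braided Ti (fspace V)"
  unfolding braided_def
proof (intro conjI ballI allI impI)
  fix r s v assume v: "v \<in> fspace V"
  note c = Ti_closed T_closed
  { assume "s \<in> S" then show "Ti s v \<in> fspace V" using v by (rule Ti_closed) }
  { assume f: "cf2 r s"
    then have S: "r \<in> S" "s \<in> S" using cf_S by auto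
    define x where "x = Ti r (Ti s v)"
    have x: "x \<in> fspace V" using S v c by (simp add: x_def)
    have "v = T s (T r x)" using S v by (simp add: x_def c T_Ti)
    also have "\<dots> = T r (T s x)" by (rule T_braid2[OF f x, symmetric])
    finally have "Ti s (Ti r v) = x" using S x by (simp add: c Ti_T)
    then show "Ti r (Ti s v) = Ti s (Ti r v)" by (simp add: x_def) }
  { assume f: "cf3 r s"
    then have S: "r \<in> S" "s \<in> S" using cf_S by auto
    define x where "x = Ti r (Ti s (Ti r v))"
    have x: "x \<in> fspace V" using S v c by (simp add: x_def)
    have "v = T r (T s (T r x))" using S v by (simp add: x_def c T_Ti)
    also have "\<dots> = T s (T r (T s x))" by (rule T_braid3[OF f x])
    finally have "Ti s (Ti r (Ti s v)) = x" using S x by (simp add: c Ti_T)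
    then show "Ti r (Ti s (Ti r v)) = Ti s (Ti r (Ti s v))" by (simp add: x_def) }
  { assume f: "cf4 r s"
    then have S: "r \<in> S" "s \<in> S" using cf_S by auto
    define x where "x = Ti r (Ti s (Ti r (Ti s v)))"
    have x: "x \<in> fspace V" using S v c by (simp add: x_def)
    have "v = T s (T r (T s (T r x)))" using S v by (simp add: x_def c T_Ti)
    also have "\<dots> = T r (T s (T r (T s x)))" by (rule T_braid4[OF f x, symmetric])
    finally have "Ti s (Ti r (Ti s (Ti r v))) = x" using S x by (simp add: c Ti_T)
    then show "Ti r (Ti s (Ti r (Ti s v))) = Ti s (Ti r (Ti s (Ti r v)))" by (simp add: x_def) }
qed

lemma Hact_closed: "v \<in> fspace V \<Longrightarrow> Hact T a v \<in> fspace V"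
  by (rule slinD(1)[OF slin_Hact_right[of V T]]) (rule T_lin)

lemma foldr_T_Ti: "set ws \<subseteq> S \<Longrightarrow> v \<in> fspace V \<Longrightarrow> List.foldr T (rev ws) (List.foldr Ti ws v) = v"
proof (induction ws)
  case (Cons s ws)
  then show ?case using foldr_closed[OF Ti_braided, of ws v] by (simp add: foldr_append T_Ti)
qed simp

lemma foldr_Ti_T: "set ws \<subseteq> S \<Longrightarrow> v \<in> fspace V \<Longrightarrow> List.foldr Ti ws (List.foldr T (rev ws) v) = v"
proof (induction ws arbitrary: v)
  case (Cons s ws)
  then show ?case by (simp add: foldr_append T_closed Ti_T)
qed simp

end

context weyl
begin

subsection \<open>The regular representation\<close>

text \<open>Every \<open>s\<close> moves every \<open>w\<close>, so there are no loops and their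
  scalar is filled with \<open>xx\<close>. The height is twice the length because multiplication
  changes the length by one while \<open>hgraph\<close> has steps of two.\<close>

sublocale reg: hgraph W S "\<lambda>s w. s \<circ> w" "\<lambda>s w. \<not> LD s w" LD "\<lambda>s w. xx" "\<lambda>w. 2 * len w"
proof
  show "finite W" by (rule finite_W)
  fix s w assume s: "s \<in> S" and w: "w \<in> W"
  { assume "\<not> LD s w" then show "s \<circ> w \<in> W \<and> \<not> LD s w \<and> LD s (s \<circ> w) \<and> s \<circ> (s \<circ> w) = w \<and>
      2 * len (s \<circ> w) = 2 * len w + 2"
      using SW[OF s w] LD_flip[OF w s] S_S_comp[OF s] len_S(2)[OF w s] by simp }
  { assume "LD s w" then show "s \<circ> w \<in> W \<and> \<not> LD s (s \<circ> w) \<and> s \<circ> (s \<circ> w) = w"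
      using SW[OF s w] LD_flip[OF w s] S_S_comp[OF s] by simp }
qed simp

lemma reg_T_up: "s \<in> S \<Longrightarrow> w \<in> W \<Longrightarrow> \<not> LD s w \<Longrightarrow> reg.T s (bv w) = bv (s \<circ> w)"
  by (rule reg.T_up)

sublocale reg: hecke_module t n W "reg.T"
proof
  show "finite W" by (rule finite_W)
  show "lin W W (reg.T s)" if "s \<in> S" for s using that by (rule reg.T_lin)
  show "reg.T s (reg.T s v) = v + vscale dd (reg.T s v)" if "s \<in> S" "v \<in> fspace W" for s v
    using that by (rule reg.T_quad)
  fix r s v assume v: "v \<in> fspace W"
  { assume c: "cf2 r s"
    note S = cf_S(1)[OF c]
    show "reg.T r (reg.T s v) = reg.T s (reg.T r v)"
    proof (rule reg.braid2I[OF _ _ _ v])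
      fix z assume z: "z \<in> W" "\<not> LD r z" "\<not> LD s z"
      have e: "r \<circ> (s \<circ> z) = s \<circ> (r \<circ> z)"
        using arg_cong[OF cf2_comm[OF c], of "\<lambda>x. x \<circ> z"] by (simp only: comp_assoc)
      from z show "reg.T r (reg.T s (bv z)) = reg.T s (reg.T r (bv z))"
        using S cf2_LD[OF c z(1)] e by (simp add: reg_T_up SW)
    qed (use S in auto) }
  { assume c: "cf3 r s"
    note S = cf_S(2)[OF c]
    show "reg.T r (reg.T s (reg.T r v)) = reg.T s (reg.T r (reg.T s v))"
    proof (rule reg.braid3I[OF _ _ _ v])
      fix z assume z: "z \<in> W" "\<not> LD r z" "\<not> LD s z"
      have e: "r \<circ> (s \<circ> (r \<circ> z)) = s \<circ> (r \<circ> (s \<circ> z))"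
        using arg_cong[OF cf3_braid[OF c], of "\<lambda>x. x \<circ> z"] by (simp only: comp_assoc)
      show "reg.T r (reg.T s (reg.T r (bv z))) = reg.T s (reg.T r (reg.T s (bv z)))"
        using S cf3_LD[OF c z(1), of False] z e by (simp add: reg_T_up SW)
    qed (use S in auto) }
  { assume c: "cf4 r s"
    note S = cf_S(3)[OF c]
    show "reg.T r (reg.T s (reg.T r (reg.T s v))) = reg.T s (reg.T r (reg.T s (reg.T r v)))"
    proof (rule reg.braid4I[OF _ _ _ v])
      fix z assume z: "z \<in> W" "\<not> LD r z" "\<not> LD s z"
      have e: "r \<circ> (s \<circ> (r \<circ> (s \<circ> z))) = s \<circ> (r \<circ> (s \<circ> (r \<circ> z)))"
        using arg_cong[OF cf4_braid[OF c], of "\<lambda>x. x \<circ> z"] by (simp only: comp_assoc)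
      show "reg.T r (reg.T s (reg.T r (reg.T s (bv z)))) = reg.T s (reg.T r (reg.T s (reg.T r (bv z))))"
        using S cf4_LD[OF c z(1), of False] z e by (simp add: reg_T_up SW)
    qed (use S in auto) }
qed

text \<open>\<open>hs\<close> prescribes coefficients where \<open>reg.T\<close> prescribes images
  of basis vectors; the symmetry in \<open>T_coeff\<close> makes the two agree.\<close>

lemma hs_reg: assumes "s \<in> S" "a \<in> fspace W" shows "hs t n s a = reg.T s a"
proof
  fix w
  show "hs t n s a w = reg.T s a w"
  proof (cases "w \<in> W")
    case True
    then show ?thesis using reg.T_coeff[OF assms(1) True assms(2)] by (simp add: hs_def LD_def)
  next
    case False
    then have "s \<circ> w \<notin> W" using SW[OF assms(1), of "s \<circ> w"] S_S_comp[OF assms(1), of w] by auto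
    then show ?thesis using False assms(2) reg.T_closed[OF assms] by (auto simp: hs_def fspace_def)
  qed
qed

lemma foldr_hs: "set ws \<subseteq> S \<Longrightarrow> a \<in> fspace W \<Longrightarrow> List.foldr (hs t n) ws a = List.foldr reg.T ws a"
proof (induction ws)
  case (Cons s ws)
  then show ?case using foldr_closed[OF reg.T_braided, of ws a] by (simp add: hs_reg)
qed simp

lemma hmult_reg: "a \<in> fspace W \<Longrightarrow> b \<in> fspace W \<Longrightarrow> hmult t n a b = Hact reg.T a b"
  unfolding hmult_def hact_Hact Hact_def Tw_def
  by (rule sum.cong) (use redword in \<open>auto simp: foldr_hs reduced_def\<close>)

end

context hecke_module
begin

lemma Hact_reg:
  assumes s: "s \<in> S" and a: "a \<in> fspace W" and v: "v \<in> fspace V"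
  shows "Hact T (reg.T s a) v = T s (Hact T a v)"
proof (rule slin_eqI[OF finite_W _ _ _ a])
  show "lin W V (\<lambda>a. Hact T (reg.T s a) v)"
    using slin_comp[OF reg.T_lin[OF s] slin_Hact_left[OF T_lin v]] by simp
  show "lin W V (\<lambda>a. T s (Hact T a v))"
    using slin_comp[OF slin_Hact_left[OF T_lin v] T_lin[OF s]] by simp
  fix w assume w: "w \<in> W"
  show "Hact T (reg.T s (bv w)) v = T s (Hact T (bv w) v)"
  proof (cases "LD s w")
    case False
    then show ?thesis using s w SW[OF s w] Tw_left[OF T_braided w s False v]
      by (simp add: reg_T_up Hact_bv)
  next
    case True
    let ?u = "s \<circ> w"
    have u: "?u \<in> W" "\<not> LD s ?u" and su: "s \<circ> ?u = w"
      using SW[OF s w] LD_flip[OF w s] True S_S_comp[OF s] by auto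
    have Tw: "Tw T w v = T s (Tw T ?u v)" using Tw_left[OF T_braided u(1) s u(2) v] su by simp
    have cl: "Tw T ?u v \<in> fspace V" using Tw_closed[OF T_braided u(1) v] .
    have "Hact T (reg.T s (bv w)) v = Hact T (bv ?u) v + vscale dd (Hact T (bv w) v)"
      using reg.T_dn[OF s w True] u(1) w
      by (simp add: slinD(2,3)[OF slin_Hact_left[OF T_lin v]])
    also have "\<dots> = T s (Hact T (bv w) v)"
      using T_quad[OF s cl] by (simp add: Hact_bv u(1) w Tw)
    finally show ?thesis .
  qed
qed

lemma Hact_foldr:
  assumes "set ws \<subseteq> S" and a: "a \<in> fspace W" and v: "v \<in> fspace V"
  shows "Hact T (List.foldr reg.T ws a) v = List.foldr T ws (Hact T a v)"
  using assms(1)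
proof (induction ws)
  case (Cons s ws)
  then show ?case using foldr_closed[OF reg.T_braided, of ws a] a by (simp add: Hact_reg v)
qed simp

text \<open>It is enough that single generators pass through the action, which is
  \<open>Hact_reg\<close>. For the regular module this is the associativity of the Hecke
  algebra.\<close>

lemma Hact_mult:
  assumes a: "a \<in> fspace W" and b: "b \<in> fspace W" and v: "v \<in> fspace V"
  shows "Hact T (Hact reg.T a b) v = Hact T a (Hact T b v)"
proof (rule slin_eqI[OF finite_W _ _ _ a])
  show "lin W V (\<lambda>a. Hact T (Hact reg.T a b) v)"
    using slin_comp[OF slin_Hact_left[OF reg.T_lin b] slin_Hact_left[OF T_lin v]] by simp
  show "lin W V (\<lambda>a. Hact T a (Hact T b v))"
    by (rule slin_Hact_left[OF T_lin Hact_closed[OF v]])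
  fix w assume w: "w \<in> W"
  then show "Hact T (Hact reg.T (bv w) b) v = Hact T (bv w) (Hact T b v)"
    using redword(1)[OF w] unfolding Hact_bv[OF w] unfolding Tw_def
    by (intro Hact_foldr b v) (auto simp: reduced_def)
qed

lemma Hact_one: "v \<in> fspace V \<Longrightarrow> Hact T hone v = v"
  unfolding hone_def Hact_bv[OF id_Wgrp] by (rule Tw_id[OF T_braided])

lemma Hact_Ti_reg:
  assumes "s \<in> S" "a \<in> fspace W" "v \<in> fspace V"
  shows "Hact T (reg.Ti s a) v = Ti s (Hact T a v)"
proof -
  have L: "lin W V (\<lambda>a. Hact T a v)" by (rule slin_Hact_left[OF T_lin assms(3)])
  show ?thesis
    using assms Hact_reg[OF assms] by (simp add: reg.Ti_def Ti_def reg.T_closed slin_minus[OF L] slinD(3)[OF L])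
qed

lemma Hact_foldr_Ti:
  assumes "set ws \<subseteq> S" and a: "a \<in> fspace W" and v: "v \<in> fspace V"
  shows "Hact T (List.foldr reg.Ti ws a) v = List.foldr Ti ws (Hact T a v)"
  using assms(1)
proof (induction ws)
  case (Cons s ws)
  then show ?case using foldr_closed[OF reg.Ti_braided, of ws a] a by (simp add: Hact_Ti_reg v)
qed simp

theorem is_Hmodule_rep_hact: "is_Hmodule_rep t n (fspace V) (hact t n T)"
  unfolding is_Hmodule_rep_def hact_Hact Hset_def vadd_plus
  using slinD[OF slin_Hact_right[OF T_lin]] slinD[OF slin_Hact_left[OF T_lin]] Hact_one
  by (auto simp: hmult_reg Hact_mult)

lemma hact_bv_S: "s \<in> S \<Longrightarrow> v \<in> fspace V \<Longrightarrow> hact t n T (bv s) v = T s v"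
  by (simp add: hact_Hact Hact_bv S_W Tw_S[OF T_braided])

end

section \<open>Inverses of standard basis elements and the bar involution of the Hecke
  algebra\<close>

context weyl
begin

text \<open>The bar of \<open>H_w\<close>: inverse generators multiplied along a reduced word of
  \<open>w\<close>. By \<open>hinv_eq\<close> it is the inverse of the basis element of
  \<open>inv w\<close>.\<close>

definition hbas :: "perm \<Rightarrow> vec" where "hbas w = Tw reg.Ti w hone"

lemma hone_W: "hone \<in> fspace W"
  unfolding hone_def by (rule fspace_simps(6)[OF id_Wgrp])

lemma hbas_W: "w \<in> W \<Longrightarrow> hbas w \<in> fspace W"
  unfolding hbas_def by (rule Tw_closed[OF reg.Ti_braided _ hone_W])

lemma foldr_reg_hone: "reduced ws \<Longrightarrow> List.foldr reg.T ws hone = bv (prodw ws)"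
proof (induction ws)
  case Nil show ?case unfolding hone_def prodw_Nil by (simp add: id_def)
next
  case (Cons s ws)
  note R = reduced_Cons[OF Cons.prems]
  have "prodw ws \<in> W" using R(1) by (auto simp: reduced_def intro: word_W)
  then have "\<not> LD s (prodw ws)" using R(2,3) LD_flip by (simp add: prodw_Cons)
  then show ?case using Cons.IH[OF R(1)] \<open>prodw ws \<in> W\<close> R(3) by (simp add: reg_T_up prodw_Cons)
qed

lemma reg_hone: assumes "a \<in> fspace W" shows "Hact reg.T a hone = a"
proof (rule slin_eqI[OF finite_W slin_Hact_left[OF reg.T_lin hone_W] slin_ident _ assms])
  show "Hact reg.T (bv w) hone = bv w" if w: "w \<in> W" for w
    unfolding Hact_bv[OF w] Tw_def using foldr_reg_hone redword[OF w] by simp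
qed

lemma hinv_eq: assumes w: "w \<in> W" shows "hinv t n (bv (inv w)) = hbas w"
proof -
  let ?ws = "redword t n w" and ?h = "bv (inv w)"
  have ws: "set ?ws \<subseteq> S" "length ?ws = len w" "prodw ?ws = w" using redword[OF w] by (auto simp: reduced_def)
  have iw: "inv w \<in> W" and h: "?h \<in> fspace W" using W_inv(1)[OF w] by auto
  have "prodw (rev ?ws) = inv w" using inv_word[OF ws(1)] ws(3) by simp
  then have rw: "reduced (rev ?ws)" "prodw (rev ?ws) = inv w"
    using ws W_inv(2)[OF w] by (auto simp: reduced_def)
  have 1: "Hact reg.T ?h (hbas w) = hone"
    using foldr_reg_hone[OF rw(1)] reg.foldr_T_Ti[OF ws(1) hone_W] Tw_reduced[OF reg.T_braided rw(1) hbas_W[OF w]]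
    by (simp add: Hact_bv[OF iw] rw(2)) (simp add: hbas_def Tw_def)
  have 2: "Hact reg.T (hbas w) ?h = hone"
  proof -
    have "Hact reg.T (hbas w) ?h = List.foldr reg.Ti ?ws (Hact reg.T hone ?h)"
      unfolding hbas_def Tw_def by (rule reg.Hact_foldr_Ti[OF ws(1) hone_W h])
    also have "Hact reg.T hone ?h = List.foldr reg.T (rev ?ws) hone"
      using reg.Hact_one[OF h] foldr_reg_hone[OF rw(1)] rw(2) by simp
    finally show ?thesis using reg.foldr_Ti_T[OF ws(1) hone_W] by simp
  qed
  show ?thesis
    unfolding hinv_def
  proof (rule the_equality)
    show "hbas w \<in> Hset t n \<and> hmult t n ?h (hbas w) = hone \<and> hmult t n (hbas w) ?h = hone"
      using 1 2 hbas_W[OF w] h by (simp add: Hset_def hmult_reg)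
    fix b assume "b \<in> Hset t n \<and> hmult t n ?h b = hone \<and> hmult t n b ?h = hone"
    then have b: "b \<in> fspace W" and hb: "Hact reg.T b ?h = hone" using h by (auto simp: Hset_def hmult_reg)
    have "b = Hact reg.T b (Hact reg.T ?h (hbas w))" using 1 reg_hone[OF b] by simp
    also have "\<dots> = Hact reg.T (Hact reg.T b ?h) (hbas w)" using reg.Hact_mult[OF b h hbas_W[OF w]] by simp
    also have "\<dots> = hbas w" using reg.Hact_one[OF hbas_W[OF w]] hb by simp
    finally show "b = hbas w" .
  qed
qed

lemma hbar_eq: "hbar t n a = (\<Sum>w\<in>W. vscale (lbar (a w)) (hbas w))"
  by (simp add: hbar_def fun_eq_iff sum_apply vec_apply hinv_eq)

end

context hecke_module
begin

lemma Hact_hbar: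
  assumes v: "v \<in> fspace V"
  shows "hact t n T (hbar t n a) v = Hact Ti (\<lambda>w. lbar (a w)) v"
proof -
  have hb: "Hact T (hbas w) v = Tw Ti w v" if "w \<in> W" for w
    using redword[OF that] unfolding hbas_def Tw_def
    by (subst Hact_foldr_Ti[OF _ hone_W v]) (auto simp: reduced_def Hact_one v)
  have L: "lin W V (\<lambda>a. Hact T a v)" by (rule slin_Hact_left[OF T_lin v])
  have "Hact T (\<Sum>w\<in>W. vscale (lbar (a w)) (hbas w)) v = (\<Sum>w\<in>W. vscale (lbar (a w)) (Tw Ti w v))"
    by (subst slin_sum[OF L]) (auto simp: hbas_W slinD(3)[OF L] hb intro!: sum.cong)
  then show ?thesis unfolding hact_Hact hbar_eq by (simp add: Hact_def[of Ti])
qed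

text \<open>Since the bar of \<open>H_s\<close> acts by \<open>Ti s\<close>, compatibility with the
  whole algebra comes down to the generators. This links the definition of \<open>modbar\<close> to
  the locale \<open>bar_graph\<close>.\<close>

lemma bar_hact_iff:
  assumes \<beta>: "slin lbar V V \<beta>"
  shows "(\<forall>a\<in>Hset t n. \<forall>v\<in>fspace V. \<beta> (hact t n T a v) = hact t n T (hbar t n a) (\<beta> v)) \<longleftrightarrow>
    (\<forall>s\<in>S. \<forall>v\<in>fspace V. \<beta> (T s v) = Ti s (\<beta> v))"
proof (intro iffI ballI)
  fix s v assume H: "\<forall>a\<in>Hset t n. \<forall>v\<in>fspace V. \<beta> (hact t n T a v) = hact t n T (hbar t n a) (\<beta> v)"
    and s: "s \<in> S" and v: "v \<in> fspace V"
  have \<beta>v: "\<beta> v \<in> fspace V" using slinD(1)[OF \<beta> v] .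
  have "(\<lambda>w. lbar (bv s w)) = bv s" by (auto simp: bv_def ringhomD)
  then have "hact t n T (hbar t n (bv s)) (\<beta> v) = Ti s (\<beta> v)"
    using Hact_hbar[OF \<beta>v, of "bv s"] s by (simp add: Hact_bv S_W Tw_S[OF Ti_braided s \<beta>v])
  moreover have "bv s \<in> Hset t n" using S_W[OF s] by (simp add: Hset_def)
  ultimately show "\<beta> (T s v) = Ti s (\<beta> v)" using H v hact_bv_S[OF s v] by metis
next
  fix a v assume H: "\<forall>s\<in>S. \<forall>v\<in>fspace V. \<beta> (T s v) = Ti s (\<beta> v)" and v: "v \<in> fspace V"
  have \<beta>v: "\<beta> v \<in> fspace V" using slinD(1)[OF \<beta> v] .
  show "\<beta> (hact t n T a v) = hact t n T (hbar t n a) (\<beta> v)"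
    unfolding Hact_hbar[OF \<beta>v] unfolding hact_Hact
    by (rule Hact_intertwine[OF \<beta>]) (use H T_closed v in auto)
qed

end

section \<open>Conjugation modules on fixed-point-free involutions\<close>

text \<open>The rank \<open>N\<close> of the ambient group is kept separate from the rank \<open>n\<close> of the acting one: \<open>N = 2 n\<close>
  gives the modules of the theorem, \<open>N = n\<close> the full conjugacy class of fixed-point-free involutions.\<close>

definition fpf_inv :: "nat \<Rightarrow> perm \<Rightarrow> bool" where
  "fpf_inv N z \<longleftrightarrow> signed_perm N z \<and> (\<forall>i. z (z i) = i) \<and> (\<forall>i\<in>{1..int N}. \<bar>z i\<bar> \<noteq> i)"

definition negp :: "nat \<Rightarrow> perm \<Rightarrow> int set" where
  "negp N z = {i\<in>{1..int N}. z i < - i}"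

definition Gg :: "ctype \<Rightarrow> nat \<Rightarrow> nat \<Rightarrow> perm set" where
  "Gg t n N = {z. fpf_inv N z \<and> (t = TypeA \<longrightarrow> (\<forall>i\<in>{1..int N}. z i > 0)) \<and>
     (t = TypeD \<longrightarrow> even (card (negp N z))) \<and> (\<forall>i. i > int n \<longrightarrow> \<not> visdes z i)}"

lemma fpf_invD:
  assumes "fpf_inv N z"
  shows "bij z" "z (- i) = - z i" "\<bar>i\<bar> > int N \<Longrightarrow> z i = i" "z (z i) = i" "z i = z j \<longleftrightarrow> i = j"
    "z i = 0 \<longleftrightarrow> i = 0" "\<bar>z i\<bar> \<le> int N \<longleftrightarrow> \<bar>i\<bar> \<le> int N" "\<bar>i\<bar> \<le> int N \<Longrightarrow> i \<noteq> 0 \<Longrightarrow> \<bar>z i\<bar> \<noteq> \<bar>i\<bar>"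
    "z i = j \<longleftrightarrow> z j = i"
proof -
  have sp: "signed_perm N z" and inv: "z (z i) = i" and f: "\<forall>i\<in>{1..int N}. \<bar>z i\<bar> \<noteq> i" for i
    using assms by (auto simp: fpf_inv_def)
  show b: "bij z" and o: "z (- i) = - z i" and out: "\<bar>i\<bar> > int N \<Longrightarrow> z i = i" for i
    using sp by (auto simp: signed_perm_def)
  show "z (z i) = i" by (rule inv)
  show inj: "z i = z j \<longleftrightarrow> i = j" for i j using inv by metis
  show "z i = j \<longleftrightarrow> z j = i" using inv by metis
  show "z i = 0 \<longleftrightarrow> i = 0" using o[of 0] inj[of i 0] by simp
  show "\<bar>z i\<bar> \<le> int N \<longleftrightarrow> \<bar>i\<bar> \<le> int N"
    using out[of i] out[of "z i"] inv[of i] by linarith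
  show "\<bar>z i\<bar> \<noteq> \<bar>i\<bar>" if "\<bar>i\<bar> \<le> int N" "i \<noteq> 0"
    using bspec[OF f, of i] bspec[OF f, of "- i"] o[of i] that by (cases "i > 0") auto
qed

text \<open>The map \<open>i \<mapsto> - z i\<close> exchanges the positions with
  \<open>z i < - i\<close> and those with \<open>- i < z i < 0\<close>. In particular such an
  involution always lies in the Weyl group of type D; the parity of \<open>negp\<close> is a finer
  invariant.\<close>

lemma negp_count:
  assumes "fpf_inv N z"
  shows "card {i\<in>{1..int N}. z i < 0} = 2 * card (negp N z)"
proof -
  note z = fpf_invD[OF assms]
  let ?Y = "{i\<in>{1..int N}. - i < z i \<and> z i < 0}"
  have fin: "finite (negp N z)" "finite ?Y" by (auto simp: negp_def intro: finite_subset[of _ "{1..int N}"])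
  have "{i\<in>{1..int N}. z i < 0} = negp N z \<union> ?Y"
    using z(8) by (auto simp: negp_def) (smt (verit) z(8))
  moreover have "negp N z \<inter> ?Y = {}" by (auto simp: negp_def)
  moreover have "card ?Y = card (negp N z)"
  proof (rule bij_betw_same_card[of "\<lambda>i. - z i"], rule bij_betw_byWitness[where f'="\<lambda>i. - z i"])
    have "\<bar>z i\<bar> \<le> int N" if "i \<in> {1..int N}" for i using z(7)[of i] that by auto
    then show "(\<lambda>i. - z i) ` ?Y \<subseteq> negp N z" "(\<lambda>i. - z i) ` negp N z \<subseteq> ?Y"
      by (fastforce simp: negp_def z(2,4))+
  qed (auto simp: z(2,4))
  ultimately show ?thesis using fin by (simp add: card_Un_disjoint)
qed

lemma fpf_inv_conj:
  assumes z: "fpf_inv N z" and N: "N \<ge> 2" and ab: "(a, b) \<in> spair t N"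
  shows "fpf_inv N (swp a b \<circ> z \<circ> swp a b)"
proof -
  let ?s = "swp a b"
  note zz = fpf_invD[OF z]
  have sabs: "\<bar>?s i\<bar> = \<bar>?s j\<bar> \<longleftrightarrow> \<bar>i\<bar> = \<bar>j\<bar>" for i j
    using swp_inj[OF ab, of i j] swp_inj[OF ab, of i "- j"] swp_odd[OF ab, of j] by (auto simp: abs_eq_iff)
  have "\<bar>(?s \<circ> z \<circ> ?s) i\<bar> \<noteq> i" if "i \<in> {1..int N}" for i
  proof -
    have "\<bar>z (?s i)\<bar> \<noteq> \<bar>?s i\<bar>"
      by (rule zz(8)) (use that swp_bound[OF N ab, of i] swp_0[OF ab, of i] in auto)
    then have "\<bar>?s (z (?s i))\<bar> \<noteq> \<bar>?s (?s i)\<bar>" using sabs by blast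
    then show ?thesis using that by (simp add: comp_apply swp_swp[OF ab])
  qed
  moreover have "signed_perm N (?s \<circ> z \<circ> ?s)"
    unfolding signed_perm_def
    by (intro conjI bij_comp swp_bij[OF ab] zz(1)) (auto simp: comp_apply swp_odd[OF ab] zz(2,3) swp_outside[OF N ab])
  ultimately show ?thesis by (auto simp: fpf_inv_def comp_apply swp_swp[OF ab] zz(4))
qed

text \<open>At \<open>i \<ge> 2\<close> the conjugation can only exchange the values 1 and -1,
  neither of which is below \<open>- i\<close>. At 1 the value changes its sign, and its absolute
  value exceeds 1.\<close>

lemma negp_conj_zero:
  assumes z: "fpf_inv N z" and N: "N \<ge> 2"
  shows "even (card (negp N (swp (- 1) 1 \<circ> z \<circ> swp (- 1) 1))) \<longleftrightarrow> odd (card (negp N z))"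
proof -
  define y where "y = swp (- 1) 1 \<circ> z \<circ> swp (- 1) 1"
  note zz = fpf_invD[OF z]
  have z1: "z 1 \<noteq> 0" "\<bar>z 1\<bar> \<noteq> 1" using zz(6)[of 1] zz(8)[of 1] N by auto
  have e1: "y 1 = - z 1" using z1 by (auto simp: y_def comp_apply swp_def zz(2))
  have ei: "y i < - i \<longleftrightarrow> z i < - i" if "i \<ge> 2" for i
    using that by (auto simp: y_def comp_apply swp_def)
  have "i \<in> negp N z - {1} \<longleftrightarrow> i \<in> negp N y - {1}" for i
  proof (cases "i \<ge> 2")
    case True then show ?thesis using ei[of i] by (simp add: negp_def)
  next
    case False then show ?thesis by (cases "i = 1") (simp_all add: negp_def)
  qed
  then have X: "negp N z - {1} = negp N y - {1}" by blast
  have fin: "finite (negp N z)" "finite (negp N y)" by (auto simp: negp_def intro: finite_subset[of _ "{1..int N}"])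
  have m: "1 \<in> negp N z \<longleftrightarrow> 1 \<notin> negp N y" using e1 z1 N by (auto simp: negp_def)
  show ?thesis
  proof (cases "1 \<in> negp N z")
    case True
    then have "card (negp N z) = Suc (card (negp N z - {1}))" by (rule card.remove[OF fin(1)])
    moreover have "negp N y - {1} = negp N y" using m True by simp
    ultimately show ?thesis unfolding y_def[symmetric] X by simp
  next
    case False
    then have "card (negp N y) = Suc (card (negp N y - {1}))" using m by (intro card.remove[OF fin(2)]) simp
    moreover have "negp N z - {1} = negp N z" using False by simp
    ultimately show ?thesis unfolding y_def[symmetric] X[symmetric] by simp
  qed
qed

text \<open>The set \<open>negp\<close> itself may change, but by \<open>negp_count\<close> its size
  is half the number of negative values, which a permutation of the positive numbers
  preserves.\<close>

lemma negp_conj_shift: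
  assumes z: "fpf_inv N z" and i: "1 \<le> i" "i < int N"
  shows "card (negp N (swp i (i + 1) \<circ> z \<circ> swp i (i + 1))) = card (negp N z)"
proof -
  let ?s = "swp i (i + 1)"
  have N: "N \<ge> 2" and ab: "(i, i + 1) \<in> spair TypeA N" using i by (auto simp: spair_def)
  have pos: "?s k > 0 \<longleftrightarrow> k > 0" "?s k < 0 \<longleftrightarrow> k < 0" for k using i by (auto simp: swp_def)
  have bd: "\<bar>?s k\<bar> \<le> int N \<longleftrightarrow> \<bar>k\<bar> \<le> int N" for k using swp_bound[OF N ab] .
  have mem: "?s k \<in> {1..int N} \<longleftrightarrow> k \<in> {1..int N}" for k
    using pos[of k] bd[of k] by (auto simp: abs_if split: if_splits)
  have "card {k\<in>{1..int N}. (?s \<circ> z \<circ> ?s) k < 0} = card {k\<in>{1..int N}. z k < 0}"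
    by (rule bij_betw_same_card[of ?s], rule bij_betw_byWitness[where f'="?s"])
      (use mem in \<open>auto simp: comp_apply pos swp_swp[OF ab]\<close>)
  then show ?thesis using negp_count[OF z] negp_count[OF fpf_inv_conj[OF z N ab]] by simp
qed

text \<open>The reflection for \<open>(-1, 2)\<close> is \<open>s_0 s_1 s_0\<close>, and the two
  conjugations by \<open>s_0\<close> flip the parity twice.\<close>

lemma negp_conj:
  assumes z: "fpf_inv N z" and N: "N \<ge> 2" and ab: "(a, b) \<in> spair TypeD N"
  shows "even (card (negp N (swp a b \<circ> z \<circ> swp a b))) \<longleftrightarrow> even (card (negp N z))"
  using ab
proof (cases rule: spair_cases)
  case shift then show ?thesis using negp_conj_shift[OF z, of a] by simp
next
  case minus
  have 0: "(- 1, 1) \<in> spair TypeBC N" and 1: "(1, 1 + 1) \<in> spair TypeBC N" using N by (auto simp: spair_def)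
  let ?s0 = "swp (- 1) 1" and ?s1 = "swp 1 (1 + 1)"
  have "swp (- 1) 2 = ?s0 \<circ> ?s1 \<circ> ?s0" by (auto simp: fun_eq_iff comp_apply swp_def)
  then have e: "swp a b \<circ> z \<circ> swp a b = ?s0 \<circ> (?s1 \<circ> (?s0 \<circ> z \<circ> ?s0) \<circ> ?s1) \<circ> ?s0"
    by (simp add: minus comp_assoc)
  note z1 = fpf_inv_conj[OF z N 0]
  note z2 = fpf_inv_conj[OF z1 N 1]
  show ?thesis
    unfolding e negp_conj_zero[OF z2 N] using negp_conj_shift[OF z1, of 1] negp_conj_zero[OF z N] N by simp
qed simp

text \<open>\<open>cA\<close> and \<open>cD\<close> are the scalars of the loops in
  \<open>Asc^=\<close> and \<open>Des^=\<close>. The pair \<open>(- xinv, xx)\<close> gives M and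
  \<open>(xx, - xinv)\<close> gives N.\<close>

locale conj_module = weyl t n + N: weyl t N for t n N +
  fixes cA cD :: lpoly
  assumes nN: "n \<le> N" and cA: "cA = xx \<or> cA = - xinv" and cD: "cD = xx \<or> cD = - xinv"
begin

abbreviation "G \<equiv> Gg t n N"
abbreviation "h \<equiv> N.len"

lemma P_N: "(a, b) \<in> P \<Longrightarrow> (a, b) \<in> spair t N"
  using nN by (auto simp: spair_def split: ctype.splits)

lemma S_N: "s \<in> S \<Longrightarrow> s \<in> N.S"
  using P_N by (auto simp: S_swp N.S_swp)

lemma G_fpf: "z \<in> G \<Longrightarrow> fpf_inv N z" by (simp add: Gg_def)

lemmas GD = fpf_invD[OF G_fpf]

lemma G_W: assumes "z \<in> G" shows "z \<in> N.W"
proof -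
  have "even (card {i\<in>{1..int N}. z i < 0})" using negp_count[OF G_fpf[OF assms]] by simp
  then show ?thesis using assms by (auto simp: Gg_def fpf_inv_def Wgrp_def split: ctype.splits)
qed

lemma G_inv: "z \<in> G \<Longrightarrow> inv z = z"
  by (rule inv_unique_comp) (auto simp: fun_eq_iff comp_apply GD)

lemma finite_G: "finite G"
  by (rule finite_subset[OF _ N.finite_W]) (use G_W in blast)

lemma G_rel: "z \<in> G \<Longrightarrow> rel t c d \<Longrightarrow> rel t (z c) (z d)"
  by (rule Wgrp_rel[OF G_W])

lemma S_outside: assumes "s \<in> S" "\<bar>k\<bar> > int n" shows "s k = k"
  using assms S_swp swp_outside[OF n2] by auto

lemma P_G: assumes "(a, b) \<in> P" "z \<in> G" shows "\<bar>z a\<bar> \<noteq> \<bar>a\<bar>" "\<bar>z b\<bar> \<noteq> \<bar>b\<bar>" "z a \<noteq> z b" "\<bar>z a\<bar> = \<bar>b\<bar> \<longleftrightarrow> \<bar>z b\<bar> = \<bar>a\<bar>"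
proof -
  note bd = spair_bound[OF n2 assms(1)]
  show "\<bar>z a\<bar> \<noteq> \<bar>a\<bar>" "\<bar>z b\<bar> \<noteq> \<bar>b\<bar>" using GD(8)[OF assms(2), of a] GD(8)[OF assms(2), of b] bd nN by auto
  show "z a \<noteq> z b" using GD(5)[OF assms(2)] bd by auto
  have "z a = b \<longleftrightarrow> z b = a" "z a = - b \<longleftrightarrow> z b = - a"
    using GD(9)[OF assms(2), of a b] GD(9)[OF assms(2), of a "- b"] GD(2)[OF assms(2), of b] by auto
  then show "\<bar>z a\<bar> = \<bar>b\<bar> \<longleftrightarrow> \<bar>z b\<bar> = \<bar>a\<bar>" by (auto simp: abs_eq_iff)
qed

definition DE :: "perm \<Rightarrow> perm \<Rightarrow> bool" where "DE s z \<longleftrightarrow> s \<circ> z = z \<circ> s"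
definition AE :: "perm \<Rightarrow> perm \<Rightarrow> bool" where "AE s z \<longleftrightarrow> (\<exists>i. i > int n \<and> z \<circ> s \<circ> z = sgen i)"
definition aeq :: "int \<Rightarrow> int \<Rightarrow> bool" where "aeq p q \<longleftrightarrow> q = p + 1 \<and> \<bar>p\<bar> > int n \<and> \<bar>q\<bar> > int n"
definition act :: "perm \<Rightarrow> perm \<Rightarrow> perm" where "act s z = s \<circ> z \<circ> s"
definition Up :: "perm \<Rightarrow> perm \<Rightarrow> bool" where "Up s z \<longleftrightarrow> \<not> DE s z \<and> \<not> AE s z \<and> \<not> N.LD s z"
definition Dn :: "perm \<Rightarrow> perm \<Rightarrow> bool" where "Dn s z \<longleftrightarrow> \<not> DE s z \<and> \<not> AE s z \<and> N.LD s z"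
definition lc :: "perm \<Rightarrow> perm \<Rightarrow> lpoly" where "lc s z = (if AE s z then cA else cD)"

lemma act_apply: "act s z k = s (z (s k))" by (simp add: act_def comp_apply)

lemma G_swp: "z \<in> G \<Longrightarrow> a \<noteq> 0 \<Longrightarrow> b \<noteq> 0 \<Longrightarrow> z \<circ> swp a b \<circ> z = swp (z a) (z b)"
proof -
  assume z: "z \<in> G" "a \<noteq> 0" "b \<noteq> 0"
  have "z \<circ> z = id" by (auto simp: fun_eq_iff comp_apply GD(4)[OF z(1)])
  moreover have "z \<circ> swp a b = swp (z a) (z b) \<circ> z"
    by (rule comp_swp) (use z GD[OF z(1)] in \<open>auto intro: injI\<close>)
  ultimately show ?thesis by (simp add: comp_assoc)
qed

text \<open>If \<open>z\<close> centralises the reflection, it preserves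
  \<open>{a, b, - a, - b}\<close>; the values \<open>a\<close> and \<open>- a\<close> are excluded
  at \<open>a\<close> because \<open>z\<close> has no fixed points up to sign.\<close>

lemma DE_iff:
  assumes ab: "(a, b) \<in> P" and z: "z \<in> G" shows "DE (swp a b) z \<longleftrightarrow> \<bar>z a\<bar> = \<bar>b\<bar>"
proof
  note bd = spair_bound[OF n2 ab]
  assume "DE (swp a b) z"
  then have "swp a b (z a) = z b" by (auto simp: DE_def fun_eq_iff comp_apply dest: spec[of _ a])
  then show "\<bar>z a\<bar> = \<bar>b\<bar>" using P_G[OF ab z] by (auto simp: swp_def split: if_splits)
next
  note bd = spair_bound[OF n2 ab]
  assume "\<bar>z a\<bar> = \<bar>b\<bar>"
  then have "z a = b \<and> z b = a \<or> z a = - b \<and> z b = - a"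
    using GD(9)[OF z, of a b] GD(9)[OF z, of a "- b"] GD(2)[OF z, of b] by (auto simp: abs_eq_iff)
  moreover have "swp b a = swp a b" using bd by (auto simp: swp_def fun_eq_iff)
  ultimately have "swp (z a) (z b) = swp a b" using swp_neg[of a b] bd by auto
  moreover have "z \<circ> swp a b = swp (z a) (z b) \<circ> z"
    by (rule comp_swp) (use z GD[OF z] bd in \<open>auto intro: injI\<close>)
  ultimately show "DE (swp a b) z" by (simp add: DE_def)
qed

text \<open>If \<open>z s z = s_j\<close>, then \<open>(z a, z b)\<close> is
  \<open>(j, j + 1)\<close>, \<open>(- j - 1, - j)\<close> or one of these reversed. The reversed
  orders would make \<open>j\<close> a visible descent, so the increasing ones in \<open>aeq\<close>
  remain.\<close>

lemma AE_iff:
  assumes ab: "(a, b) \<in> P" and z: "z \<in> G" shows "AE (swp a b) z \<longleftrightarrow> aeq (z a) (z b)"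
proof
  note bd = spair_bound[OF n2 ab]
  have conj: "z \<circ> swp a b \<circ> z = swp (z a) (z b)" using G_swp[OF z] bd by auto
  { assume "AE (swp a b) z"
    then obtain j where j: "j > int n" "swp (z a) (z b) = swp j (j + 1)"
      using conj sgen_swp(1) n2 by (auto simp: AE_def)
    then have zb: "z b = swp j (j + 1) (z a)" by (metis swp_ab(1))
    have nv: "\<not> visdes z j" using z j by (auto simp: Gg_def)
    have "z a \<noteq> z b" using P_G[OF ab z] by simp
    then consider "z a = j" "z b = j + 1" | "z a = j + 1" "z b = j" | "z a = - j" "z b = - j - 1"
      | "z a = - j - 1" "z b = - j" using zb by (auto simp: swp_def split: if_splits)
    then show "aeq (z a) (z b)"
    proof cases
      case 2
      then have "z j = b" "z (j + 1) = a" using GD(4)[OF z] by metis+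
      then show ?thesis using nv j bd by (auto simp: visdes_def)
    next
      case 3
      then have "z j = - a" "z (j + 1) = - b" using GD(4)[OF z] GD(2)[OF z] by (metis minus_minus minus_add_distrib uminus_add_conv_diff add_uminus_conv_diff)+
      then show ?thesis using nv j bd by (auto simp: visdes_def)
    qed (use j in \<open>auto simp: aeq_def\<close>) }
  { assume e: "aeq (z a) (z b)"
    show "AE (swp a b) z"
    proof (cases "z a > 0")
      case True
      then show ?thesis using e conj sgen_swp(1)[of "z a"] unfolding AE_def aeq_def by (intro exI[of _ "z a"]) auto
    next
      case False
      then have "sgen (- z b) = swp (z a) (z b)"
        using e n2 sgen_swp(1)[of "- z b"] swp_neg[of "z a" "z b"] by (auto simp: aeq_def)
      then show ?thesis using e conj False n2 unfolding AE_def aeq_def by (intro exI[of _ "- z b"]) auto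
    qed }
qed

lemma LD_iff_G: "(a, b) \<in> P \<Longrightarrow> z \<in> G \<Longrightarrow> N.LD (swp a b) z \<longleftrightarrow> z a > z b"
  using N.LD_iff[OF G_W P_N] G_inv by simp

lemma Up_iff: "(a, b) \<in> P \<Longrightarrow> z \<in> G \<Longrightarrow> Up (swp a b) z \<longleftrightarrow> z a < z b \<and> \<bar>z a\<bar> \<noteq> \<bar>b\<bar> \<and> \<not> aeq (z a) (z b)"
  using P_G(3)[of a b z] by (auto simp: Up_def DE_iff AE_iff LD_iff_G)

lemma Dn_iff: "(a, b) \<in> P \<Longrightarrow> z \<in> G \<Longrightarrow> Dn (swp a b) z \<longleftrightarrow> z a > z b \<and> \<bar>z a\<bar> \<noteq> \<bar>b\<bar>"
  by (auto simp: Dn_def DE_iff AE_iff LD_iff_G aeq_def)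

lemma not_Dn: "\<not> Dn s z \<Longrightarrow> Up s z \<or> DE s z \<or> AE s z"
  by (auto simp: Up_def Dn_def)

lemma swp_order_G:
  assumes ab: "(a, b) \<in> P" and z: "z \<in> G" and cd: "(c, d) \<in> P"
    and ne: "\<not> (z c = a \<and> z d = b)" "\<not> (z c = - b \<and> z d = - a)" "\<not> (z d = a \<and> z c = b)" "\<not> (z d = - b \<and> z c = - a)"
  shows "swp a b (z c) < swp a b (z d) \<longleftrightarrow> z c < z d"
proof -
  have r: "rel t (z c) (z d)" by (rule G_rel[OF z spair_rel[OF cd]])
  then have r': "rel t (z d) (z c)" by (auto simp: rel_def)
  show ?thesis
    using swp_order[OF ab r] swp_order[OF ab r'] ne P_G(3)[OF cd z] by (cases "z c" "z d" rule: linorder_cases) force+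
qed

lemma swp_order_self:
  assumes ab: "(a, b) \<in> P" and z: "z \<in> G" and ne: "\<bar>z a\<bar> \<noteq> \<bar>b\<bar>"
  shows "swp a b (z a) < swp a b (z b) \<longleftrightarrow> z a < z b"
  by (rule swp_order_G[OF ab z ab]) (use ne P_G[OF ab z] in auto)

text \<open>Beyond \<open>n\<close> only the values of \<open>z\<close> can change, since
  \<open>s\<close> fixes these positions, and \<open>s\<close> permutes the values within
  \<open>[-n, n]\<close>. A new visible descent at \<open>i\<close> would need \<open>z i\<close>
  and \<open>z (i + 1)\<close> to be the very pair reversed by \<open>s\<close>; that is the
  excluded case \<open>AE\<close>.\<close>

lemma act_G:
  assumes s: "s \<in> S" and z: "z \<in> G" and ne: "\<not> DE s z" "\<not> AE s z"
  shows "act s z \<in> G"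
proof -
  obtain a b where ab: "(a, b) \<in> P" "s = swp a b" using s S_swp by auto
  note abN = P_N[OF ab(1)]
  note bd = spair_bound[OF n2 ab(1)]
  have f: "fpf_inv N (act s z)" unfolding act_def ab(2) by (rule fpf_inv_conj[OF G_fpf[OF z] N.n2 abN])
  have "act s z i > 0" if tA: "t = TypeA" and i: "i \<in> {1..int N}" for i
  proof -
    have sp: "s k > 0" if "k > 0" for k
      using ab(1) tA that unfolding ab(2) by (cases rule: spair_cases) (auto simp: swp_def)
    have zp: "z k > 0" if "k > 0" for k using WgrpD(5)[OF G_W[OF z] tA that] .
    show ?thesis using i sp zp by (auto simp: act_apply)
  qed
  moreover have "even (card (negp N (act s z)))" if tD: "t = TypeD"
    unfolding act_def ab(2) using negp_conj[OF G_fpf[OF z] N.n2, of a b] abN z tD by (simp add: Gg_def)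
  moreover have "\<not> visdes (act s z) i" if i: "i > int n" for i
  proof -
    have nv: "\<not> visdes z i" using z i by (auto simp: Gg_def)
    have e: "act s z i = s (z i)" "act s z (i + 1) = s (z (i + 1))"
      using S_outside[OF s] i by (auto simp: act_apply)
    have bds: "\<bar>s k\<bar> \<le> int n \<longleftrightarrow> \<bar>k\<bar> \<le> int n" for k unfolding ab(2) by (rule swp_bound[OF n2 ab(1)])
    have out: "s k = k" if "\<bar>k\<bar> > int n" for k using S_outside[OF s that] .
    have A: "\<not> s (z i) < - i" using nv i out[of "z i"] bds[of "z i"] by (cases "\<bar>z i\<bar> > int n") (auto simp: visdes_def)
    have B: "\<not> s (z (i + 1)) < min i (s (z i))"
    proof (cases "\<bar>z i\<bar> \<le> int n")
      case False
      then have "z i > int n" "z (i + 1) > int n"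
      proof -
        \<comment> \<open>Were \<open>z i\<close> below \<open>- n\<close>, then \<open>i\<close> or
          \<open>- z i\<close> would be a visible descent, whichever is smaller in absolute
          value.\<close>
        show *: "z i > int n"
        proof (rule ccontr)
          assume "\<not> z i > int n"
          with False have "- z i > int n" by simp
          moreover have "z i \<noteq> - i" using GD(8)[OF z, of i] GD(3)[OF z, of i] i by (cases "i \<le> int N") auto
          moreover have "z (- z i) = - i" using GD(2,4)[OF z] by simp
          moreover have "\<not> visdes z (- z i)" using z \<open>- z i > int n\<close> by (auto simp: Gg_def)
          ultimately show False using nv i by (auto simp: visdes_def)
        qed
        show "z (i + 1) > int n" using nv * i by (auto simp: visdes_def)
      qed
      then show ?thesis using nv i out by (auto simp: visdes_def)
    next
      case True
      then have lt: "z i < z (i + 1)" using nv i GD(5)[OF z, of i "i + 1"] by (auto simp: visdes_def)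
      show ?thesis
      proof (cases "\<bar>z (i + 1)\<bar> \<le> int n")
        case False
        then have "z (i + 1) > int n" using lt True by auto
        then show ?thesis using True bds[of "z i"] out[of "z (i + 1)"] by auto
      next
        case t2: True
        have i0: "rel t i (i + 1)" using i by (auto simp: rel_def)
        have "\<not> (z i = a \<and> z (i + 1) = b)" "\<not> (z i = - b \<and> z (i + 1) = - a)"
        proof -
          have "\<not> aeq (z a) (z b)" using ne(2) AE_iff[OF ab(1) z] ab(2) by simp
          then show "\<not> (z i = a \<and> z (i + 1) = b)"
            using GD(9)[OF z, of i a] GD(9)[OF z, of "i + 1" b] i by (auto simp: aeq_def)
          show "\<not> (z i = - b \<and> z (i + 1) = - a)"
            using GD(9)[OF z, of i "- b"] GD(9)[OF z, of "i + 1" "- a"] i \<open>\<not> aeq (z a) (z b)\<close> GD(2)[OF z]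
            by (auto simp: aeq_def)
        qed
        then have "s (z i) < s (z (i + 1))"
          unfolding ab(2) using swp_order[OF ab(1) G_rel[OF z i0] lt] by blast
        then show ?thesis by auto
      qed
    qed
    show ?thesis using A B by (auto simp: visdes_def e)
  qed
  ultimately show ?thesis using f by (auto simp: Gg_def)
qed

lemma S_sgen: assumes "s \<in> S" "i > int n" shows "s \<circ> (sgen i \<circ> s) = sgen i"
proof -
  have "s \<circ> swp i (i + 1) = swp i (i + 1) \<circ> s"
    using S_comp_swp[OF assms(1), of i "i + 1"] S_outside[OF assms(1)] assms(2) by simp
  then show ?thesis using S_S[OF assms(1)] sgen_swp(1)[of i] assms(2)
    by (simp add: comp_assoc[symmetric]) (simp add: comp_assoc)
qed

lemma act_act: "s \<in> S \<Longrightarrow> act s (act s z) = z"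
  unfolding act_def by (simp only: comp_assoc S_S S_S_comp comp_id)

lemma DE_act: assumes "s \<in> S" shows "DE s (act s z) \<longleftrightarrow> DE s z"
  unfolding DE_def act_def by (simp only: comp_assoc S_S[OF assms] S_S_comp[OF assms] comp_id) metis

lemma AE_act_imp: assumes rs: "r \<in> S" "r \<circ> s = s \<circ> r" and "AE s z" shows "AE s (act r z)"
proof -
  obtain i where i: "i > int n" "z \<circ> (s \<circ> z) = sgen i" using assms by (auto simp: AE_def comp_assoc)
  have "act r z \<circ> s \<circ> act r z = r \<circ> (z \<circ> ((r \<circ> s) \<circ> (r \<circ> (z \<circ> r))))" by (simp only: act_def comp_assoc)
  also have "\<dots> = r \<circ> (z \<circ> (s \<circ> (z \<circ> r)))" by (simp only: rs(2)) (simp only: comp_assoc S_S_comp[OF rs(1)])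
  also have "\<dots> = r \<circ> ((z \<circ> (s \<circ> z)) \<circ> r)" by (simp only: comp_assoc)
  also have "\<dots> = sgen i" unfolding i(2) by (rule S_sgen[OF rs(1) i(1)])
  finally show ?thesis using i(1) by (auto simp: AE_def)
qed

lemma AE_act_comm: assumes "r \<in> S" "r \<circ> s = s \<circ> r" shows "AE s (act r z) \<longleftrightarrow> AE s z"
  using AE_act_imp[OF assms, of z] AE_act_imp[OF assms, of "act r z"] act_act[OF assms(1)] by auto

lemma DE_act_imp: assumes rs: "r \<in> S" "r \<circ> s = s \<circ> r" and "DE s z" shows "DE s (act r z)"
proof -
  have "s \<circ> act r z = (s \<circ> r) \<circ> (z \<circ> r)" by (simp only: act_def comp_assoc)
  also have "\<dots> = r \<circ> ((s \<circ> z) \<circ> r)" by (simp only: rs(2)[symmetric] comp_assoc)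
  also have "\<dots> = r \<circ> (z \<circ> (s \<circ> r))" using assms(3) by (simp only: DE_def comp_assoc)
  also have "\<dots> = act r z \<circ> s" by (simp only: rs(2)[symmetric] act_def comp_assoc)
  finally show ?thesis by (simp add: DE_def)
qed

lemma DE_act_comm: assumes "r \<in> S" "r \<circ> s = s \<circ> r" shows "DE s (act r z) \<longleftrightarrow> DE s z"
  using DE_act_imp[OF assms, of z] DE_act_imp[OF assms, of "act r z"] act_act[OF assms(1)] by auto

text \<open>The left factor changes the length by one. The right factor does so in the same
  direction, because \<open>s\<close> keeps the order of \<open>z a\<close> and \<open>z b\<close>
  once \<open>\<bar>z a\<bar> = \<bar>b\<bar>\<close> is excluded.\<close>

lemma LD_act:
  assumes s: "s \<in> S" and z: "z \<in> G" and ne: "\<not> DE s z" "\<not> AE s z"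
  shows "N.LD s (act s z) \<longleftrightarrow> \<not> N.LD s z" "\<not> N.LD s z \<Longrightarrow> h (act s z) = h z + 2"
proof -
  obtain a b where ab: "(a, b) \<in> P" "s = swp a b" using s S_swp by auto
  note z' = act_G[OF assms]
  have nb: "\<bar>z a\<bar> \<noteq> \<bar>b\<bar>" using ne DE_iff[OF ab(1) z] ab(2) by simp
  note o = swp_order_self[OF ab(1) z nb]
  have v: "act s z a = s (z b)" "act s z b = s (z a)" by (auto simp: act_apply ab(2))
  show "N.LD s (act s z) \<longleftrightarrow> \<not> N.LD s z"
    using LD_iff_G[OF ab(1) z'] LD_iff_G[OF ab(1) z] o v P_G(3)[OF ab(1) z] ab(2) by auto
  assume nl: "\<not> N.LD s z"
  then have lt: "(s \<circ> z) a < (s \<circ> z) b"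
    using o LD_iff_G[OF ab(1) z] P_G(3)[OF ab(1) z] ab(2) by (auto simp: comp_apply)
  have "N.len (s \<circ> z) = N.len z + 1" by (rule N.len_S(2)[OF G_W[OF z] S_N[OF s] nl])
  moreover have "N.len (s \<circ> z \<circ> swp a b) = N.len (s \<circ> z) + 1"
    by (rule N.len_right(1)[OF N.SW[OF S_N[OF s] G_W[OF z]] P_N[OF ab(1)] lt])
  ultimately show "h (act s z) = h z + 2" by (simp add: act_def ab(2))
qed

sublocale hgraph G S act Up Dn lc h
proof
  show "finite G" by (rule finite_G)
  fix s z assume s: "s \<in> S" and z: "z \<in> G"
  note A = AE_act_comm[OF s refl, of z] DE_act[OF s, of z] act_act[OF s, of z]
  { assume "Up s z"
    then show "act s z \<in> G \<and> \<not> Dn s z \<and> Dn s (act s z) \<and> act s (act s z) = z \<and> h (act s z) = h z + 2"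
      using act_G[OF s z] LD_act[OF s z] A by (auto simp: Up_def Dn_def) }
  { assume "Dn s z"
    then show "act s z \<in> G \<and> Up s (act s z) \<and> act s (act s z) = z"
      using act_G[OF s z] LD_act[OF s z] A by (auto simp: Up_def Dn_def) }
  show "lc s z = xx \<or> lc s z = - xinv" using cA cD by (auto simp: lc_def)
qed

section \<open>Braid relations at basis vectors without strict descents\<close>

lemma act_act_comm: assumes "r \<circ> s = s \<circ> r" shows "act r (act s z) = act s (act r z)"
proof -
  have "act r (act s z) = (r \<circ> s) \<circ> (z \<circ> (s \<circ> r))" by (simp only: act_def comp_assoc)
  also have "\<dots> = (s \<circ> r) \<circ> (z \<circ> (r \<circ> s))" by (simp only: assms)
  finally show ?thesis by (simp only: act_def comp_assoc)
qed

lemma loop_iff: "\<not> Up s z \<and> \<not> Dn s z \<longleftrightarrow> DE s z \<or> AE s z"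
  by (auto simp: Up_def Dn_def)

text \<open>In general each generator keeps its status after the other has acted. The exception is
  that \<open>z\<close> conjugates \<open>s\<close> into \<open>r\<close>: then
  \<open>act r z = act s z\<close>, the second generator goes back down, and both orders give the
  same sum.\<close>

lemma braid2_min:
  assumes c: "cf2 r s" and z: "z \<in> G" and m: "\<not> Dn r z" "\<not> Dn s z"
  shows "T r (T s (bv z)) = T s (T r (bv z))"
proof -
  note S = cf_S(1)[OF c] and comm = cf2_comm[OF c]
  have comm': "s \<circ> r = r \<circ> s" using comm by simp
  consider "Up r z" "Up s z" | "Up r z" "DE s z \<or> AE s z" | "DE r z \<or> AE r z" "Up s z"
    | "DE r z \<or> AE r z" "DE s z \<or> AE s z" using m not_Dn by blast
  then show ?thesis
  proof cases
    case 1
    obtain a b c d where P: "(a, b) \<in> P" "(c, d) \<in> P" and rs: "r = swp a b" "s = swp c d" and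
       e: "r c = c \<and> r d = d \<and> s a = a \<and> s b = b \<or> r c = - d \<and> r d = - c \<and> s a = - b \<and> s b = - a"
      using c unfolding cf2_def by blast
    note ur = up[OF _ z 1(1)] and us = up[OF _ z 1(2)]
    have lt: "z c < z d" "z a < z b" using 1 Up_iff P z rs by auto
    show ?thesis
    proof (cases "z c = a \<and> z d = b \<or> z c = - b \<and> z d = - a")
      case True
      have "swp (z c) (z d) = swp a b"
        using True swp_neg[of a b] spair_bound[OF n2 P(1)] by auto
      moreover have "z \<circ> swp c d = swp (z c) (z d) \<circ> z"
        by (rule comp_swp) (use z GD[OF z] spair_bound[OF n2 P(2)] in \<open>auto intro: injI\<close>)
      ultimately have zs: "z \<circ> s = r \<circ> z" by (simp add: rs)
      have zz: "z \<circ> z = id" by (auto simp: fun_eq_iff comp_apply GD(4)[OF z])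
      have "z \<circ> (z \<circ> (s \<circ> z)) = z \<circ> (r \<circ> (z \<circ> z))" using zs by (simp only: comp_assoc[symmetric])
      then have zr: "s \<circ> z = z \<circ> r" by (simp only: comp_assoc[symmetric] zz id_comp) (simp only: comp_assoc zz comp_id)
      have "act s z = s \<circ> (r \<circ> z)" unfolding act_def comp_assoc zs ..
      also have "\<dots> = r \<circ> (s \<circ> z)" by (simp only: comp_assoc[symmetric] comm)
      also have "\<dots> = act r z" unfolding act_def comp_assoc zr ..
      finally have "act s z = act r z" .
      then show ?thesis using ur us S 1 z T_dn[of r "act r z"] T_dn[of s "act s z"] by (simp add: T_up)
    next
      case False
      have zdc: "z c \<noteq> b \<or> z d \<noteq> a" "z d \<noteq> - b \<or> z c \<noteq> - a"
        using lt spair_bound[OF n2 P(1)] by auto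
      have o1: "r (z c) < r (z d)"
        unfolding rs(1) using swp_order_G[OF P(1) z P(2)] False lt zdc by auto
      have F2: "\<not> (z a = c \<and> z b = d)" "\<not> (z a = - d \<and> z b = - c)"
        using False GD(9)[OF z, of a c] GD(9)[OF z, of b d] GD(9)[OF z, of a "- d"] GD(9)[OF z, of b "- c"] GD(2)[OF z]
        by auto
      moreover have "z a \<noteq> d \<or> z b \<noteq> c" "z b \<noteq> - d \<or> z a \<noteq> - c" using lt spair_bound[OF n2 P(2)] by auto
      ultimately have o2: "s (z a) < s (z b)"
        unfolding rs(2) using swp_order_G[OF P(2) z P(1)] lt by auto
      have ro: "r (- k) = - r k" "s (- k) = - s k" for k using swp_odd[OF P(1)] swp_odd[OF P(2)] rs by auto
      have "act r z c < act r z d" "act s z a < act s z b"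
        using e o1 o2 by (auto simp: act_apply GD(2)[OF z] ro)
      then have "\<not> N.LD s (act r z)" "\<not> N.LD r (act s z)"
        using LD_iff_G[OF P(2), of "act r z"] LD_iff_G[OF P(1), of "act s z"] ur us S rs by auto
      then have "Up s (act r z)" "Up r (act s z)"
        using 1 DE_act_comm[OF conjunct1[OF S] comm] AE_act_comm[OF conjunct1[OF S] comm]
          DE_act_comm[OF conjunct2[OF S] comm'] AE_act_comm[OF conjunct2[OF S] comm'] by (auto simp: Up_def)
      then show ?thesis using ur us S 1 z act_act_comm[OF comm] by (simp add: T_up)
    qed
  next
    case 2
    then have u: "act r z \<in> G" using up[OF _ z] S by blast
    have l: "\<not> Up s z" "\<not> Dn s z" using 2 loop_iff by auto
    have l': "\<not> Up s (act r z)" "\<not> Dn s (act r z)" "lc s (act r z) = lc s z"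
      using 2 loop_iff DE_act_comm[OF conjunct1[OF S] comm] AE_act_comm[OF conjunct1[OF S] comm] by (auto simp: lc_def)
    show ?thesis using 2 l l' u z S by (simp add: T_up T_loop T_vscale)
  next
    case 3
    then have u: "act s z \<in> G" using up[OF _ z] S by blast
    have l: "\<not> Up r z" "\<not> Dn r z" using 3 loop_iff by auto
    have l': "\<not> Up r (act s z)" "\<not> Dn r (act s z)" "lc r (act s z) = lc r z"
      using 3 loop_iff DE_act_comm[OF conjunct2[OF S] comm'] AE_act_comm[OF conjunct2[OF S] comm'] by (auto simp: lc_def)
    show ?thesis using 3 l l' u z S by (simp add: T_up T_loop T_vscale)
  next
    case 4
    then have "\<not> Up r z" "\<not> Dn r z" "\<not> Up s z" "\<not> Dn s z" using loop_iff by auto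
    then show ?thesis using z S by (simp add: T_loop T_vscale vscale_simps mult.commute)
  qed
qed

lemma T_AE: assumes "z \<in> G" "AE s z" shows "T s (bv z) = vscale cA (bv z)"
  using assms loop_iff[of s z] by (simp add: T_loop lc_def)

lemma T_DE: assumes "z \<in> G" "DE s z" "\<not> AE s z" shows "T s (bv z) = vscale cD (bv z)"
  using assms loop_iff[of s z] by (simp add: T_loop lc_def)

text \<open>Two strict ascents give a hexagon of ascents. If only one generator is a strict ascent,
  the other loops at \<open>z\<close>, and after the two moves the first generator loops in the same
  way, because the product of the two conjugates one into the other. Of two loops both must be
  \<open>AE\<close>: a \<open>DE\<close> loop puts the value at the common position \<open>b\<close>
  among \<open>a\<close>, \<open>c\<close> up to sign and so excludes any loop of the other
  generator.\<close>

lemma braid3_min: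
  assumes c: "cf3 r s" and z: "z \<in> G" and m: "\<not> Dn r z" "\<not> Dn s z"
  shows "T r (T s (T r (bv z))) = T s (T r (T s (bv z)))"
proof -
  obtain a b c where P: "(a, b) \<in> P" "(b, c) \<in> P" and ab: "a \<noteq> - b" and rs: "r = swp a b" "s = swp b c"
    using c unfolding cf3_def by blast
  have S: "r \<in> S" "s \<in> S" using cf_S c by auto
  have conf: "(b = a + 1 \<and> c = a + 2 \<and> 1 \<le> a) \<or> (a = - 1 \<and> b = 2 \<and> c = 3)"
    using P ab by (auto elim!: spair_cases)
  have le: "\<bar>a\<bar> \<le> int n" "\<bar>b\<bar> \<le> int n" "\<bar>c\<bar> \<le> int n"
    using spair_bound[OF n2 P(1)] spair_bound[OF n2 P(2)] by auto
  have v: "r a = b" "r b = a" "r c = c" "s a = a" "s b = c" "s c = b"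
    "r (- a) = - b" "r (- b) = - a" "r (- c) = - c" "s (- a) = - a" "s (- b) = - c" "s (- c) = - b"
    using conf by (auto simp: rs swp_def)
  define out where "out k \<longleftrightarrow> \<bar>k\<bar> \<noteq> \<bar>a\<bar> \<and> \<bar>k\<bar> \<noteq> \<bar>b\<bar> \<and> \<bar>k\<bar> \<noteq> \<bar>c\<bar> \<and> k \<noteq> 0" for k
  have outv: "r k = k" "s k = k" if "out k" for k using that by (auto simp: out_def rs swp_def)
  have big: "out k" if "\<bar>k\<bar> > int n" for k using that le by (auto simp: out_def)
  have ra: "act r y a = r (y b)" "act r y b = r (y a)" "act r y c = r (y c)"
    and sa: "act s y a = s (y a)" "act s y b = s (y c)" "act s y c = s (y b)" for y
    by (auto simp: act_apply v)
  have UpR: "Up r y \<longleftrightarrow> y a < y b \<and> \<bar>y a\<bar> \<noteq> \<bar>b\<bar> \<and> \<not> aeq (y a) (y b)"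
    and UpS: "Up s y \<longleftrightarrow> y b < y c \<and> \<bar>y b\<bar> \<noteq> \<bar>c\<bar> \<and> \<not> aeq (y b) (y c)"
    and DER: "DE r y \<longleftrightarrow> \<bar>y a\<bar> = \<bar>b\<bar>" and DES: "DE s y \<longleftrightarrow> \<bar>y b\<bar> = \<bar>c\<bar>"
    and AER: "AE r y \<longleftrightarrow> aeq (y a) (y b)" and AES: "AE s y \<longleftrightarrow> aeq (y b) (y c)" if "y \<in> G" for y
    unfolding rs using Up_iff[OF P(1) that] Up_iff[OF P(2) that] DE_iff[OF P(1) that] DE_iff[OF P(2) that]
      AE_iff[OF P(1) that] AE_iff[OF P(2) that] by auto
  have upR: "T r (bv y) = bv (act r y) \<and> act r y \<in> G" if "y \<in> G" "Up r y" for y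
    using T_up[OF that] up[OF S(1) that] by blast
  have upS: "T s (bv y) = bv (act s y) \<and> act s y \<in> G" if "y \<in> G" "Up s y" for y
    using T_up[OF that] up[OF S(2) that] by blast
  define p q u where pqu: "p = z a" "q = z b" "u = z c"
  note za = pqu[symmetric]
  have abs: "\<bar>p\<bar> \<noteq> \<bar>a\<bar>" "\<bar>q\<bar> \<noteq> \<bar>b\<bar>" "\<bar>u\<bar> \<noteq> \<bar>c\<bar>" "\<bar>p\<bar> = \<bar>b\<bar> \<longleftrightarrow> \<bar>q\<bar> = \<bar>a\<bar>" "\<bar>q\<bar> = \<bar>c\<bar> \<longleftrightarrow> \<bar>u\<bar> = \<bar>b\<bar>"
    using P_G[OF P(1) z] P_G[OF P(2) z] by (auto simp: pqu)
  have nz: "p \<noteq> 0" "q \<noteq> 0" "u \<noteq> 0" using GD(6)[OF z] conf by (auto simp: pqu)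
  have pcua: "p = c \<longleftrightarrow> u = a" "p = - c \<longleftrightarrow> u = - a"
    using GD(9)[OF z, of a c] GD(9)[OF z, of a "- c"] GD(2)[OF z, of c] by (auto simp: pqu)
  have ds: "a \<noteq> b" "a \<noteq> - b" "b \<noteq> c" "b \<noteq> - c" using conf by auto
  have pq_abs: "\<bar>p\<bar> \<noteq> \<bar>q\<bar>" "\<bar>q\<bar> \<noteq> \<bar>u\<bar>"
    unfolding pqu abs_eq_iff
    using ds GD(5)[OF z, of a b] GD(5)[OF z, of a "- b"] GD(5)[OF z, of b c] GD(5)[OF z, of b "- c"]
    by (simp_all add: GD(2)[OF z])
  consider "Up r z" "Up s z" | "Up r z" "AE s z" | "Up r z" "DE s z" "\<not> AE s z"
    | "AE r z" "Up s z" | "DE r z" "\<not> AE r z" "Up s z" | "AE r z" "AE s z"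
    | "DE r z" "DE s z \<or> AE s z" | "AE r z" "DE s z" using m not_Dn by blast
  then show ?thesis
  proof cases
    case 1
    then have lt: "p < q" "q < u" "\<bar>p\<bar> \<noteq> \<bar>b\<bar>" "\<bar>q\<bar> \<noteq> \<bar>c\<bar>" "\<not> aeq p q" "\<not> aeq q u"
      using UpR[OF z] UpS[OF z] by (auto simp: pqu)
    have "\<bar>p\<bar> \<noteq> \<bar>c\<bar>" "\<bar>u\<bar> \<noteq> \<bar>a\<bar>"
      using lt abs nz pcua conf by (smt (verit))+
    then have o: "out p" "out q" "out u" using lt abs nz by (auto simp: out_def)
    have npu: "\<not> aeq p u" "p < u" using lt by (auto simp: aeq_def)
    have ob: "\<bar>k\<bar> \<noteq> \<bar>b\<bar>" "\<bar>k\<bar> \<noteq> \<bar>c\<bar>" if "out k" for k using that by (auto simp: out_def)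
    note e = ra sa za outv[OF o(1)] outv[OF o(2)] outv[OF o(3)] ob[OF o(1)] ob[OF o(2)] ob[OF o(3)] lt npu
    have R1: "act r z \<in> G" and r1: "T r (bv z) = bv (act r z)" using upR[OF z 1(1)] by auto
    have R2: "act s (act r z) \<in> G" and r2: "T s (bv (act r z)) = bv (act s (act r z))"
      using upS[OF R1] UpS[OF R1] by (auto simp: e)
    have r3: "T r (bv (act s (act r z))) = bv (act r (act s (act r z)))"
      using upR[OF R2] UpR[OF R2] by (auto simp: e)
    have S1: "act s z \<in> G" and s1: "T s (bv z) = bv (act s z)" using upS[OF z 1(2)] by auto
    have S2: "act r (act s z) \<in> G" and s2: "T r (bv (act s z)) = bv (act r (act s z))"
      using upR[OF S1] UpR[OF S1] lt by (auto simp: e)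
    have s3: "T s (bv (act r (act s z))) = bv (act s (act r (act s z)))"
      using upS[OF S2] UpS[OF S2] by (auto simp: e)
    have "act r (act s (act r z)) = (r \<circ> (s \<circ> r)) \<circ> (z \<circ> (r \<circ> (s \<circ> r)))" by (simp only: act_def comp_assoc)
    also have "\<dots> = act s (act r (act s z))" unfolding cf3_braid[OF c] by (simp only: act_def comp_assoc)
    finally show ?thesis by (simp add: r1 r2 r3 s1 s2 s3)
  next
    case 2
    then have lt: "p < q" "\<bar>p\<bar> \<noteq> \<bar>b\<bar>" "\<not> aeq p q" "aeq q u" using UpR[OF z] AES[OF z] by (auto simp: pqu)
    then have bg: "u = q + 1" "\<bar>q\<bar> > int n" "\<bar>u\<bar> > int n" by (auto simp: aeq_def)
    have "\<bar>p\<bar> \<noteq> \<bar>c\<bar>" using pcua bg le by (auto simp: abs_eq_iff)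
    then have o: "out p" "out q" "out u" using lt abs nz bg big by (auto simp: out_def)
    have npu: "\<not> aeq p u" "p < u" using lt bg by (auto simp: aeq_def)
    have pc: "\<bar>p\<bar> \<noteq> \<bar>c\<bar>" using o by (auto simp: out_def)
    note e = ra sa za outv[OF o(1)] outv[OF o(2)] outv[OF o(3)] lt npu pc
    have R1: "act r z \<in> G" and r1: "T r (bv z) = bv (act r z)" using upR[OF z 2(1)] by auto
    have R2: "act s (act r z) \<in> G" and r2: "T s (bv (act r z)) = bv (act s (act r z))"
      using upS[OF R1] UpS[OF R1] by (auto simp: e)
    have "AE r (act s (act r z))" using AER[OF R2] by (simp add: e)
    then have r3: "T r (bv (act s (act r z))) = vscale cA (bv (act s (act r z)))" by (rule T_AE[OF R2])
    show ?thesis using S z R1 R2 by (simp add: r1 r2 r3 T_AE[OF z 2(2)] T_vscale)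
  next
    case 3
    then have lt: "p < q" "\<bar>p\<bar> \<noteq> \<bar>b\<bar>" "\<bar>q\<bar> = \<bar>c\<bar>" using UpR[OF z] DES[OF z] by (auto simp: pqu)
    have qu: "q = c \<and> u = b \<or> q = - c \<and> u = - b"
      using lt(3) GD(9)[OF z, of b c] GD(9)[OF z, of b "- c"] GD(2)[OF z, of c] by (auto simp: pqu abs_eq_iff)
    have "\<bar>p\<bar> \<noteq> \<bar>c\<bar>" using pq_abs lt by auto
    then have o: "out p" using lt abs nz by (auto simp: out_def)
    have pc: "\<bar>p\<bar> \<noteq> \<bar>c\<bar>" using o by (auto simp: out_def)
    have pa: "q = c \<Longrightarrow> p < a" "q = - c \<Longrightarrow> p < - a"
    proof -
      have ne: "p \<noteq> a" "p \<noteq> - a" "p \<noteq> b" "p \<noteq> 0" using o by (auto simp: out_def)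
      show "q = c \<Longrightarrow> p < a" using conf lt(1) ne by (elim disjE) auto
      show "q = - c \<Longrightarrow> p < - a" using conf lt(1) by (elim disjE) auto
    qed
    have na: "\<not> aeq p a" "\<not> aeq p (- a)" "\<not> aeq b a" "\<not> aeq (- b) (- a)" using le by (auto simp: aeq_def)
    note e = ra sa za outv[OF o] v
    have R1: "act r z \<in> G" and r1: "T r (bv z) = bv (act r z)" using upR[OF z 3(1)] by auto
    have R2: "act s (act r z) \<in> G" and r2: "T s (bv (act r z)) = bv (act s (act r z))"
      using upS[OF R1] UpS[OF R1] qu pa na pc by (auto simp: e)
    have "DE r (act s (act r z))" "\<not> AE r (act s (act r z))"
      using DER[OF R2] AER[OF R2] qu na by (auto simp: e)
    then have r3: "T r (bv (act s (act r z))) = vscale cD (bv (act s (act r z)))" by (rule T_DE[OF R2])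
    show ?thesis using S z R1 R2 by (simp add: r1 r2 r3 T_DE[OF z 3(2,3)] T_vscale)
  next
    case 4
    then have lt: "q < u" "\<bar>q\<bar> \<noteq> \<bar>c\<bar>" "\<not> aeq q u" "aeq p q" using UpS[OF z] AER[OF z] by (auto simp: pqu)
    then have bg: "q = p + 1" "\<bar>q\<bar> > int n" "\<bar>p\<bar> > int n" by (auto simp: aeq_def)
    have "\<bar>u\<bar> \<noteq> \<bar>a\<bar>" using pcua bg le by (auto simp: abs_eq_iff)
    then have o: "out p" "out q" "out u" using lt abs nz bg big by (auto simp: out_def)
    have npu: "\<not> aeq p u" "p < u" using lt bg by (auto simp: aeq_def)
    have pb: "\<bar>p\<bar> \<noteq> \<bar>b\<bar>" using o by (auto simp: out_def)
    note e = ra sa za outv[OF o(1)] outv[OF o(2)] outv[OF o(3)] lt npu pb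
    have S1: "act s z \<in> G" and s1: "T s (bv z) = bv (act s z)" using upS[OF z 4(2)] by auto
    have S2: "act r (act s z) \<in> G" and s2: "T r (bv (act s z)) = bv (act r (act s z))"
      using upR[OF S1] UpR[OF S1] bg lt by (auto simp: e)
    have "AE s (act r (act s z))" using AES[OF S2] by (simp add: e)
    then have s3: "T s (bv (act r (act s z))) = vscale cA (bv (act r (act s z)))" by (rule T_AE[OF S2])
    show ?thesis using S z S1 S2 by (simp add: s1 s2 s3 T_AE[OF z 4(1)] T_vscale)
  next
    case 5
    then have lt: "q < u" "\<bar>q\<bar> \<noteq> \<bar>c\<bar>" "\<bar>p\<bar> = \<bar>b\<bar>" using UpS[OF z] DER[OF z] by (auto simp: pqu)
    have pq: "p = b \<and> q = a \<or> p = - b \<and> q = - a"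
      using lt(3) GD(9)[OF z, of a b] GD(9)[OF z, of a "- b"] GD(2)[OF z, of b] by (auto simp: pqu abs_eq_iff)
    have "\<bar>u\<bar> \<noteq> \<bar>a\<bar>" using pq_abs pq by auto
    then have o: "out u" using lt abs nz by (auto simp: out_def)
    have ca: "q = a \<Longrightarrow> c < u" "q = - a \<Longrightarrow> - c < u"
    proof -
      have ne: "u \<noteq> c" "u \<noteq> - a" "u \<noteq> b" "u \<noteq> 0" using o by (auto simp: out_def)
      show "q = a \<Longrightarrow> c < u" using conf lt(1) ne by (elim disjE) auto
      show "q = - a \<Longrightarrow> - c < u" using conf lt(1) by (elim disjE) auto
    qed
    have na: "\<not> aeq c u" "\<not> aeq (- c) u" "\<not> aeq c b" "\<not> aeq (- c) (- b)" using le by (auto simp: aeq_def)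
    have cb: "\<bar>c\<bar> \<noteq> \<bar>b\<bar>" using conf by auto
    note e = ra sa za outv[OF o] v
    have S1: "act s z \<in> G" and s1: "T s (bv z) = bv (act s z)" using upS[OF z 5(3)] by auto
    have S2: "act r (act s z) \<in> G" and s2: "T r (bv (act s z)) = bv (act r (act s z))"
      using upR[OF S1] UpR[OF S1] pq ca na cb by (auto simp: e)
    have "DE s (act r (act s z))" "\<not> AE s (act r (act s z))"
      using DES[OF S2] AES[OF S2] pq na by (auto simp: e)
    then have s3: "T s (bv (act r (act s z))) = vscale cD (bv (act r (act s z)))" by (rule T_DE[OF S2])
    show ?thesis using S z S1 S2 by (simp add: s1 s2 s3 T_DE[OF z 5(1,2)] T_vscale)
  next
    case 6
    then show ?thesis using S z by (simp add: T_AE T_vscale)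
  next
    case 7
    then have "\<bar>q\<bar> = \<bar>a\<bar>" using DER[OF z] abs by (auto simp: pqu)
    moreover have "\<bar>a\<bar> \<noteq> \<bar>c\<bar>" using conf by auto
    ultimately show ?thesis using 7 DES[OF z] AES[OF z] le by (auto simp: aeq_def pqu)
  next
    case 8
    then show ?thesis using DES[OF z] AER[OF z] le by (auto simp: aeq_def)
  qed
qed

text \<open>\<open>s_0\<close> never loops: \<open>\<bar>y 1\<bar> = 1\<close> is impossible, and
  \<open>- y 1\<close> and \<open>y 1\<close> do not differ by 1. If \<open>s\<close> commutes with
  \<open>z\<close>, then \<open>z\<close> exchanges 1 and 2, and \<open>s\<close> acts by
  \<open>cD\<close> at \<open>z\<close> as well as at \<open>act r z\<close>.\<close>

lemma braid4_min:
  assumes c: "cf4 r s" and z: "z \<in> G" and m: "\<not> Dn r z" "\<not> Dn s z"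
  shows "T r (T s (T r (T s (bv z)))) = T s (T r (T s (T r (bv z))))"
proof -
  have rs: "r = swp (- 1) 1" "s = swp 1 2" and P: "(- 1, 1) \<in> P" "(1, 2) \<in> P"
    using c n2 unfolding cf4_def by (auto simp: spair_def)
  have S: "r \<in> S" "s \<in> S" using cf_S c by auto
  have le: "2 \<le> int n" using n2 by simp
  have v: "r 1 = - 1" "r (- 1) = 1" "r 2 = 2" "r (- 2) = - 2" "s 1 = 2" "s 2 = 1" "s (- 1) = - 2" "s (- 2) = - 1"
    by (auto simp: rs swp_def)
  have outv: "r k = k" "s k = k" "r (- k) = - k" "s (- k) = - k" if "\<bar>k\<bar> \<noteq> 1" "\<bar>k\<bar> \<noteq> 2" for k
    using that by (auto simp: rs swp_def)
  have ra: "act r y 1 = r (- y 1)" "act r y 2 = r (y 2)"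
    and sa: "act s y 1 = s (y 2)" "act s y 2 = s (y 1)" if "y \<in> G" for y
    using GD(2)[OF that, of 1] by (auto simp: act_apply v)
  have UpR: "Up r y \<longleftrightarrow> y 1 > 0"
    and UpS: "Up s y \<longleftrightarrow> y 1 < y 2 \<and> \<bar>y 1\<bar> \<noteq> 2 \<and> \<not> aeq (y 1) (y 2)"
    and DES: "DE s y \<longleftrightarrow> \<bar>y 1\<bar> = 2" and AES: "AE s y \<longleftrightarrow> aeq (y 1) (y 2)" if "y \<in> G" for y
  proof -
    have "\<bar>y 1\<bar> \<noteq> 1" using P_G(2)[OF P(1) that] by simp
    moreover have "\<not> aeq (- y 1) (y 1)" unfolding aeq_def by presburger
    ultimately show "Up r y \<longleftrightarrow> y 1 > 0" using Up_iff[OF P(1) that] GD(2)[OF that, of 1] rs by auto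
  qed (use Up_iff[OF P(2)] DE_iff[OF P(2)] AE_iff[OF P(2)] rs that in auto)
  have upR: "T r (bv y) = bv (act r y) \<and> act r y \<in> G" if "y \<in> G" "Up r y" for y
    using T_up[OF that] up[OF S(1) that] by blast
  have upS: "T s (bv y) = bv (act s y) \<and> act s y \<in> G" if "y \<in> G" "Up s y" for y
    using T_up[OF that] up[OF S(2) that] by blast
  define p q where pq: "p = z 1" "q = z 2"
  note za = pq[symmetric]
  have abs: "\<bar>p\<bar> \<noteq> 1" "\<bar>q\<bar> \<noteq> 2" "\<bar>p\<bar> = 2 \<longleftrightarrow> \<bar>q\<bar> = 1" "p \<noteq> 0"
    using P_G[OF P(2) z] GD(6)[OF z, of 1] by (auto simp: pq)
  have "\<not> aeq (- p) p" unfolding aeq_def by presburger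
  then have p0: "p > 0" using m(1) Dn_iff[OF P(1) z] abs GD(2)[OF z, of 1] by (auto simp: rs pq)
  then have ur: "Up r z" using UpR[OF z] by (simp add: pq)
  have R1: "act r z \<in> G" and r1: "T r (bv z) = bv (act r z)" using upR[OF z ur] by auto
  consider "Up s z" | "AE s z" | "DE s z" "\<not> AE s z" using m not_Dn by blast
  then show ?thesis
  proof cases
    case 1
    then have lt: "p < q" "\<bar>p\<bar> \<noteq> 2" "\<not> aeq p q" using UpS[OF z] by (auto simp: pq)
    have o: "\<bar>q\<bar> \<noteq> 1" using lt abs by simp
    note ov = outv[OF abs(1) lt(2)] outv[OF o abs(2)]
    have na: "\<not> aeq (- q) p" "\<not> aeq (- p) q" "\<not> aeq (- q) (- p)" using lt p0 by (auto simp: aeq_def)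
    have p2: "p \<noteq> 2" "q \<noteq> 2" "q \<noteq> 1" "p \<noteq> 1" using lt abs p0 o by auto
    note e = ra sa za ov lt abs o p0 na p2
    have R2: "act s (act r z) \<in> G" and r2: "T s (bv (act r z)) = bv (act s (act r z))"
      using upS[OF R1] UpS[OF R1] z p0 lt by (auto simp: e)
    have R3: "act r (act s (act r z)) \<in> G" and r3: "T r (bv (act s (act r z))) = bv (act r (act s (act r z)))"
      using upR[OF R2] UpR[OF R2] z R1 p0 lt by (auto simp: e)
    have r4: "T s (bv (act r (act s (act r z)))) = bv (act s (act r (act s (act r z))))"
      using upS[OF R3] UpS[OF R3] z R1 R2 p0 lt by (auto simp: e)
    have S1: "act s z \<in> G" and s1: "T s (bv z) = bv (act s z)" using upS[OF z 1] by auto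
    have S2: "act r (act s z) \<in> G" and s2: "T r (bv (act s z)) = bv (act r (act s z))"
      using upR[OF S1] UpR[OF S1] z p0 lt by (auto simp: e)
    have S3: "act s (act r (act s z)) \<in> G" and s3: "T s (bv (act r (act s z))) = bv (act s (act r (act s z)))"
      using upS[OF S2] UpS[OF S2] z S1 p0 lt by (auto simp: e)
    have s4: "T r (bv (act s (act r (act s z)))) = bv (act r (act s (act r (act s z))))"
      using upR[OF S3] UpR[OF S3] z S1 S2 p0 lt by (auto simp: e)
    have "act r (act s (act r (act s z))) = (r \<circ> (s \<circ> (r \<circ> s))) \<circ> (z \<circ> (s \<circ> (r \<circ> (s \<circ> r))))"
      by (simp only: act_def comp_assoc)
    also have "\<dots> = (s \<circ> (r \<circ> (s \<circ> r))) \<circ> (z \<circ> (r \<circ> (s \<circ> (r \<circ> s))))" by (simp only: cf4_braid[OF c])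
    also have "\<dots> = act s (act r (act s (act r z)))" by (simp only: act_def comp_assoc)
    finally show ?thesis by (simp add: r1 r2 r3 r4 s1 s2 s3 s4)
  next
    case 2
    then have "aeq p q" using AES[OF z] by (auto simp: pq)
    then have bg: "q = p + 1" "p > int n" "q > int n" using p0 by (auto simp: aeq_def)
    have o: "\<bar>p\<bar> \<noteq> 2" "\<bar>q\<bar> \<noteq> 1" using bg le by auto
    note ov = outv[OF abs(1) o(1)] outv[OF o(2) abs(2)]
    have na: "\<not> aeq (- p) q" "aeq (- q) (- p)" using bg p0 by (auto simp: aeq_def)
    have p2: "p \<noteq> 2" "q \<noteq> 2" "q \<noteq> 1" "p \<noteq> 1" "- p < q" "q > 0" using o abs p0 bg by auto
    note e = ra sa za ov abs o p0 na p2
    have R2: "act s (act r z) \<in> G" and r2: "T s (bv (act r z)) = bv (act s (act r z))"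
      using upS[OF R1] UpS[OF R1] z by (auto simp: e)
    have R3: "act r (act s (act r z)) \<in> G" and r3: "T r (bv (act s (act r z))) = bv (act r (act s (act r z)))"
      using upR[OF R2] UpR[OF R2] z R1 by (auto simp: e)
    have "AE s (act r (act s (act r z)))" using AES[OF R3] z R1 R2 by (auto simp: e)
    then have r4: "T s (bv (act r (act s (act r z)))) = vscale cA (bv (act r (act s (act r z))))"
      by (rule T_AE[OF R3])
    show ?thesis using S z R1 R2 R3 by (simp add: r1 r2 r3 r4 T_AE[OF z 2] T_vscale)
  next
    case 3
    then have "p = 2" using DES[OF z] p0 by (auto simp: pq)
    then have q1: "p = 2" "q = 1" using GD(9)[OF z, of 1 2] by (auto simp: pq)
    have v1: "act r z 1 = - 2" "act r z 2 = - 1" using z by (simp_all add: ra za q1 v)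
    have d: "DE s (act r z)" "\<not> AE s (act r z)" using DES[OF R1] AES[OF R1] le by (auto simp: v1 aeq_def)
    have dn: "Dn r (act r z)" using up[OF S(1) z ur] by blast
    have rr: "T r (bv (act r z)) = bv z + vscale dd (bv (act r z))"
      using T_dn[OF S(1) R1 dn] act_act[OF S(1)] by simp
    show ?thesis using S z R1
      by (simp add: r1 rr T_DE[OF z 3] T_DE[OF R1 d] T_vscale T_add vscale_simps(1,5) ac_simps)
  qed
qed

sublocale hecke_module t n G T
proof
  show "finite G" by (rule finite_G)
  fix s assume s: "s \<in> S"
  show "lin G G (T s)" by (rule T_lin[OF s])
  show "T s (T s v) = v + vscale dd (T s v)" if "v \<in> fspace G" for v by (rule T_quad[OF s that])
next
  fix r s v assume v: "v \<in> fspace G"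
  show "T r (T s v) = T s (T r v)" if "cf2 r s"
    using braid2I[OF _ _ braid2_min[OF that] v] cf_S(1)[OF that] by blast
  show "T r (T s (T r v)) = T s (T r (T s v))" if "cf3 r s"
    using braid3I[OF _ _ braid3_min[OF that] v] cf_S(2)[OF that] by blast
  show "T r (T s (T r (T s v))) = T s (T r (T s (T r v)))" if "cf4 r s"
    using braid4I[OF _ _ braid4_min[OF that] v] cf_S(3)[OF that] by blast
qed

end

section \<open>Minimal elements\<close>

text \<open>At the first disagreement the smaller value would have to be taken by the other function
  at an earlier point, where both agree.\<close>

lemma increasing_unique:
  fixes f g :: "int \<Rightarrow> int"
  assumes K: "finite K" and f: "\<And>i j. i \<in> K \<Longrightarrow> j \<in> K \<Longrightarrow> i < j \<Longrightarrow> f i < f j"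
    and g: "\<And>i j. i \<in> K \<Longrightarrow> j \<in> K \<Longrightarrow> i < j \<Longrightarrow> g i < g j" and im: "f ` K = g ` K" and k: "k \<in> K"
  shows "f k = g k"
proof (rule ccontr)
  assume ne: "f k \<noteq> g k"
  let ?B = "{i\<in>K. f i \<noteq> g i}"
  have B: "finite ?B" "?B \<noteq> {}" using K k ne by auto
  define i where "i = Min ?B"
  have i: "i \<in> K" "f i \<noteq> g i" using Min_in[OF B] by (auto simp: i_def)
  have below: "f j = g j" if "j \<in> K" "j < i" for j
    using Min_le[OF B(1), of j] that by (force simp: i_def)
  have False if H: "f i < g i" "\<And>i j. i \<in> K \<Longrightarrow> j \<in> K \<Longrightarrow> i < j \<Longrightarrow> f i < f j"
    "\<And>i j. i \<in> K \<Longrightarrow> j \<in> K \<Longrightarrow> i < j \<Longrightarrow> g i < g j" "f ` K = g ` K" "\<And>j. j \<in> K \<Longrightarrow> j < i \<Longrightarrow> f j = g j" for f g :: "int \<Rightarrow> int"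
  proof -
    obtain j where j: "j \<in> K" "f i = g j" using H(4) i(1) by blast
    have "\<not> i < j" using H(1) H(3)[OF i(1) j(1)] j(2) by auto
    moreover have "i \<noteq> j" using H(1) j(2) by auto
    ultimately have "j < i" by simp
    then show False using H(2)[OF j(1) i(1)] H(5)[OF j(1)] j by simp
  qed
  from this[of f g] this[of g f] show False
    using i(2) f g im below by (cases "f i < g i") (auto simp: not_less order_le_less)
qed

context conj_module
begin

lemma T'_Ti: "T' = Ti" by (simp add: fun_eq_iff T'_def Ti_def)

definition Kz :: "perm \<Rightarrow> int set" where "Kz z = {j. int n < j \<and> j \<le> int N \<and> \<bar>z j\<bar> \<le> int n}"

lemma G_visdes: "z \<in> G \<Longrightarrow> i > int n \<Longrightarrow> z (i + 1) \<ge> min i (z i) \<and> z i \<ge> - i"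
  using n2 by (auto simp: Gg_def visdes_def)

lemma G_out: assumes z: "z \<in> G" and i: "i > int n" "\<bar>z i\<bar> > int n" shows "z i > int n"
proof (rule ccontr)
  assume "\<not> z i > int n"
  with i have m: "- z i > int n" by simp
  have "z i \<noteq> - i" using GD(8)[OF z, of i] GD(3)[OF z, of i] i n2 by (cases "i \<le> int N") auto
  moreover have "z (- z i) = - i" using GD(2,4)[OF z] by simp
  ultimately show False using G_visdes[OF z i(1)] G_visdes[OF z m] by auto
qed

lemma G_out_step: assumes z: "z \<in> G" and i: "i > int n" "\<bar>z i\<bar> > int n" shows "\<bar>z (i + 1)\<bar> > int n"
  using G_visdes[OF z i(1)] G_out[OF z i] i by auto

text \<open>Once a value at a position beyond \<open>n\<close> is itself beyond \<open>n\<close>,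
  the absence of visible descents keeps all later ones there. So \<open>Kz z\<close> is an initial
  segment of the positions after \<open>n\<close>.\<close>

lemma Kz_convex: assumes z: "z \<in> G" and j: "\<bar>z j\<bar> \<le> int n" and i: "int n < i" "i \<le> j" shows "\<bar>z i\<bar> \<le> int n"
proof (rule ccontr)
  assume ni: "\<not> \<bar>z i\<bar> \<le> int n"
  have "i \<le> j \<Longrightarrow> \<bar>z j\<bar> > int n" for j
  proof (induction j rule: int_ge_induct)
    case base then show ?case using ni by simp
  next
    case (step j) then show ?case using G_out_step[OF z, of j] i by auto
  qed
  then show False using j i by force
qed

lemma Kz_incr:
  assumes z: "z \<in> G" and i: "int n < i" "i < j" and j: "\<bar>z j\<bar> \<le> int n" shows "z i < z j"
proof -
  have "i + 1 \<le> j" using i by simp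
  then show ?thesis using j
  proof (induction j rule: int_ge_induct)
    case base
    have "\<bar>z i\<bar> \<le> int n" using Kz_convex[OF z base i(1)] by simp
    then show ?case using G_visdes[OF z i(1)] GD(5)[OF z, of i "i + 1"] i by (auto simp: min_def split: if_splits)
  next
    case (step j)
    then have zj: "\<bar>z j\<bar> \<le> int n" using Kz_convex[OF z step.prems, of j] i by simp
    then have "z j < z (j + 1)"
      using G_visdes[OF z, of j] GD(5)[OF z, of j "j + 1"] i step by (auto simp: min_def split: if_splits)
    then show ?case using step.IH[OF zj] by simp
  qed
qed

definition minimal :: "perm \<Rightarrow> bool" where "minimal z \<longleftrightarrow> (\<forall>s\<in>S. \<not> Dn s z)"

lemma minimalD: assumes "minimal z" "z \<in> G" "(a, b) \<in> P" shows "z a < z b \<or> z a = b \<and> z b = a \<or> z a = - b \<and> z b = - a"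
proof -
  have "swp a b \<in> S" using assms S_swp by blast
  then have "z a < z b \<or> \<bar>z a\<bar> = \<bar>b\<bar>"
    using assms Dn_iff[OF assms(3,2)] P_G(3)[OF assms(3,2)] by (auto simp: minimal_def)
  then show ?thesis
    using GD(9)[OF assms(2), of a b] GD(9)[OF assms(2), of a "- b"] GD(2)[OF assms(2), of b] by (auto simp: abs_eq_iff)
qed

lemma minimal_step:
  assumes "minimal z" "z \<in> G" "1 \<le> i" "i < int n"
  shows "z i < z (i + 1) \<or> z i = i + 1 \<and> z (i + 1) = i \<or> z i = - (i + 1) \<and> z (i + 1) = - i"
  using minimalD[OF assms(1,2), of i "i + 1"] assms(3,4) by (auto simp: spair_def)

lemma minimal_chain:
  assumes m: "minimal z" and z: "z \<in> G" and j: "1 \<le> j" "z j > 0" shows "j \<le> i \<Longrightarrow> i \<le> int n \<Longrightarrow> z i > 0"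
proof (induction i rule: int_ge_induct)
  case base show ?case by (rule j)
next
  case (step i) then show ?case using minimal_step[OF m z, of i] j by auto
qed

text \<open>Only \<open>z 1\<close> could start a run of negative values. Types A and BC exclude
  this at once; in type D it would make 1 the only element of \<open>negp\<close>, against its
  parity.\<close>

lemma minimal_pos:
  assumes m: "minimal z" and z: "z \<in> G" and i: "i > 0" shows "z i > 0"
proof -
  have z0: "z 1 \<noteq> 0" "\<bar>z 1\<bar> \<noteq> 1" using GD(6)[OF z, of 1] GD(8)[OF z, of 1] N.n2 by auto
  have z1: "z 1 > 0"
  proof (cases t)
    case TypeA then show ?thesis using WgrpD(5)[OF G_W[OF z]] by simp
  next
    case TypeBC
    then have "(- 1, 1) \<in> P" by (auto simp: spair_def)
    then show ?thesis using minimalD[OF m z, of "- 1" 1] GD(2)[OF z, of 1] z0 by auto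
  next
    case TypeD
    then have P: "(- 1, 2) \<in> P" by (auto simp: spair_def)
    show ?thesis
    proof (rule ccontr)
      assume "\<not> z 1 > 0"
      then have neg: "z 1 < - 1" using z0 by auto
      have D1: "- z 1 < z 2 \<or> z 1 = - 2 \<and> z 2 = - 1"
        using minimalD[OF m z P] GD(2)[OF z, of 1] neg by auto
      have ge: "\<not> z i < - i" if i: "2 \<le> i" "i \<le> int N" for i
      proof (cases "i \<le> int n")
        case False then show ?thesis using G_visdes[OF z, of i] by auto
      next
        case True
        from D1 show ?thesis
        proof
          assume "- z 1 < z 2"
          then have "z 2 > 0" using neg by simp
          then show ?thesis using minimal_chain[OF m z, of 2 i] i True by auto
        next
          assume e: "z 1 = - 2 \<and> z 2 = - 1"
          show ?thesis
          proof (cases "i = 2")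
            case True then show ?thesis using e by simp
          next
            case False
            then have "z 2 < z 3" using minimal_step[OF m z, of 2] i True e by auto
            then have "z 3 > 0" using e GD(6)[OF z, of 3] by auto
            then show ?thesis using minimal_chain[OF m z, of 3 i] i True False by auto
          qed
        qed
      qed
      have "negp N z = {1}"
      proof (intro set_eqI iffI)
        fix i assume "i \<in> negp N z"
        then show "i \<in> {1}" using ge[of i] by (cases "i = 1") (auto simp: negp_def)
      qed (use neg N.n2 in \<open>auto simp: negp_def\<close>)
      then show False using z TypeD by (simp add: Gg_def)
    qed
  qed
  have low: "z j > 0" if "1 \<le> j" "j \<le> int n" for j using minimal_chain[OF m z, of 1 j] z1 that by simp
  show ?thesis
  proof (cases "i \<le> int n")
    case True then show ?thesis using low i by simp
  next
    case False
    show ?thesis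
    proof (rule ccontr)
      assume "\<not> z i > 0"
      then have n: "z i < 0" using GD(6)[OF z, of i] i by force
      then have "\<bar>z i\<bar> \<le> int n" using G_out[OF z, of i] False by force
      then have "z (- z i) > 0" using low[of "- z i"] n by auto
      then show False using GD(2,4)[OF z] i by simp
    qed
  qed
qed

text \<open>Downwards from \<open>z j = i\<close> the values at the positions after \<open>i\<close>
  stay at most \<open>i\<close>, but the inequality at \<open>i\<close> itself makes
  \<open>z (i + 1)\<close> at least \<open>i\<close>. Hence \<open>i + 1\<close> is the partner of
  \<open>i\<close>.\<close>

lemma adjacent:
  assumes z: "z \<in> G" and nv: "\<And>k. i \<le> k \<Longrightarrow> k < j \<Longrightarrow> z (k + 1) \<ge> min k (z k)"
    and j: "z i = j" "i < j"
  shows "j = i + 1"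
proof (rule ccontr)
  assume "j \<noteq> i + 1"
  then have ij: "i + 1 < j" using j by simp
  have "l \<le> j \<Longrightarrow> i + 1 \<le> l \<Longrightarrow> z l \<le> i" for l
  proof (induction l rule: int_le_induct)
    case base then show ?case using GD(9)[OF z, of i j] j by simp
  next
    case (step l)
    then have "z l \<le> i" "z l \<ge> min (l - 1) (z (l - 1))" using nv[of "l - 1"] by auto
    then show ?case using step by (auto simp: min_def split: if_splits)
  qed
  from this[of "i + 1"] have "z (i + 1) \<le> i" using ij by simp
  moreover have "z (i + 1) \<ge> i" using nv[of i] j by simp
  ultimately have "z (i + 1) = i" by simp
  then show False using GD(9)[OF z, of "i + 1" i] j ij by simp
qed

lemma minimal_adjacent:
  assumes m: "minimal z" and z: "z \<in> G" and i: "1 \<le> i" "i < z i" "i \<le> int n \<longrightarrow> z i \<le> int n"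
  shows "z i = i + 1"
proof (rule adjacent[OF z _ refl i(2)])
  fix k assume k: "i \<le> k" "k < z i"
  show "z (k + 1) \<ge> min k (z k)"
  proof (cases "k < int n")
    case True
    then show ?thesis using minimal_step[OF m z, of k] minimal_pos[OF m z, of k] k i by auto
  next
    case False
    then have "k > int n" using i k by (cases "i \<le> int n") auto
    then show ?thesis using G_visdes[OF z] by blast
  qed
qed

lemma finite_Kz: "finite (Kz z)"
  by (rule finite_subset[of _ "{int n..int N}"]) (auto simp: Kz_def)

text \<open>The positions in \<open>[n]\<close> with partners beyond \<open>n\<close> form a final
  segment \<open>E\<close>, determined by its size, which is that of \<open>Kz z\<close>; and
  \<open>z\<close> maps \<open>Kz z\<close> increasingly onto \<open>E\<close>. All other positions
  are paired with neighbours, so \<open>z\<close> can be read off from left to right.\<close>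

lemma minimal_unique:
  assumes m: "minimal z" "minimal y" and z: "z \<in> G" "y \<in> G" and K: "Kz z = Kz y"
  shows "z = y"
proof -
  define E where "E z = {i. 1 \<le> i \<and> i \<le> int n \<and> z i > int n}" for z :: perm
  have EK: "z ` Kz z = E z" if "minimal z" "z \<in> G" for z
  proof (intro set_eqI iffI)
    fix i assume "i \<in> z ` Kz z"
    then obtain j where j: "i = z j" "int n < j" "j \<le> int N" "\<bar>z j\<bar> \<le> int n" by (auto simp: Kz_def)
    then show "i \<in> E z" using minimal_pos[OF that, of j] GD(4)[OF that(2)] n2 by (auto simp: E_def)
  next
    fix i assume i: "i \<in> E z"
    then have "\<bar>z i\<bar> \<le> int N" using GD(7)[OF that(2), of i] nN by (auto simp: E_def)
    then show "i \<in> z ` Kz z" using i GD(4)[OF that(2), of i]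
      by (intro image_eqI[of _ _ "z i"]) (auto simp: E_def Kz_def)
  qed
  have cardE: "card (E z) = card (Kz z)" if "minimal z" "z \<in> G" for z
    unfolding EK[OF that, symmetric] by (rule card_image) (use GD(5)[OF that(2)] in \<open>auto intro: inj_onI\<close>)
  have fE: "finite (E z)" for z by (rule finite_subset[of _ "{1..int n}"]) (auto simp: E_def)
  have upE: "j \<in> E z" if z: "minimal z" "z \<in> G" and i: "i \<in> E z" and j: "i \<le> j" "j \<le> int n" for z i j
    using j
  proof (induction j rule: int_ge_induct)
    case (step j)
    then have "j \<in> E z" by simp
    then show ?case using minimal_step[OF z, of j] step by (auto simp: E_def)
  qed (rule i)
  have subE: "E z \<subseteq> E y" if "minimal z" "z \<in> G" "minimal y" "y \<in> G" "card (E z) = card (E y)" for z y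
  proof (rule ccontr)
    assume "\<not> E z \<subseteq> E y"
    then obtain i where i: "i \<in> E z" "i \<notin> E y" by blast
    have "E y \<subseteq> E z"
    proof
      fix j assume j: "j \<in> E y"
      then have "i < j" using upE[OF that(3,4) j, of i] i by (force simp: E_def)
      then show "j \<in> E z" using upE[OF that(1,2) i(1), of j] j by (simp add: E_def)
    qed
    then have "E y \<subset> E z" using i by blast
    then show False using psubset_card_mono[OF fE] that(5) by force
  qed
  have cE: "card (E z) = card (E y)" using cardE m z K by simp
  have EE: "E z = E y" using subE[OF m(1) z(1) m(2) z(2) cE] subE[OF m(2) z(2) m(1) z(1) cE[symmetric]] by blast
  have onK: "z k = y k" if "k \<in> Kz z" for k
  proof (rule increasing_unique[OF finite_Kz _ _ _ that])
    show "z i < z j" if "i \<in> Kz z" "j \<in> Kz z" "i < j" for i j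
      using Kz_incr[OF z(1), of i j] that by (auto simp: Kz_def)
    show "y i < y j" if "i \<in> Kz z" "j \<in> Kz z" "i < j" for i j
      using Kz_incr[OF z(2), of i j] that unfolding K by (auto simp: Kz_def)
    show "z ` Kz z = y ` Kz z" using EK[OF m(1) z(1)] EK[OF m(2) z(2)] EE K by simp
  qed
  have onE: "z i = y i" if "i \<in> E z" for i
  proof -
    have "i \<in> z ` Kz z" unfolding EK[OF m(1) z(1)] by (rule that)
    then obtain k where k: "k \<in> Kz z" "i = z k" by blast
    then show ?thesis using onK[OF k(1)] GD(4)[OF z(1), of k] GD(4)[OF z(2), of k] by simp
  qed
  have pos: "z i = y i" if "i > 0" for i
    using that
  proof (induction "nat i" arbitrary: i rule: less_induct)
    case less
    note p = minimal_pos[OF m(1) z(1) less.prems] minimal_pos[OF m(2) z(2) less.prems]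
    show ?case
    proof (cases "i > int N")
      case True then show ?thesis using GD(3)[OF z(1)] GD(3)[OF z(2)] by simp
    next
      case False
      show ?thesis
      proof (cases "i \<in> Kz z \<or> i \<in> E z")
        case True then show ?thesis by (elim disjE) (erule onK, erule onE)
      next
        case nKE: False
        have "i \<notin> E z" "i \<notin> E y" unfolding EE[symmetric] using nKE by auto
        then have side: "i \<le> int n \<longrightarrow> z i \<le> int n" "i \<le> int n \<longrightarrow> y i \<le> int n"
          using less.prems unfolding E_def mem_Collect_eq by linarith+
        have ne: "z i \<noteq> i" "y i \<noteq> i" using GD(8)[OF z(1), of i] GD(8)[OF z(2), of i] False less.prems by auto
        show ?thesis
        proof (cases "z i < i \<or> y i < i")
          case True
          then show ?thesis
          proof
            assume "z i < i"
            then have "z (z i) = y (z i)" using less.hyps[of "z i"] p by simp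
            then show ?thesis using GD(4)[OF z(1), of i] GD(9)[OF z(2), of "z i" i] by simp
          next
            assume "y i < i"
            then have "z (y i) = y (y i)" using less.hyps[of "y i"] p by simp
            then show ?thesis using GD(4)[OF z(2), of i] GD(9)[OF z(1), of "y i" i] by simp
          qed
        next
          case False
          then show ?thesis
            using minimal_adjacent[OF m(1) z(1), of i] minimal_adjacent[OF m(2) z(2), of i]
              side ne less.prems by simp
        qed
      qed
    qed
  qed
  show "z = y"
  proof
    fix i
    show "z i = y i"
    proof (cases i "0::int" rule: linorder_cases)
      case less
      then have "z (- i) = y (- i)" using pos by simp
      then show ?thesis unfolding GD(2)[OF z(1)] GD(2)[OF z(2)] by simp
    next
      case equal then show ?thesis using GD(6)[OF z(1), of i] GD(6)[OF z(2), of i] by simp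
    next
      case greater then show ?thesis by (rule pos)
    qed
  qed
qed

section \<open>The bar operator on the full conjugacy class\<close>

text \<open>Here \<open>M\<^sub>z \<mapsto> C H\<^sub>z\<^sup>-\<^sup>1 M\<^sub>z\<close> does the job: if \<open>s\<close> is an ascent then \<open>H\<^bsub>szs\<^esub> = H\<^sub>s H\<^sub>z H\<^sub>s\<close>, and if
  \<open>sz = zs\<close> then \<open>H\<^sub>s\<close> and \<open>H\<^sub>z\<close> commute.\<close>

lemma cD_bar: "cD - dd = lbar cD" "cA - dd = lbar cA" "cD * lbar cD = 1" "cA * lbar cA = 1"
  using cA cD by (auto simp: ringhomD algebra_simps)

lemma full_AE: assumes "n = N" "z \<in> G" shows "\<not> AE s z \<or> s \<notin> S"
proof (rule ccontr)
  assume "\<not> ?thesis"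
  then obtain i where i: "i > int n" "z \<circ> s \<circ> z = sgen i" and s: "s \<in> S" by (auto simp: AE_def)
  have "z i = i" "s i = i" using GD(3)[OF assms(2), of i] S_outside[OF s, of i] i assms(1) by auto
  then have "(z \<circ> s \<circ> z) i = i" by (simp add: comp_apply)
  then show False unfolding i(2) using i(1) by (simp add: sgen_def)
qed

lemma Ti_bv_DE: assumes "s \<in> S" "z \<in> G" "DE s z" "\<not> AE s z" shows "Ti s (bv z) = vscale (lbar cD) (bv z)"
  unfolding Ti_def T_DE[OF assms(2-4)] cD_bar(1)[symmetric] by (simp add: vscale_simps)

text \<open>Since \<open>s z = z s\<close>, the longer of \<open>z\<close> and \<open>s z\<close>
  has reduced words with \<open>s\<close> at either end.\<close>

lemma Tw_DE:
  assumes full: "n = N" and s: "s \<in> S" and z: "z \<in> G" and d: "DE s z" and v: "v \<in> fspace G"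
  shows "Ti s (Tw Ti z v) = Tw Ti z (Ti s v)"
proof -
  note B = Ti_braided
  have zW: "z \<in> W" using G_W[OF z] full by simp
  have comm: "s \<circ> z = z \<circ> s" using d by (simp add: DE_def)
  note Tv = Ti_closed[OF s v]
  show ?thesis
  proof (cases "LD s z")
    case False
    have "len (z \<circ> s) = len z + 1" using len_S(2)[OF zW s False] comm by simp
    from Tw_right[OF B zW s this v] Tw_left[OF B zW s False v] show ?thesis by (simp add: comm)
  next
    case True
    let ?u = "s \<circ> z"
    have u: "?u \<in> W" "\<not> LD s ?u" "s \<circ> ?u = z" using SW[OF s zW] LD_flip[OF zW s] True S_S_comp[OF s] by auto
    have us: "?u \<circ> s = z" unfolding comm by (simp only: comp_assoc S_S[OF s] comp_id)
    have l: "len (?u \<circ> s) = len ?u + 1" unfolding us by (rule len_S(1)[OF zW s True])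
    have 1: "Tw Ti z w = Ti s (Tw Ti ?u w)" if "w \<in> fspace G" for w
      using Tw_left[OF B u(1) s u(2) that] u(3) by simp
    have 2: "Tw Ti z w = Tw Ti ?u (Ti s w)" if "w \<in> fspace G" for w
      using Tw_right[OF B u(1) s l that] us by simp
    show ?thesis using 1[OF Tv] 2[OF v] by simp
  qed
qed

text \<open>Both multiplications in \<open>s z s\<close> lengthen, so the operator of
  \<open>s z s\<close> is \<open>Ti s\<close>, then that of \<open>z\<close>, then
  \<open>Ti s\<close> again; the innermost \<open>Ti s\<close> takes \<open>bv (act s z)\<close>
  back to \<open>bv z\<close>.\<close>

lemma Tw_Up:
  assumes full: "n = N" and s: "s \<in> S" and z: "z \<in> G" and U: "Up s z"
  shows "Tw Ti (act s z) (bv (act s z)) = Ti s (Tw Ti z (bv z))"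
proof -
  note B = Ti_braided
  have zW: "z \<in> W" using G_W[OF z] full by simp
  note u = up[OF s z U]
  have "\<not> N.LD s z" using U by (simp add: Up_def)
  then have nl: "\<not> LD s z" using full by simp
  have l: "len (s \<circ> z) = len z + 1" by (rule len_S(2)[OF zW s nl])
  have "len (act s z) = len z + 2" using u full by simp
  then have l2: "len ((s \<circ> z) \<circ> s) = len (s \<circ> z) + 1" using l by (simp add: act_def)
  have aG: "bv (act s z) \<in> fspace G" using u by simp
  have "Tw Ti (act s z) (bv (act s z)) = Tw Ti (s \<circ> z) (Ti s (bv (act s z)))"
    unfolding act_def[of s z, folded comp_assoc] using Tw_right[OF B SW[OF s zW] s l2 aG] by (simp add: act_def)
  also have "Ti s (bv (act s z)) = bv z" using Ti_T[OF s, of "bv z"] z T_up[OF z U] by simp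
  also have "Tw Ti (s \<circ> z) (bv z) = Ti s (Tw Ti z (bv z))" using Tw_left[OF B zW s nl] z by simp
  finally show ?thesis .
qed

text \<open>A minimal \<open>z\<close> of the full class is the product of the adjacent
  transpositions of positions 1 and 2, 3 and 4, and so on, each of which commutes with
  \<open>z\<close>. The statement is about partial products \<open>w\<close> of these so that
  induction can remove one factor at a time.\<close>

lemma Tw_minimal:
  assumes full: "n = N" and z: "z \<in> G" and m: "minimal z"
    and w: "w \<in> W" "\<And>i. w i = i \<or> w i = z i"
  shows "Tw Ti w (bv z) = vscale (lbar cD ^ len w) (bv z)"
  using w
proof (induction "len w" arbitrary: w rule: less_induct)
  case less
  note B = Ti_braided
  have bz: "bv z \<in> fspace G" using z by simp
  have adj: "z i = i + 1 \<or> z i = i - 1" if i: "1 \<le> i" "i \<le> int N" for i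
  proof (cases "i < z i")
    case True
    then show ?thesis using minimal_adjacent[OF m z, of i] GD(7)[OF z, of i] i full by auto
  next
    case False
    then have lt: "z i < i" using GD(8)[OF z, of i] i by force
    have "1 \<le> z i" using minimal_pos[OF m z, of i] i by simp
    then show ?thesis using minimal_adjacent[OF m z, of "z i"] GD(4)[OF z, of i] lt i full by auto
  qed
  show ?case
  proof (cases "inv w = id")
    case True
    then have w: "w = id" using WgrpD(1)[OF less.prems(1)] by (metis inv_inv_eq inv_id)
    have "len id \<le> 0" using len_word_le[of "[]"] by (simp only: prodw_Nil) simp
    then have "len id = 0" by simp
    then show ?thesis unfolding w Tw_id[OF B bz] by simp
  next
    case False
    define v where "v = inv w"
    have vW: "v \<in> W" using W_inv[OF less.prems(1)] by (simp add: v_def)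
    have wv: "w (v k) = k" "v (w k) = k" for k
      using WgrpD(1)[OF less.prems(1)] by (auto simp: v_def bij_is_surj surj_f_inv_f bij_is_inj)
    have vp: "v i = i \<or> v i = z i" for i
      using less.prems(2)[of "v i"] wv(1)[of i] GD(4)[OF z] by metis
    have posv: "v i > 0" if "i > 0" for i using vp[of i] minimal_pos[OF m z that] that by auto
    have "v \<noteq> id" using False by (simp add: v_def)
    then obtain a b where ab: "(a, b) \<in> P" "\<not> v a < v b" using increasing_id[OF vW] by blast
    then have gt: "v a > v b" using inv_neq[OF less.prems(1) ab(1)] by (auto simp: v_def)
    from ab(1) obtain sh: "b = a + 1" "1 \<le> a" "a < int n"
    proof (cases rule: spair_cases)
      case zero then show ?thesis using gt posv[of 1] WgrpD(2)[OF vW, of 1] by auto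
    next
      case minus then show ?thesis using gt posv[of 1] posv[of 2] WgrpD(2)[OF vW, of 1] by auto
    qed
    have za: "z a = b"
      using vp[of a] vp[of b] gt adj[of a] adj[of b] sh full by auto
    let ?s = "swp a b"
    have s: "?s \<in> S" using ab S_swp by blast
    have L: "LD ?s w" using LD_iff[OF less.prems(1) ab(1)] gt by (simp add: v_def)
    let ?u = "?s \<circ> w"
    have u: "?u \<in> W" "\<not> LD ?s ?u" "?s \<circ> ?u = w"
      using SW[OF s less.prems(1)] LD_flip[OF less.prems(1) s] L S_S_comp[OF s] by auto
    have zb: "z b = a" using GD(9)[OF z, of a b] za by simp
    have "?s k = z k" if "k \<in> {a, b, - a, - b}" for k
      using that za zb GD(2)[OF z, of a] GD(2)[OF z, of b] by (auto simp: swp_def)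
    moreover have "?s k = k" if "k \<notin> {a, b, - a, - b}" for k using that by (auto simp: swp_def)
    ultimately have up: "?u i = i \<or> ?u i = z i" for i
      unfolding comp_apply using less.prems(2)[of i] GD(4)[OF z, of i] by metis
    have lw: "len w = Suc (len ?u)" using len_S(1)[OF less.prems(1) s L] by simp
    have d: "DE ?s z" "\<not> AE ?s z" using DE_iff[OF ab(1) z] full_AE[OF full z] za s by auto
    have "Tw Ti w (bv z) = Ti ?s (Tw Ti ?u (bv z))" using Tw_left[OF B u(1) s u(2) bz] u(3) by simp
    also have "Tw Ti ?u (bv z) = vscale (lbar cD ^ len ?u) (bv z)"
      by (rule less.hyps[OF _ u(1) up]) (simp add: lw)
    also have "Ti ?s \<dots> = vscale (lbar cD ^ len w) (bv z)"
      using slinD(3)[OF Ti_lin[OF s] bz] Ti_bv_DE[OF s z d] by (simp add: lw vscale_simps mult.commute)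
    finally show ?thesis .
  qed
qed

lemma full_bar:
  assumes full: "n = N"
  shows "\<exists>\<beta>. slin lbar G G \<beta> \<and> (\<forall>s\<in>S. \<forall>z\<in>G. \<beta> (T s (bv z)) = Ti s (\<beta> (bv z))) \<and>
    (\<forall>z\<in>G. minimal z \<longrightarrow> \<beta> (bv z) = bv z)"
proof -
  \<comment> \<open>At the minimal vector the operator of \<open>z\<close> is the scalar
    \<open>lbar cD ^ len z\<close>, and \<open>C\<close> is its inverse. The choice is harmless, as
    \<open>minimal_unique\<close> with \<open>Kz\<close> empty allows only one minimal
    element.\<close>
  define C where "C = cD ^ len (SOME z. z \<in> G \<and> minimal z)"
  define B where "B z = vscale C (Tw Ti z (bv z))" for z
  have GW: "z \<in> W" if "z \<in> G" for z using G_W[OF that] full by simp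
  have BG: "B z \<in> fspace G" if "z \<in> G" for z
    unfolding B_def using Tw_closed[OF Ti_braided GW[OF that]] that by auto
  have TG: "Tw Ti z (bv z) \<in> fspace G" if "z \<in> G" for z
    using Tw_closed[OF Ti_braided GW[OF that]] that by auto
  define \<beta> where "\<beta> = slin_ext lbar G B"
  have sl: "slin lbar G G \<beta>" unfolding \<beta>_def by (rule slin_slin_ext[OF ringhom_lbar BG])
  have bb: "\<beta> (bv z) = B z" if "z \<in> G" for z
    unfolding \<beta>_def by (rule slin_ext_bv[OF ringhom_lbar finite_G that])
  have BUp: "B (act s z) = Ti s (B z)" if "s \<in> S" "z \<in> G" "Up s z" for s z
    unfolding B_def Tw_Up[OF full that] using slinD(3)[OF Ti_lin[OF that(1)] TG[OF that(2)]] by simp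
  have "\<beta> (T s (bv z)) = Ti s (\<beta> (bv z))" if s: "s \<in> S" and z: "z \<in> G" for s z
  proof -
    consider "Up s z" | "Dn s z" | "DE s z" "\<not> AE s z" using full_AE[OF full z] s not_Dn by blast
    then show ?thesis
    proof cases
      case 1
      then show ?thesis using up[OF s z 1] BUp[OF s z 1] by (simp add: T_up[OF z 1] bb z)
    next
      case 2
      note d = dn[OF s z 2]
      have Bz: "B z = Ti s (B (act s z))" using BUp[OF s, of "act s z"] d by auto
      have "\<beta> (T s (bv z)) = B (act s z) - vscale dd (B z)"
        using d z by (simp add: T_dn[OF s z 2] slinD(2,3)[OF sl] bb ringhomD) (simp add: fun_eq_iff vec_apply algebra_simps)
      also have "\<dots> = Ti s (B z)"
        unfolding Ti_def[of s "B z"] using Bz T_Ti[OF s BG[of "act s z"]] d by simp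
      finally show ?thesis by (simp add: bb z)
    next
      case 3
      have "Ti s (B z) = vscale C (Tw Ti z (Ti s (bv z)))"
        unfolding B_def using slinD(3)[OF Ti_lin[OF s] TG[OF z]] Tw_DE[OF full s z 3(1)] z by simp
      also have "\<dots> = vscale (lbar cD) (B z)"
        unfolding Ti_bv_DE[OF s z 3] B_def using slinD(3)[OF lin_Tw[OF Ti_lin GW[OF z]], where v="bv z"] z
        by (simp add: vscale_simps mult.commute)
      finally show ?thesis using z by (simp add: T_DE[OF z 3] slinD(3)[OF sl] bb)
    qed
  qed
  moreover have "\<beta> (bv z) = bv z" if z: "z \<in> G" and m: "minimal z" for z
  proof -
    have Kz0: "Kz y = {}" for y unfolding Kz_def using full by auto
    have "(SOME z. z \<in> G \<and> minimal z) = z"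
      by (rule some_equality) (use z m minimal_unique Kz0 in auto)
    then have "C = cD ^ len z" by (simp add: C_def)
    moreover have "Tw Ti z (bv z) = vscale (lbar cD ^ len z) (bv z)"
      by (rule Tw_minimal[OF full z m GW[OF z]]) simp
    ultimately have "B z = vscale ((cD * lbar cD) ^ len z) (bv z)"
      by (simp add: B_def vscale_simps power_mult_distrib)
    then show ?thesis by (simp add: bb z cD_bar)
  qed
  ultimately show ?thesis using sl by blast
qed

end

section \<open>The bar operator in general\<close>

text \<open>For a set \<open>K\<close> of positions beyond \<open>n\<close>, sorting the values at \<open>K\<close> maps the module of the full class onto
  the span of the \<open>z\<close> with \<open>Kz z = K\<close>: it factors out \<open>H\<^sub>j = cA\<close> for \<open>j, j + 1 \<in> K\<close>. This map commutes with
  the action of the small Hecke algebra, and its kernel is bar-stable, so the bar operator descends.\<close>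

lemma spair_gap: "(a, b) \<in> spair t n \<Longrightarrow> a < m \<Longrightarrow> m < b \<Longrightarrow> m \<noteq> 0 \<Longrightarrow> m \<noteq> - a \<Longrightarrow> False"
  by (erule spair_cases) auto

lemma order_outside:
  fixes p q p' q' m :: int
  assumes "m \<ge> 0" "(\<bar>p\<bar> \<le> m \<longrightarrow> p' = p) \<and> (p > m \<longrightarrow> p' > m) \<and> (p < - m \<longrightarrow> p' < - m)"
    "(\<bar>q\<bar> \<le> m \<longrightarrow> q' = q) \<and> (q > m \<longrightarrow> q' > m) \<and> (q < - m \<longrightarrow> q' < - m)"
    "\<not> (p > m \<and> q > m)" "\<not> (p < - m \<and> q < - m)"
  shows "p' < q' \<longleftrightarrow> p < q"
proof -
  consider "\<bar>p\<bar> \<le> m" | "p > m" | "p < - m" by linarith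
  then show ?thesis
  proof cases
    case 1
    consider "\<bar>q\<bar> \<le> m" | "q > m" | "q < - m" by linarith
    then show ?thesis using 1 assms by cases auto
  next
    case 2
    consider "\<bar>q\<bar> \<le> m" | "q < - m" using 2 assms(4) by linarith
    then show ?thesis using 2 assms by cases auto
  next
    case 3
    consider "\<bar>q\<bar> \<le> m" | "q > m" using 3 assms(5) by linarith
    then show ?thesis using 3 assms by cases auto
  qed
qed

locale two_ranks = conj_module t n N cA cD + full: conj_module t N N cA cD for t n N cA cD
begin

section \<open>Sorting the values at K\<close>

definition symK :: "int set \<Rightarrow> perm \<Rightarrow> bool" where
  "symK K \<sigma> \<longleftrightarrow> bij \<sigma> \<and> (\<forall>i. \<sigma> (- i) = - \<sigma> i) \<and> (\<forall>i\<in>K. \<sigma> i \<in> K) \<and> (\<forall>i. i \<notin> K \<longrightarrow> - i \<notin> K \<longrightarrow> \<sigma> i = i)"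

text \<open>For \<open>z\<close> in \<open>GK K\<close>, which increases on \<open>K\<close>, this
  says that \<open>z\<close> arises from \<open>y\<close> by sorting the values at
  \<open>K\<close>.\<close>

definition srt :: "int set \<Rightarrow> perm \<Rightarrow> perm \<Rightarrow> bool" where
  "srt K y z \<longleftrightarrow> (\<exists>\<sigma>. symK K \<sigma> \<and> y \<circ> \<sigma> = \<sigma> \<circ> z)"

definition GK :: "int set \<Rightarrow> perm set" where "GK K = {z \<in> G. Kz z = K}"

text \<open>This is \<open>cA\<close> to the power \<open>(h y - h z) / 2\<close>, written without
  negative exponents since \<open>lbar cA\<close> is the inverse of \<open>cA\<close>. Each sorting
  step lowers \<open>h\<close> by 2 and yields one factor \<open>cA\<close>.\<close>

definition coef :: "perm \<Rightarrow> perm \<Rightarrow> lpoly" where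
  "coef y z = cA ^ (h y div 2) * lbar cA ^ (h z div 2)"

text \<open>By \<open>srt_unique\<close> at most one entry is nonzero. This form avoids choosing the
  sorted element, which need not exist.\<close>

definition pcol :: "int set \<Rightarrow> perm \<Rightarrow> vec" where
  "pcol K y = (\<lambda>z. if z \<in> GK K \<and> srt K y z then coef y z else 0)"

definition proj :: "int set \<Rightarrow> vec \<Rightarrow> vec" where "proj K = lin_ext full.G (pcol K)"

lemma GKD: "z \<in> GK K \<Longrightarrow> z \<in> G" "z \<in> GK K \<Longrightarrow> Kz z = K" by (auto simp: GK_def)

lemma K_range: "z \<in> GK K \<Longrightarrow> j \<in> K \<Longrightarrow> int n < j \<and> j \<le> int N \<and> \<bar>z j\<bar> \<le> int n"
  by (auto simp: GK_def Kz_def)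

lemma G_full: "z \<in> G \<Longrightarrow> z \<in> full.G"
  using nN by (auto simp: Gg_def)

lemma S_full: "s \<in> S \<Longrightarrow> s \<in> N.S" by (rule S_N)

lemma proj_lin: "lin full.G G (proj K)"
  unfolding proj_def by (rule lin_lin_ext) (auto simp: pcol_def fspace_def GK_def)

lemma proj_bv: "y \<in> full.G \<Longrightarrow> proj K (bv y) = pcol K y"
  unfolding proj_def by (rule lin_ext_bv[OF full.finite_G])

lemma symKD:
  assumes "symK K \<sigma>"
  shows "bij \<sigma>" "\<sigma> (- i) = - \<sigma> i" "i \<in> K \<Longrightarrow> \<sigma> i \<in> K" "i \<notin> K \<Longrightarrow> - i \<notin> K \<Longrightarrow> \<sigma> i = i"
  using assms by (auto simp: symK_def)

lemma symK_low: "symK K \<sigma> \<Longrightarrow> z \<in> GK K \<Longrightarrow> \<bar>i\<bar> \<le> int n \<Longrightarrow> \<sigma> i = i"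
  using symKD(4)[of K \<sigma> i] K_range[of z K i] K_range[of z K "- i"] by force

lemma finite_K: "z \<in> GK K \<Longrightarrow> finite K"
  using finite_Kz GKD(2) by blast

lemma K_pos: "z \<in> GK K \<Longrightarrow> \<forall>k\<in>K. k > 0"
  using K_range by fastforce

lemma symK_surj: assumes "symK K \<sigma>" "z \<in> GK K" shows "\<sigma> ` K = K"
proof (rule card_seteq[OF finite_K[OF assms(2)]])
  show "\<sigma> ` K \<subseteq> K" using symKD(3)[OF assms(1)] by blast
  have "inj_on \<sigma> K" using symKD(1)[OF assms(1)] by (meson bij_is_inj inj_on_subset subset_UNIV)
  then show "card K \<le> card (\<sigma> ` K)" by (simp add: card_image)
qed

lemma srt_refl: "srt K z z"
  unfolding srt_def by (rule exI[of _ id]) (auto simp: symK_def)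

lemma srt_image:
  assumes "symK K \<sigma>" "y \<circ> \<sigma> = \<sigma> \<circ> z" "z \<in> GK K"
  shows "k \<in> K \<Longrightarrow> y (\<sigma> k) = z k" "y ` K = z ` K"
proof -
  show *: "y (\<sigma> k) = z k" if "k \<in> K" for k
    using fun_cong[OF assms(2), of k] symK_low[OF assms(1,3), of "z k"] K_range[OF assms(3) that]
    by (simp add: comp_apply)
  have "y ` K = y ` \<sigma> ` K" using symK_surj[OF assms(1,3)] by simp
  also have "\<dots> = z ` K" unfolding image_image by (rule image_cong) (use * in auto)
  finally show "y ` K = z ` K" .
qed

lemma GK_incr: "z \<in> GK K \<Longrightarrow> i \<in> K \<Longrightarrow> j \<in> K \<Longrightarrow> i < j \<Longrightarrow> z i < z j"
  using Kz_incr[of z i j] by (auto simp: GK_def Kz_def)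

lemma srt_off:
  assumes "symK K \<sigma>" "y \<circ> \<sigma> = \<sigma> \<circ> z" "z \<in> GK K" and i: "i \<notin> K" "- i \<notin> K" and zi: "z i \<notin> K" "- z i \<notin> K"
  shows "y i = z i"
  using fun_cong[OF assms(2), of i] symKD(4)[OF assms(1) i] symKD(4)[OF assms(1) zi] by (simp add: comp_apply)

lemma srt_eqI:
  fixes y z :: perm
  assumes z: "\<And>i. z (- i) = - z i" "\<And>i. z (z i) = i" and y: "\<And>i. y (- i) = - y i" "\<And>i. y (y i) = i"
    and on: "\<And>k. k \<in> K \<Longrightarrow> y k = z k"
    and off: "\<And>i. i \<notin> K \<Longrightarrow> - i \<notin> K \<Longrightarrow> z i \<notin> K \<Longrightarrow> - z i \<notin> K \<Longrightarrow> y i = z i"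
  shows "y = z"
proof
  fix i
  have pm: "y k = z k" if "k \<in> K \<or> - k \<in> K" for k
    using that
  proof
    assume "- k \<in> K"
    then have "y (- k) = z (- k)" by (rule on)
    then show ?thesis unfolding z(1) y(1) by simp
  qed (rule on)
  show "y i = z i"
  proof (cases "i \<in> K \<or> - i \<in> K")
    case True then show ?thesis by (rule pm)
  next
    case False
    show ?thesis
    proof (cases "z i \<in> K \<or> - z i \<in> K")
      case True
      from pm[OF this] have "y (z i) = i" using z(2) by simp
      then show ?thesis using y(2)[of "z i"] by simp
    qed (use off False in auto)
  qed
qed

lemma srt_unique:
  assumes z: "z \<in> GK K" "z' \<in> GK K" and y: "srt K y z" "srt K y z'"
  shows "z = z'"
proof -
  obtain \<sigma> \<sigma>' where s: "symK K \<sigma>" "y \<circ> \<sigma> = \<sigma> \<circ> z" and s': "symK K \<sigma>'" "y \<circ> \<sigma>' = \<sigma>' \<circ> z'"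
    using y by (auto simp: srt_def)
  have im: "z ` K = z' ` K" using srt_image(2)[OF s z(1)] srt_image(2)[OF s' z(2)] by simp
  have on: "z k = z' k" if "k \<in> K" for k
    by (rule increasing_unique[OF finite_K[OF z(1)] GK_incr[OF z(1)] GK_incr[OF z(2)] im that])
  have zG: "z \<in> G" "z' \<in> G" using z GKD by auto
  show ?thesis
  proof (rule srt_eqI[where K=K])
    fix i assume i: "i \<notin> K" "- i \<notin> K" and zi: "z' i \<notin> K" "- z' i \<notin> K"
    have n: "z i \<noteq> k" if "k \<in> K \<or> - k \<in> K" for k
    proof
      assume "z i = k"
      have "z k = z' k" using on[of k] on[of "- k"] GD(2)[OF zG(1), of k] GD(2)[OF zG(2), of k] that by auto
      moreover have "i = z k" using \<open>z i = k\<close> GD(4)[OF zG(1), of i] by simp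
      ultimately have "z' i = k" using GD(4)[OF zG(2), of k] by simp
      then show False using zi that by auto
    qed
    have "y i = z' i" by (rule srt_off[OF s' z(2) i zi])
    moreover have "y i = z i" by (rule srt_off[OF s z(1) i]) (use n in auto)
    ultimately show "z i = z' i" by simp
  qed (rule GD(2)[OF zG(2)] GD(4)[OF zG(2)] GD(2)[OF zG(1)] GD(4)[OF zG(1)] on, (assumption)?)+
qed

lemma pcol_eq: "z \<in> GK K \<Longrightarrow> srt K y z \<Longrightarrow> pcol K y = vscale (coef y z) (bv z)"
proof
  fix x assume "z \<in> GK K" "srt K y z"
  then show "pcol K y x = vscale (coef y z) (bv z) x"
    using srt_unique[of z K x y] by (cases "x = z") (auto simp: pcol_def vscale_apply bv_def)
qed

lemma pcol_0: "(\<And>z. z \<in> GK K \<Longrightarrow> \<not> srt K y z) \<Longrightarrow> pcol K y = 0"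
  by (auto simp: pcol_def fun_eq_iff vec_apply)

lemma coef_steps:
  "h y' = h y + 2 \<Longrightarrow> coef y' z = cA * coef y z"
  "h y = h y' + 2 \<Longrightarrow> coef y' z + dd * coef y z = cA * coef y z"
  "h y' = h y + 2 \<Longrightarrow> h z' = h z + 2 \<Longrightarrow> coef y' z' = coef y z"
  "coef z z = 1"
proof -
  show "h y' = h y + 2 \<Longrightarrow> coef y' z = cA * coef y z" by (simp add: coef_def mult.assoc)
  have c: "cA * lbar cA = 1" by (rule cD_bar)
  show "h y' = h y + 2 \<Longrightarrow> h z' = h z + 2 \<Longrightarrow> coef y' z' = coef y z"
  proof -
    assume "h y' = h y + 2" "h z' = h z + 2"
    then have "coef y' z' = (cA * lbar cA) * coef y z" by (simp add: coef_def ac_simps)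
    then show ?thesis using c by simp
  qed
  have "coef z z = (cA * lbar cA) ^ (h z div 2)" by (simp only: coef_def power_mult_distrib)
  then show "coef z z = 1" using c by simp
  assume l: "h y = h y' + 2"
  have e: "coef y z = cA * coef y' z" using l by (simp add: coef_def mult.assoc)
  have "cA = lbar cA + dd" using cD_bar(2) by (simp add: algebra_simps)
  then have "cA * coef y z = lbar cA * coef y z + dd * coef y z"
    by (metis distrib_right)
  also have "lbar cA * coef y z = (cA * lbar cA) * coef y' z" by (simp add: e ac_simps)
  finally show "coef y' z + dd * coef y z = cA * coef y z" using c by simp
qed

lemma full_AE': "y \<in> full.G \<Longrightarrow> s \<in> N.S \<Longrightarrow> \<not> full.AE s y"
  using full.full_AE[OF refl] by blast

lemma full_Up: "y \<in> full.G \<Longrightarrow> s \<in> N.S \<Longrightarrow> full.Up s y \<longleftrightarrow> \<not> DE s y \<and> \<not> N.LD s y"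
  using full_AE'[of y s] by (simp add: full.Up_def)
lemma full_Dn: "y \<in> full.G \<Longrightarrow> s \<in> N.S \<Longrightarrow> full.Dn s y \<longleftrightarrow> \<not> DE s y \<and> N.LD s y"
  using full_AE'[of y s] by (simp add: full.Dn_def)

text \<open>\<open>s\<close> moves only positions up to \<open>n\<close>, and \<sigma> only
  positions beyond \<open>n\<close>.\<close>

lemma symK_comm:
  assumes s: "s \<in> S" and sg: "symK K \<sigma>" and z: "z \<in> GK K"
  shows "s \<circ> \<sigma> = \<sigma> \<circ> s"
proof
  fix i
  obtain a b where ab: "(a, b) \<in> P" "s = swp a b" using s S_swp by auto
  have bds: "\<bar>s k\<bar> \<le> int n \<longleftrightarrow> \<bar>k\<bar> \<le> int n" for k unfolding ab(2) by (rule swp_bound[OF n2 ab(1)])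
  show "(s \<circ> \<sigma>) i = (\<sigma> \<circ> s) i"
  proof (cases "\<bar>i\<bar> \<le> int n")
    case True
    then show ?thesis using symK_low[OF sg z] bds by (simp add: comp_apply)
  next
    case False
    then have si: "s i = i" using S_outside[OF s] by simp
    have "\<bar>\<sigma> i\<bar> > int n"
    proof (rule ccontr)
      assume "\<not> ?thesis"
      then have "\<sigma> (\<sigma> i) = \<sigma> i" using symK_low[OF sg z] by simp
      then have "\<sigma> i = i" using symKD(1)[OF sg] by (simp add: bij_is_inj inj_eq)
      then show False using False \<open>\<not> int n < \<bar>\<sigma> i\<bar>\<close> by simp
    qed
    then show ?thesis using S_outside[OF s] si by (simp add: comp_apply)
  qed
qed

lemma DE_srt:
  assumes s: "s \<in> S" and z: "z \<in> GK K" and y: "srt K y z"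
  shows "DE s y \<longleftrightarrow> DE s z"
proof -
  obtain \<sigma> where sg: "symK K \<sigma>" "y \<circ> \<sigma> = \<sigma> \<circ> z" using y by (auto simp: srt_def)
  note c = symK_comm[OF s sg(1) z]
  have b: "bij \<sigma>" using symKD(1)[OF sg(1)] .
  have 1: "s \<circ> y \<circ> \<sigma> = \<sigma> \<circ> (s \<circ> z)" by (simp only: comp_assoc sg(2)) (simp only: comp_assoc[symmetric] c)
  have 2: "y \<circ> s \<circ> \<sigma> = \<sigma> \<circ> (z \<circ> s)" by (simp only: comp_assoc c) (simp only: comp_assoc[symmetric] sg(2))
  have i1: "\<sigma> \<circ> inv \<sigma> = id" and i2: "inv \<sigma> \<circ> \<sigma> = id"
    using b by (simp_all add: bij_def surj_iff[symmetric] inj_iff[symmetric])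
  have R: "f = g" if "f \<circ> \<sigma> = g \<circ> \<sigma>" for f g :: perm
    using arg_cong[OF that, of "\<lambda>x. x \<circ> inv \<sigma>"] by (simp only: comp_assoc i1 comp_id)
  have L: "f = g" if "\<sigma> \<circ> f = \<sigma> \<circ> g" for f g :: perm
    using arg_cong[OF that, of "\<lambda>x. inv \<sigma> \<circ> x"] by (simp only: comp_assoc[symmetric] i2 id_comp)
  have "DE s y \<longleftrightarrow> s \<circ> y \<circ> \<sigma> = y \<circ> s \<circ> \<sigma>" unfolding DE_def using R by auto
  also have "\<dots> \<longleftrightarrow> s \<circ> z = z \<circ> s" unfolding 1 2 using L by auto
  finally show ?thesis by (simp add: DE_def)
qed

lemma srt_act:
  assumes s: "s \<in> S" and z: "z \<in> GK K" and y: "srt K y z"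
  shows "srt K (act s y) (act s z)"
proof -
  obtain \<sigma> where sg: "symK K \<sigma>" "y \<circ> \<sigma> = \<sigma> \<circ> z" using y by (auto simp: srt_def)
  note c = symK_comm[OF s sg(1) z]
  have "act s y \<circ> \<sigma> = s \<circ> (y \<circ> (s \<circ> \<sigma>))" by (simp only: act_def comp_assoc)
  also have "\<dots> = s \<circ> ((y \<circ> \<sigma>) \<circ> s)" by (simp only: c comp_assoc)
  also have "\<dots> = (s \<circ> \<sigma>) \<circ> (z \<circ> s)" by (simp only: sg(2) comp_assoc)
  also have "\<dots> = \<sigma> \<circ> act s z" by (simp only: c act_def comp_assoc)
  finally show ?thesis using sg(1) by (auto simp: srt_def)
qed

lemma symK_gen:
  assumes j: "j \<in> K" "j + 1 \<in> K" "j > 0" "\<forall>k\<in>K. k > 0" and sg: "symK K \<sigma>"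
  shows "symK K (swp j (j + 1) \<circ> \<sigma>)" "symK K (\<sigma> \<circ> swp j (j + 1))"
proof -
  have P: "(j, j + 1) \<in> spair TypeA (nat j + 1)" using j by (auto simp: spair_def)
  note b = bij_comp[OF symKD(1)[OF sg] swp_bij[OF P]] bij_comp[OF swp_bij[OF P] symKD(1)[OF sg]]
  have nK: "- j \<notin> K" "- j - 1 \<notin> K"
    using bspec[OF j(4), of "- j"] bspec[OF j(4), of "- j - 1"] j(3) by auto
  have K: "swp j (j + 1) k \<in> K" if "k \<in> K" for k
    using that j nK by (auto simp: swp_def)
  have fixk: "swp j (j + 1) i = i" if i: "i \<notin> K" "- i \<notin> K" for i
  proof -
    have "i \<noteq> j" "i \<noteq> j + 1" using i j by auto
    moreover have "i \<noteq> - j" "i \<noteq> - (j + 1)" using i(2) j(1,2) by (metis minus_minus)+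
    ultimately show ?thesis by (simp add: swp_def)
  qed
  show "symK K (swp j (j + 1) \<circ> \<sigma>)" "symK K (\<sigma> \<circ> swp j (j + 1))"
    using b symKD(2-4)[OF sg] K fixk by (auto simp: symK_def comp_apply swp_odd[OF P])
qed

lemma AE_K:
  assumes z: "z \<in> GK K" and s: "s \<in> S" and A: "AE s z"
  obtains j where "j \<in> K" "j + 1 \<in> K" "z \<circ> s \<circ> z = swp j (j + 1)" "int n < j" "z j < z (j + 1)"
proof -
  obtain a b where ab: "(a, b) \<in> P" "s = swp a b" using s S_swp by auto
  note bd = spair_bound[OF n2 ab(1)]
  have zG: "z \<in> G" using z GKD by blast
  obtain j where j: "int n < j" "z \<circ> s \<circ> z = sgen j" using A by (auto simp: AE_def)
  have e: "swp (z a) (z b) = swp j (j + 1)" using j G_swp[OF zG, of a b] bd sgen_swp(1)[of j] n2 ab(2) by auto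
  have "aeq (z a) (z b)" using AE_iff[OF ab(1) zG] A ab(2) by simp
  then have q: "z b = z a + 1" "\<bar>z a\<bar> > int n" "\<bar>z b\<bar> > int n" by (auto simp: aeq_def)
  have "z b = swp j (j + 1) (z a)" using e by (metis swp_ab(1))
  then have c: "z a = j \<and> z b = j + 1 \<or> z b = - j \<and> z a = - (j + 1)"
    using q by (auto simp: swp_def split: if_splits)
  have "\<bar>z a\<bar> \<le> int N" "\<bar>z b\<bar> \<le> int N" using GD(7)[OF zG, of a] GD(7)[OF zG, of b] bd nN by auto
  then have N: "j \<le> int N" "j + 1 \<le> int N" using c by auto
  have v: "z j = a \<and> z (j + 1) = b \<or> z j = - b \<and> z (j + 1) = - a"
    using c GD(2,4)[OF zG] by (metis minus_minus)
  then have "j \<in> Kz z" "j + 1 \<in> Kz z" using j(1) N bd by (auto simp: Kz_def)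
  then show ?thesis using that j(2) sgen_swp(1)[of j] j(1) v bd GKD(2)[OF z] by auto
qed

text \<open>From \<open>z s z = s_j\<close> follows \<open>s z = z s_j\<close>, hence
  \<open>s z s = s_j z s_j\<close>. A loop of the small module is thus, in the full class, a
  rearrangement within \<open>K\<close>, which sorting undoes.\<close>

lemma act_AE:
  assumes z: "z \<in> GK K" and s: "s \<in> S" and A: "AE s z" and e: "z \<circ> s \<circ> z = swp j (j + 1)" and j: "int n < j"
  shows "act s z = act (swp j (j + 1)) z"
proof -
  let ?r = "swp j (j + 1)"
  have zG: "z \<in> G" using z GKD by blast
  have zz: "z \<circ> z = id" by (auto simp: fun_eq_iff comp_apply GD(4)[OF zG])
  have comm: "s \<circ> ?r = ?r \<circ> s"
    using S_comp_swp[OF s, of j "j + 1"] S_outside[OF s] j by simp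
  have sz: "s \<circ> z = z \<circ> ?r" unfolding e[symmetric] by (simp only: comp_assoc[symmetric] zz id_comp)
  have zs: "z \<circ> s = ?r \<circ> z" unfolding e[symmetric] by (simp only: comp_assoc zz comp_id)
  have "act s z = s \<circ> (?r \<circ> z)" by (simp only: act_def comp_assoc zs)
  also have "\<dots> = ?r \<circ> (s \<circ> z)" by (simp only: comm comp_assoc[symmetric])
  also have "\<dots> = act ?r z" by (simp only: sz act_def comp_assoc)
  finally show ?thesis .
qed

lemma srt_gen_right:
  assumes "srt K y z" and j: "j \<in> K" "j + 1 \<in> K" "j > 0" "\<forall>k\<in>K. k > 0"
  shows "srt K y (act (swp j (j + 1)) z)" "srt K (act (swp j (j + 1)) y) z"
proof -
  let ?r = "swp j (j + 1)"
  have P: "(j, j + 1) \<in> spair TypeA (nat j + 1)" using j by (auto simp: spair_def)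
  have rr: "?r \<circ> ?r = id" by (rule swp_comp[OF P])
  have rr': "?r \<circ> (?r \<circ> f) = f" for f by (simp only: comp_assoc[symmetric] rr id_comp)
  obtain \<sigma> where sg: "symK K \<sigma>" "y \<circ> \<sigma> = \<sigma> \<circ> z" using assms by (auto simp: srt_def)
  have "y \<circ> (\<sigma> \<circ> ?r) = (\<sigma> \<circ> ?r) \<circ> act ?r z"
    by (simp only: comp_assoc[symmetric] sg(2)) (simp only: act_def comp_assoc rr')
  then show "srt K y (act ?r z)" using symK_gen(2)[OF j sg(1)] by (auto simp: srt_def)
  have "act ?r y \<circ> (?r \<circ> \<sigma>) = (?r \<circ> \<sigma>) \<circ> z"
    by (simp only: act_def comp_assoc rr' sg(2))
  then show "srt K (act ?r y) z" using symK_gen(1)[OF j sg(1)] by (auto simp: srt_def)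
qed

lemma Kz_act:
  assumes s: "s \<in> S" shows "Kz (act s z) = Kz z"
proof -
  obtain a b where ab: "(a, b) \<in> P" "s = swp a b" using s S_swp by auto
  have bds: "\<bar>s k\<bar> \<le> int n \<longleftrightarrow> \<bar>k\<bar> \<le> int n" for k unfolding ab(2) by (rule swp_bound[OF n2 ab(1)])
  show ?thesis using S_outside[OF s] bds by (auto simp: Kz_def act_apply)
qed

lemma act_GK: "s \<in> S \<Longrightarrow> z \<in> GK K \<Longrightarrow> \<not> DE s z \<Longrightarrow> \<not> AE s z \<Longrightarrow> act s z \<in> GK K"
  using act_G Kz_act by (auto simp: GK_def)

lemma srt_act_AE:
  assumes z: "z \<in> GK K" and s: "s \<in> S" and A: "AE s z" and y: "srt K y z"
  shows "srt K (act s y) z"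
proof -
  obtain j where j: "j \<in> K" "j + 1 \<in> K" "z \<circ> s \<circ> z = swp j (j + 1)" "int n < j" by (rule AE_K[OF z s A])
  let ?r = "swp j (j + 1)"
  have j0: "j > 0" using j(4) n2 by simp
  have "srt K (act s y) (act ?r z)" using srt_act[OF s z y] act_AE[OF z s A j(3,4)] by simp
  from srt_gen_right(1)[OF this j(1,2) j0 K_pos[OF z]] show ?thesis
  proof -
    have P: "(j, j + 1) \<in> spair TypeA (nat j + 1)" using j0 by (auto simp: spair_def)
    have "act ?r (act ?r z) = z" by (auto simp: fun_eq_iff act_apply swp_swp[OF P])
    then show "srt K (act s y) (act ?r (act ?r z)) \<Longrightarrow> ?thesis" by simp
  qed
qed

lemma srt_act_ex:
  assumes s: "s \<in> S" and z: "z \<in> GK K" and y: "srt K y z"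
  shows "\<exists>z'\<in>GK K. srt K (act s y) z'"
proof -
  consider "DE s z" | "AE s z" | "\<not> DE s z" "\<not> AE s z" by blast
  then show ?thesis
  proof cases
    case 1
    then have "act s y = y" using DE_srt[OF s z y] S_S[OF s] unfolding DE_def act_def
      by (metis comp_assoc comp_id)
    then show ?thesis using z y by auto
  next
    case 2 then show ?thesis using srt_act_AE[OF z s 2 y] z by blast
  next
    case 3 then show ?thesis using srt_act[OF s z y] act_GK[OF s z 3] by blast
  qed
qed

text \<open>\<open>z\<close> increases on the interval \<open>Kz z\<close>, so
  \<open>z a < z b\<close>. A position strictly between them would carry a value strictly between
  \<open>a\<close> and \<open>b\<close>, which \<open>spair_gap\<close> rules out.\<close>

lemma both_big:
  assumes ab: "(a, b) \<in> P" and z: "z \<in> G" and p: "z a > int n" "z b > int n"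
  shows "aeq (z a) (z b)"
proof -
  have bd: "\<bar>a\<bar> \<le> int n" "\<bar>b\<bar> \<le> int n" "a < b" "b \<le> int n" "a \<noteq> 0" "b > 0"
    using spair_bound[OF n2 ab] by auto
  have v: "z (z a) = a" "z (z b) = b" using GD(4)[OF z] by auto
  have lt: "z a < z b"
  proof (rule ccontr)
    assume "\<not> z a < z b"
    then have "z b < z a" using P_G(3)[OF ab z] by simp
    then show False using Kz_incr[OF z p(2), of "z a"] v bd by simp
  qed
  have "z b = z a + 1"
  proof (rule ccontr)
    assume "z b \<noteq> z a + 1"
    then have m: "z a < z a + 1" "z a + 1 < z b" using lt by auto
    have zm: "\<bar>z (z a + 1)\<bar> \<le> int n" using Kz_convex[OF z, of "z b" "z a + 1"] v bd p m by auto
    have 1: "a < z (z a + 1)" using Kz_incr[OF z p(1) m(1) zm] v by simp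
    have 2: "z (z a + 1) < b" using Kz_incr[OF z _ m(2)] v p bd by simp
    have nz: "z (z a + 1) \<noteq> 0" using GD(6)[OF z] p n2 by auto
    have na: "z (z a + 1) \<noteq> - a"
      using GD(5)[OF z, of "z a + 1" "- z a"] GD(2)[OF z, of "z a"] v(1) p n2 by auto
    show False by (rule spair_gap[OF ab 1 2 nz na])
  qed
  then show ?thesis using p by (auto simp: aeq_def)
qed

lemma both_small:
  assumes ab: "(a, b) \<in> P" and z: "z \<in> G" and p: "z a < - int n" "z b < - int n"
  shows "aeq (z a) (z b)"
proof -
  have bd: "\<bar>a\<bar> \<le> int n" "\<bar>b\<bar> \<le> int n" "a < b" "b \<le> int n" "a \<noteq> 0" "b > 0"
    using spair_bound[OF n2 ab] by auto
  let ?p = "- z a" and ?q = "- z b"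
  have v: "z ?p = - a" "z ?q = - b" using GD(2,4)[OF z] by auto
  have lt: "?q < ?p"
  proof (rule ccontr)
    assume "\<not> ?q < ?p"
    then have "?p < ?q" using P_G(3)[OF ab z] by simp
    moreover have "int n < ?p" using p by simp
    ultimately show False using Kz_incr[OF z, of ?p ?q] v bd by simp
  qed
  have "?p = ?q + 1"
  proof (rule ccontr)
    assume "?p \<noteq> ?q + 1"
    then have m: "?q < ?q + 1" "?q + 1 < ?p" using lt by auto
    have pq: "int n < ?q" "int n < ?q + 1" using p by auto
    have zm: "\<bar>z (?q + 1)\<bar> \<le> int n" using Kz_convex[OF z, of ?p "?q + 1"] v bd pq m by auto
    have 1: "- b < z (?q + 1)" using Kz_incr[OF z pq(1) m(1) zm] v by simp
    have 2: "z (?q + 1) < - a" using Kz_incr[OF z pq(2) m(2)] v bd by simp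
    have nz: "z (?q + 1) \<noteq> 0" using GD(6)[OF z, of "?q + 1"] p n2 by auto
    have na: "z (?q + 1) \<noteq> a"
      using GD(9)[OF z, of "?q + 1" a] p by auto
    show False by (rule spair_gap[OF ab, of "- z (?q + 1)"]) (use 1 2 nz na in auto)
  qed
  then show ?thesis using p by (auto simp: aeq_def)
qed

text \<open>Passing from \<open>z\<close> to \<open>y\<close> keeps the values within
  \<open>[-n, n]\<close> and moves the others only on their own side of this interval. The order of
  the values at \<open>a\<close> and \<open>b\<close> could change only if both lie beyond
  \<open>n\<close> on one side, and this is the case \<open>AE\<close>.\<close>

lemma LD_srt:
  assumes s: "s \<in> S" and z: "z \<in> GK K" and yG: "y \<in> full.G" and y: "srt K y z" and ne: "\<not> DE s z" "\<not> AE s z"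
  shows "N.LD s y \<longleftrightarrow> N.LD s z"
proof -
  obtain a b where ab: "(a, b) \<in> P" "s = swp a b" using s S_swp by auto
  note bd = spair_bound[OF n2 ab(1)]
  obtain \<sigma> where sg: "symK K \<sigma>" "y \<circ> \<sigma> = \<sigma> \<circ> z" using y by (auto simp: srt_def)
  have zG: "z \<in> G" using z GKD by blast
  have y1: "y a = \<sigma> (z a)" "y b = \<sigma> (z b)"
    using fun_cong[OF sg(2), of a] fun_cong[OF sg(2), of b] symK_low[OF sg(1) z, of a] symK_low[OF sg(1) z, of b] bd
    by (auto simp: comp_apply)
  have nae: "\<not> aeq (z a) (z b)" using AE_iff[OF ab(1) zG] ne ab(2) by simp
  have val: "(\<bar>z c\<bar> \<le> int n \<longrightarrow> \<sigma> (z c) = z c) \<and> (z c > int n \<longrightarrow> \<sigma> (z c) > int n) \<and> (z c < - int n \<longrightarrow> \<sigma> (z c) < - int n)"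
    if c: "\<bar>c\<bar> \<le> int n" for c
  proof (intro conjI impI)
    have cN: "\<bar>z c\<bar> \<le> int N" using GD(7)[OF zG, of c] c nN by auto
    show "\<sigma> (z c) = z c" if "\<bar>z c\<bar> \<le> int n" by (rule symK_low[OF sg(1) z that])
    { assume "z c > int n"
      then have "z c \<in> K" using GKD(2)[OF z] cN c GD(4)[OF zG, of c] by (auto simp: Kz_def)
      then show "\<sigma> (z c) > int n" using symKD(3)[OF sg(1)] K_range[OF z] by blast }
    { assume "z c < - int n"
      then have "- z c \<in> K" using GKD(2)[OF z] cN c GD(2,4)[OF zG] by (auto simp: Kz_def)
      then have "\<sigma> (- z c) > int n" using symKD(3)[OF sg(1)] K_range[OF z] by blast
      then show "\<sigma> (z c) < - int n" using symKD(2)[OF sg(1), of "z c"] by simp }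
  qed
  have "y a < y b \<longleftrightarrow> z a < z b"
    unfolding y1
    by (rule order_outside[of "int n"])
      (use val[of a] val[of b] both_big[OF ab(1) zG] both_small[OF ab(1) zG] nae bd in auto)
  moreover have "y a \<noteq> y b" using full.GD(5)[OF yG, of a b] bd by auto
  moreover have "N.LD s y \<longleftrightarrow> y a > y b" unfolding ab(2) by (rule full.LD_iff_G[OF P_N[OF ab(1)] yG])
  moreover have "N.LD s z \<longleftrightarrow> z a > z b" unfolding ab(2) by (rule LD_iff_G[OF ab(1) zG])
  ultimately show ?thesis using P_G(3)[OF ab(1) zG] by auto
qed

text \<open>Conjugation by \<open>s\<close> commutes with sorting. The two modules differ only where
  \<open>s\<close> loops by \<open>AE\<close> at the sorted element although it moves
  \<open>y\<close>; there the powers of \<open>cA\<close> in \<open>coef\<close> produce the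
  scalar.\<close>

lemma proj_T_bv:
  assumes s: "s \<in> S" and y: "y \<in> full.G"
  shows "proj K (full.T s (bv y)) = T s (proj K (bv y))"
proof -
  note sf = S_full[OF s]
  note pl = slinD[OF proj_lin[of K]]
  have Tf: "full.Up s y \<Longrightarrow> proj K (full.T s (bv y)) = pcol K (act s y)"
    "full.Dn s y \<Longrightarrow> proj K (full.T s (bv y)) = pcol K (act s y) + vscale dd (pcol K y)"
    using full.up[OF sf y] full.dn[OF sf y] y
    by (auto simp: full.T_up full.T_dn[OF sf] pl proj_bv)
  have st: "full.Up s y \<or> full.Dn s y \<or> DE s y" using full_Up[OF y sf] full_Dn[OF y sf] by blast
  have TD: "full.T s (bv y) = vscale cD (bv y)" if "DE s y"
    using full.T_DE[OF y] that full_AE'[OF y sf] by simp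
  have ha: "full.Up s y \<Longrightarrow> h (act s y) = h y + 2" "full.Dn s y \<Longrightarrow> h y = h (act s y) + 2"
    using full.up[OF sf y] full.dn_h[OF sf y] by auto
  show ?thesis
  proof (cases "\<exists>z\<in>GK K. srt K y z")
    case True
    then obtain z where z: "z \<in> GK K" "srt K y z" by blast
    have zG: "z \<in> G" using z GKD by blast
    have bz: "bv z \<in> fspace G" using zG by simp
    have py: "pcol K y = vscale (coef y z) (bv z)" by (rule pcol_eq[OF z])
    have R: "T s (proj K (bv y)) = vscale (coef y z) (T s (bv z))"
      using T_vscale[OF s bz] by (simp add: proj_bv y py)
    consider "AE s z" "\<not> DE s z" | "DE s z" "\<not> AE s z" | "Up s z" | "Dn s z" | "AE s z" "DE s z"
      using not_Dn by blast
    then show ?thesis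
    proof cases
      \<comment> \<open>In the full class \<open>s\<close> may be an ascent or a descent of
        \<open>y\<close>; \<open>coef_steps\<close> gives the factor \<open>cA\<close> both
        ways.\<close>
      case 1
      have pa: "pcol K (act s y) = vscale (coef (act s y) z) (bv z)"
        by (rule pcol_eq[OF z(1) srt_act_AE[OF z(1) s 1(1) z(2)]])
      have "\<not> DE s y" using DE_srt[OF s z] 1 by simp
      with st have "full.Up s y \<or> full.Dn s y" by blast
      then show ?thesis unfolding R T_AE[OF zG 1(1)]
        using Tf ha coef_steps(1)[of "act s y" y z] coef_steps(2)[of y "act s y" z]
        by (auto simp: pa py vscale_simps(5) mult.commute simp flip: vscale_simps(3))
    next
      case 2
      then have d: "DE s y" using DE_srt[OF s z] by simp
      show ?thesis unfolding R TD[OF d] T_DE[OF zG 2]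
        using y by (simp add: pl proj_bv py vscale_simps(5) mult.commute)
    next
      case 3
      then have ne: "\<not> DE s z" "\<not> AE s z" by (auto simp: Up_def)
      have ny: "full.Up s y" using full_Up[OF y sf] LD_srt[OF s z(1) y z(2) ne] DE_srt[OF s z] 3 by (auto simp: Up_def)
      have pa: "pcol K (act s y) = vscale (coef (act s y) (act s z)) (bv (act s z))"
        by (rule pcol_eq[OF act_GK[OF s z(1) ne] srt_act[OF s z]])
      have "coef (act s y) (act s z) = coef y z"
        using coef_steps(3) ha(1)[OF ny] up[OF s zG 3] by simp
      then show ?thesis unfolding R Tf(1)[OF ny] T_up[OF zG 3] pa by simp
    next
      case 4
      then have ne: "\<not> DE s z" "\<not> AE s z" by (auto simp: Dn_def)
      have ny: "full.Dn s y" using full_Dn[OF y sf] LD_srt[OF s z(1) y z(2) ne] DE_srt[OF s z] 4 by (auto simp: Dn_def)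
      have pa: "pcol K (act s y) = vscale (coef (act s y) (act s z)) (bv (act s z))"
        by (rule pcol_eq[OF act_GK[OF s z(1) ne] srt_act[OF s z]])
      have "coef y z = coef (act s y) (act s z)"
        using coef_steps(3) ha(2)[OF ny] dn_h[OF s zG 4] by simp
      then show ?thesis unfolding R Tf(2)[OF ny] T_dn[OF s zG 4] pa py
        by (simp add: vscale_simps(1,5) mult.commute)
    next
      case 5
      obtain a b where ab: "(a, b) \<in> P" "s = swp a b" using s S_swp by auto
      have False using 5 AE_iff[OF ab(1) zG] DE_iff[OF ab(1) zG] ab(2) spair_bound[OF n2 ab(1)] by (auto simp: aeq_def)
      then show ?thesis ..
    qed
  next
    case False
    then have py: "pcol K y = 0" by (intro pcol_0) blast
    have pa: "pcol K (act s y) = 0"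
    proof (rule pcol_0, rule notI)
      fix z assume "z \<in> GK K" "srt K (act s y) z"
      from srt_act_ex[OF s this] show False using False act_act[OF s] by simp
    qed
    have "T s 0 = 0" by (rule slin_zero[OF T_lin[OF s]])
    then show ?thesis
      using st Tf TD y by (auto simp: pa py proj_bv pl vscale_simps)
  qed
qed

lemma proj_T: assumes s: "s \<in> S" and v: "v \<in> fspace full.G" shows "proj K (full.T s v) = T s (proj K v)"
  using slin_eqI[OF full.finite_G slin_comp[OF full.T_lin[OF S_full[OF s]] proj_lin] slin_comp[OF proj_lin T_lin[OF s]] proj_T_bv[OF s] v]
  by simp

lemma proj_Ti: assumes s: "s \<in> S" and v: "v \<in> fspace full.G" shows "proj K (full.Ti s v) = Ti s (proj K v)"
  using v full.T_closed[OF S_full[OF s] v]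
  by (simp add: full.Ti_def Ti_def slin_minus[OF proj_lin] slinD(3)[OF proj_lin] proj_T[OF s v])

text \<open>Conjugation by \<open>s_j\<close> rearranges values within \<open>K\<close> and leaves
  the sorted element unchanged, so only \<open>coef\<close> varies. This is what factoring out
  \<open>H_j = cA\<close> amounts to.\<close>

lemma proj_gen_bv:
  assumes j: "j \<in> K" "j + 1 \<in> K" and z0: "z0 \<in> GK K" and y: "y \<in> full.G"
  shows "proj K (full.T (swp j (j + 1)) (bv y)) = vscale cA (proj K (bv y))"
proof -
  let ?r = "swp j (j + 1)"
  have jj: "int n < j" "j + 1 \<le> int N" using K_range[OF z0 j(1)] K_range[OF z0 j(2)] by auto
  have j0: "j > 0" using jj n2 by simp
  have P: "(j, j + 1) \<in> spair t N" using jj j0 by (auto simp: spair_def)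
  have r: "?r \<in> N.S" using P N.S_swp by blast
  note pl = slinD[OF proj_lin[of K]]
  have Tf: "full.Up ?r y \<Longrightarrow> proj K (full.T ?r (bv y)) = pcol K (act ?r y)"
    "full.Dn ?r y \<Longrightarrow> proj K (full.T ?r (bv y)) = pcol K (act ?r y) + vscale dd (pcol K y)"
    using full.up[OF r y] full.dn[OF r y] y
    by (auto simp: full.T_up full.T_dn[OF r] pl proj_bv)
  have TD: "full.T ?r (bv y) = vscale cD (bv y)" if "DE ?r y"
    using full.T_DE[OF y] that full_AE'[OF y r] by simp
  have st: "full.Up ?r y \<or> full.Dn ?r y \<or> DE ?r y" using full_Up[OF y r] full_Dn[OF y r] by blast
  have ha: "full.Up ?r y \<Longrightarrow> h (act ?r y) = h y + 2" "full.Dn ?r y \<Longrightarrow> h y = h (act ?r y) + 2"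
    using full.up[OF r y] full.dn_h[OF r y] by auto
  show ?thesis
  proof (cases "\<exists>z\<in>GK K. srt K y z")
    case True
    then obtain z where z: "z \<in> GK K" "srt K y z" by blast
    obtain \<sigma> where sg: "symK K \<sigma>" "y \<circ> \<sigma> = \<sigma> \<circ> z" using z(2) by (auto simp: srt_def)
    have "y j \<in> z ` K" using srt_image(2)[OF sg z(1)] j by blast
    then have "\<bar>y j\<bar> \<le> int n" using K_range[OF z(1)] by auto
    then have "\<not> DE ?r y" using full.DE_iff[OF P y] jj by auto
    with st have ud: "full.Up ?r y \<or> full.Dn ?r y" by blast
    have pa: "pcol K (act ?r y) = vscale (coef (act ?r y) z) (bv z)"
      by (rule pcol_eq[OF z(1) srt_gen_right(2)[OF z(2) j j0 K_pos[OF z0]]])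
    have py: "pcol K y = vscale (coef y z) (bv z)" by (rule pcol_eq[OF z])
    show ?thesis
      using ud Tf ha coef_steps(1)[of "act ?r y" y z] coef_steps(2)[of y "act ?r y" z] y
      by (auto simp: proj_bv pa py vscale_simps(5) simp flip: vscale_simps(3))
  next
    case False
    then have py: "pcol K y = 0" by (intro pcol_0) blast
    have "act ?r (act ?r y) = y" by (auto simp: fun_eq_iff act_apply swp_swp[OF P])
    then have pa: "pcol K (act ?r y) = 0"
      using srt_gen_right(2)[of K "act ?r y" _ j, OF _ j j0 K_pos[OF z0]] False by (intro pcol_0 notI) auto
    show ?thesis
      using st Tf TD y by (auto simp: pa py proj_bv pl vscale_simps)
  qed
qed

lemma proj_gen_Ti:
  assumes j: "j \<in> K" "j + 1 \<in> K" and z0: "z0 \<in> GK K" and r: "swp j (j + 1) \<in> N.S" and v: "v \<in> fspace full.G"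
  shows "proj K (full.Ti (swp j (j + 1)) v) = vscale (lbar cA) (proj K v)"
proof -
  have "proj K (full.T (swp j (j + 1)) v) = vscale cA (proj K v)"
    using slin_eqI[OF full.finite_G slin_comp[OF full.T_lin[OF r] proj_lin] slin_scale[OF proj_lin] proj_gen_bv[OF j z0] v] by simp
  then show ?thesis
    using v full.T_closed[OF r v]
    by (simp add: full.Ti_def slin_minus[OF proj_lin] slinD(3)[OF proj_lin] cD_bar(2)[symmetric] vscale_simps)
qed

text \<open>Bubble sort: a descent of \<open>y\<close> between neighbours in \<open>K\<close> is
  removed by a conjugation that lowers the height by 2 and keeps the sorted element. Without such
  descents \<open>y\<close> is already sorted.\<close>

lemma srt_height:
  assumes z: "z \<in> GK K" shows "y \<in> full.G \<Longrightarrow> srt K y z \<Longrightarrow> h z \<le> h y"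
proof (induction "h y" arbitrary: y rule: less_induct)
  case less
  have zG: "z \<in> G" using z GKD by blast
  obtain \<sigma> where sg: "symK K \<sigma>" "y \<circ> \<sigma> = \<sigma> \<circ> z" using less.prems(2) by (auto simp: srt_def)
  have yK: "\<bar>y k\<bar> \<le> int n" if "k \<in> K" for k
  proof -
    have "y k \<in> z ` K" using srt_image(2)[OF sg z] that by blast
    then show ?thesis using K_range[OF z] by auto
  qed
  show ?case
  proof (cases "\<exists>j. j \<in> K \<and> j + 1 \<in> K \<and> y j > y (j + 1)")
    case True
    then obtain j where j: "j \<in> K" "j + 1 \<in> K" "y j > y (j + 1)" by blast
    let ?r = "swp j (j + 1)"
    have jj: "int n < j" "j + 1 \<le> int N" using K_range[OF z j(1)] K_range[OF z j(2)] by auto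
    have j0: "j > 0" using jj n2 by simp
    have P: "(j, j + 1) \<in> spair t N" using jj j0 by (auto simp: spair_def)
    have r: "?r \<in> N.S" using P N.S_swp by blast
    have d: "full.Dn ?r y" using full.Dn_iff[OF P less.prems(1)] j(3) yK[OF j(1)] jj by auto
    have "h z \<le> h (act ?r y)"
      using less.hyps[of "act ?r y"] full.dn[OF r less.prems(1) d] full.dn_h[OF r less.prems(1) d]
        srt_gen_right(2)[OF less.prems(2) j(1,2) j0 K_pos[OF z]] by simp
    then show ?thesis using full.dn_h[OF r less.prems(1) d] by simp
  next
    case False
    have conv: "i \<in> K" if "j \<in> K" "int n < i" "i \<le> j" for i j
      using Kz_convex[OF zG, of j i] K_range[OF z that(1)] that GKD(2)[OF z] by (auto simp: Kz_def)
    have inc: "y i < y j" if "i \<in> K" "j \<in> K" "i < j" for i j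
    proof -
      have "i + 1 \<le> j" using that by simp
      then show ?thesis using that(2)
      proof (induction j rule: int_ge_induct)
        case base
        then show ?case using False that(1) full.GD(5)[OF less.prems(1), of i "i + 1"] by force
      next
        case (step j)
        have jK: "j \<in> K" by (rule conv[OF step.prems]) (use step K_range[OF z that(1)] in auto)
        have "y j < y (j + 1)" using False jK step.prems full.GD(5)[OF less.prems(1), of j "j + 1"] by force
        then show ?case using step.IH[OF jK] by simp
      qed
    qed
    have on: "y k = z k" if "k \<in> K" for k
      by (rule increasing_unique[OF finite_K[OF z] inc GK_incr[OF z] srt_image(2)[OF sg z] that])
    have "y = z"
      by (rule srt_eqI[where K=K])
        (use on srt_off[OF sg z] GD(2,4)[OF zG] full.GD(2,4)[OF less.prems(1)] in auto)
    then show ?thesis by simp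
  qed
qed

theorem bar_exists:
  "\<exists>\<beta>. slin lbar G G \<beta> \<and> (\<forall>s\<in>S. \<forall>z\<in>G. \<beta> (T s (bv z)) = Ti s (\<beta> (bv z))) \<and>
    (\<forall>z\<in>G. minimal z \<longrightarrow> \<beta> (bv z) = bv z)"
proof -
  obtain \<gamma> where g: "slin lbar full.G full.G \<gamma>"
    "\<And>s z. s \<in> N.S \<Longrightarrow> z \<in> full.G \<Longrightarrow> \<gamma> (full.T s (bv z)) = full.Ti s (\<gamma> (bv z))"
    "\<And>z. z \<in> full.G \<Longrightarrow> full.minimal z \<Longrightarrow> \<gamma> (bv z) = bv z"
    using full.full_bar[OF refl] by blast
  interpret fb: bar_graph full.G N.S full.act full.Up full.Dn full.lc h \<gamma>
    by unfold_locales (use g in \<open>auto simp: full.T'_Ti full.minimal_def\<close>)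
  \<comment> \<open>The large bar operator is applied first and its value sorted; \<open>z\<close>
    is sorted already, so this descends the operator to \<open>bv z\<close>.\<close>
  define B where "B z = proj (Kz z) (\<gamma> (bv z))" for z
  define \<beta> where "\<beta> = slin_ext lbar G B"
  have gz: "\<gamma> (bv z) \<in> fspace full.G" if "z \<in> G" for z using slinD(1)[OF g(1)] G_full[OF that] by simp
  have BG: "B z \<in> fspace G" if "z \<in> G" for z unfolding B_def by (rule slinD(1)[OF proj_lin gz[OF that]])
  have sl: "slin lbar G G \<beta>" unfolding \<beta>_def by (rule slin_slin_ext[OF ringhom_lbar BG])
  have bb: "\<beta> (bv z) = B z" if "z \<in> G" for z
    unfolding \<beta>_def by (rule slin_ext_bv[OF ringhom_lbar finite_G that])
  have key: "proj (Kz z) (\<gamma> (full.T s (bv z))) = Ti s (B z)" if "s \<in> S" "z \<in> G" for s z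
    using g(2)[OF S_full[OF that(1)] G_full[OF that(2)]] proj_Ti[OF that(1) gz[OF that(2)]] by (simp add: B_def)
  have BUp: "B (act s z) = Ti s (B z)" if s: "s \<in> S" and z: "z \<in> G" and U: "Up s z" for s z
  proof -
    have "full.Up s z" using U full_Up[OF G_full[OF z] S_full[OF s]] by (auto simp: Up_def)
    then have "full.T s (bv z) = bv (act s z)" using full.T_up G_full[OF z] by simp
    then show ?thesis using key[OF s z] by (simp add: B_def Kz_act[OF s])
  qed
  have "\<beta> (T s (bv z)) = Ti s (\<beta> (bv z))" if s: "s \<in> S" and z: "z \<in> G" for s z
  proof -
    have zf: "z \<in> full.G" by (rule G_full[OF z])
    have zK: "z \<in> GK (Kz z)" using z by (simp add: GK_def)
    consider "Up s z" | "Dn s z" | "DE s z" "\<not> AE s z" | "AE s z" using not_Dn by blast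
    then show ?thesis
    proof cases
      case 1
      then show ?thesis using up[OF s z 1] BUp[OF s z 1] by (simp add: T_up[OF z 1] bb z)
    next
      case 2
      note d = dn[OF s z 2]
      have Bz: "B z = Ti s (B (act s z))" using BUp[OF s, of "act s z"] d by auto
      have "\<beta> (T s (bv z)) = B (act s z) - vscale dd (B z)"
        using d z by (simp add: T_dn[OF s z 2] slinD(2,3)[OF sl] bb ringhomD) (simp add: fun_eq_iff vec_apply algebra_simps)
      also have "\<dots> = Ti s (B z)"
        unfolding Ti_def[of s "B z"] using Bz T_Ti[OF s BG[of "act s z"]] d by simp
      finally show ?thesis by (simp add: bb z)
    next
      case 3
      have "full.T s (bv z) = vscale cD (bv z)"
        using full.T_DE[OF zf] 3 full_AE'[OF zf S_full[OF s]] by simp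
      then have "Ti s (B z) = vscale (lbar cD) (B z)"
        using key[OF s z] slinD(3)[OF g(1), of "bv z"] slinD(3)[OF proj_lin gz[OF z]] zf by (simp add: B_def)
      then show ?thesis using z by (simp add: T_DE[OF z 3] slinD(3)[OF sl] bb)
    next
      case 4
      obtain j where j: "j \<in> Kz z" "j + 1 \<in> Kz z" "z \<circ> s \<circ> z = swp j (j + 1)" "int n < j" "z j < z (j + 1)"
        by (rule AE_K[OF zK s 4])
      let ?r = "swp j (j + 1)"
      have jj: "j + 1 \<le> int N" "\<bar>z j\<bar> \<le> int n" "\<bar>z (j + 1)\<bar> \<le> int n" using j by (auto simp: Kz_def)
      have P: "(j, j + 1) \<in> spair t N" using jj j n2 by (auto simp: spair_def)
      have r: "?r \<in> N.S" using P N.S_swp by blast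
      obtain a b where ab: "(a, b) \<in> P" "s = swp a b" using s S_swp by auto
      have ae: "aeq (z a) (z b)" using AE_iff[OF ab(1) z] 4 ab(2) by simp
      have nd: "\<not> DE s z" using DE_iff[OF ab(1) z] ae spair_bound[OF n2 ab(1)] ab(2) by (auto simp: aeq_def)
      have "\<not> N.LD s z" using LD_iff_G[OF ab(1) z] ae ab(2) by (auto simp: aeq_def)
      then have "full.Up s z" using full_Up[OF zf S_full[OF s]] nd by simp
      moreover have "full.Up ?r z" using full.Up_iff[OF P zf] j jj by (auto simp: full.aeq_def)
      \<comment> \<open>This identity trades the generator \<open>s\<close> for \<open>s_j\<close>,
        on which the projection acts by \<open>lbar cA\<close>.\<close>
      ultimately have "full.T s (bv z) = full.T ?r (bv z)"
        using full.T_up[OF zf] act_AE[OF zK s 4 j(3,4)] by simp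
      then have "Ti s (B z) = proj (Kz z) (full.Ti ?r (\<gamma> (bv z)))"
        using key[OF s z] g(2)[OF r zf] by simp
      also have "\<dots> = vscale (lbar cA) (B z)"
        unfolding B_def by (rule proj_gen_Ti[OF j(1,2) zK r gz[OF z]])
      finally show ?thesis using z by (simp add: T_AE[OF z 4] slinD(3)[OF sl] bb)
    qed
  qed
  moreover have "\<beta> (bv z) = bv z" if z: "z \<in> G" and m: "minimal z" for z
  proof -
    let ?K = "Kz z"
    have zf: "z \<in> full.G" by (rule G_full[OF z])
    have zK: "z \<in> GK ?K" using z by (simp add: GK_def)
    define u where "u = \<gamma> (bv z) - bv z"
    have uf: "u \<in> fspace {y \<in> full.G. h y < h z}" unfolding u_def by (rule fb.bar_triangular[OF zf])
    have upx: "h (act s x) = h x + 2" if "s \<in> S" "x \<in> G" "Up s x" for s x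
      using up[OF that] by simp
    \<comment> \<open>Descents preserve \<open>Kz\<close> and end at a minimal element, which can
      only be \<open>z\<close>. So \<open>z\<close> has the least height for its \<open>K\<close>,
      and the lower terms \<open>u\<close> of the large bar operator at \<open>z\<close> project to
      0 by \<open>srt_height\<close>.\<close>
    have low: "Kz x = ?K \<longrightarrow> h z \<le> h x" if "x \<in> G" for x
      using that
    proof (induction x rule: height_induct[where R=S])
      case (min x)
      then show ?case using minimal_unique[OF m, of x] z by (auto simp: minimal_def)
    next
      case (up s x)
      then show ?case using upx[OF up(1-3)] Kz_act[OF up(1), of x] by auto
    qed simp
    have p0: "pcol ?K y = 0" if y: "y \<in> full.G" "h y < h z" for y
    proof (rule pcol_0, rule notI)
      fix x assume x: "x \<in> GK ?K" "srt ?K y x"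
      have "h x \<le> h y" by (rule srt_height[OF x(1) y(1) x(2)])
      moreover have "h z \<le> h x" using low[of x] x(1) by (auto simp: GK_def)
      ultimately show False using y(2) by simp
    qed
    have "finite {y \<in> full.G. h y < h z}" using full.finite_G by simp
    then have "proj ?K u = 0" using uf
    proof (induction u rule: fspace_induct)
      case zero show ?case by (rule slin_zero[OF proj_lin])
    next
      case (basis c y)
      then have yG: "bv y \<in> fspace full.G" by simp
      show ?case unfolding slinD(3)[OF proj_lin yG] using basis p0[of y] by (simp add: proj_bv vscale_simps)
    next
      case (add u v)
      then have uv: "u \<in> fspace full.G" "v \<in> fspace full.G" by (auto simp: fspace_def)
      show ?case unfolding slinD(2)[OF proj_lin uv] using add by simp
    qed
    moreover have "proj ?K (bv z) = bv z"
      unfolding proj_bv[OF zf] pcol_eq[OF zK srt_refl] coef_steps(4) by simp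
    moreover have "\<gamma> (bv z) = bv z + u" by (simp add: u_def)
    moreover have "u \<in> fspace full.G" using uf by (auto simp: fspace_def)
    ultimately show ?thesis using zf z by (simp add: bb B_def slinD(2)[OF proj_lin])
  qed
  ultimately show ?thesis using sl by blast
qed

end

section \<open>The W-graphs\<close>

context bar_graph
begin

text \<open>The canonical basis is unitriangular with respect to the height, so leading coefficients
  are preserved; bijectivity follows from this.\<close>

lemma can_ext_coeff:
  assumes f: "f \<in> fspace {z \<in> V. h z \<le> h y}" and y: "y \<in> V"
  shows "lin_ext V can f y = f y"
proof -
  have "lin_ext V can f y = (\<Sum>z\<in>V. if z = y then f y else 0)"
    unfolding lin_ext_def
  proof (rule sum.cong)
    fix z assume z: "z \<in> V"
    have "can z y = 0 \<or> f z = 0" if "z \<noteq> y"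
      using canD(5)[OF z, of y] f that z by (force simp: fspace_def)
    then show "f z * can z y = (if z = y then f y else 0)" using canD(3)[OF z] by auto
  qed simp
  then show ?thesis using y finV by simp
qed

lemma can_ext_lin: "lin V V (lin_ext V can)"
  by (rule lin_lin_ext) (rule canD(1))

lemma can_ext_inj: assumes f: "f \<in> fspace V" and 0: "lin_ext V can f = 0" shows "f = 0"
proof (rule ccontr)
  assume "f \<noteq> 0"
  then obtain x where "f x \<noteq> 0" by (auto simp: fun_eq_iff vec_apply)
  then have ne: "{y \<in> V. f y \<noteq> 0} \<noteq> {}" using f by (auto simp: fspace_def)
  have fin: "finite (h ` {y \<in> V. f y \<noteq> 0})" using finV by simp
  with ne have "Max (h ` {y \<in> V. f y \<noteq> 0}) \<in> h ` {y \<in> V. f y \<noteq> 0}" by (intro Max_in) auto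
  then obtain y where y: "y \<in> V" "f y \<noteq> 0" and my: "h y = Max (h ` {y \<in> V. f y \<noteq> 0})" by auto
  have "h z \<le> h y" if "z \<in> V" "f z \<noteq> 0" for z
    unfolding my using that fin by (intro Max_ge) auto
  then have "f \<in> fspace {z \<in> V. h z \<le> h y}" using f by (auto simp: fspace_def)
  from can_ext_coeff[OF this y(1)] show False using y(2) unfolding 0 zero_fun_def by simp
qed

lemma can_ext_surj: "v \<in> fspace {y \<in> V. h y < d} \<Longrightarrow> v \<in> lin_ext V can ` fspace V"
proof (induction d arbitrary: v)
  case 0
  then have "v = 0" by (auto simp: fspace_def fun_eq_iff vec_apply)
  then show ?case using slin_zero[OF can_ext_lin] by (intro image_eqI[of _ _ 0]) auto
next
  case (Suc d)
  define q where "q = (\<lambda>y. if y \<in> V \<and> h y = d then v y else 0)"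
  have qV: "q \<in> fspace V" and qS: "q \<in> fspace {y \<in> V. h y \<le> d}" by (auto simp: q_def fspace_def)
  have vV: "v \<in> fspace V" using Suc.prems by (auto simp: fspace_def)
  have qc: "lin_ext V can q y = q y" if "y \<in> V" "h y \<ge> d" for y
    by (rule can_ext_coeff) (use qS that in \<open>auto simp: fspace_def\<close>)
  have cV: "lin_ext V can q \<in> fspace V" using slinD(1)[OF can_ext_lin qV] .
  have "(v - lin_ext V can q) y = 0" if "y \<notin> {y \<in> V. h y < d}" for y
  proof (cases "y \<in> V")
    case False then show ?thesis using vV cV by (simp add: fspace_def vec_apply)
  next
    case True
    then show ?thesis using that qc[OF True] Suc.prems by (cases "h y = d") (auto simp: vec_apply q_def fspace_def)
  qed
  then have "v - lin_ext V can q \<in> fspace {y \<in> V. h y < d}" by (simp add: fspace_def)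
  from Suc.IH[OF this] obtain p where p: "p \<in> fspace V" "v - lin_ext V can q = lin_ext V can p" by auto
  have "v = (v - lin_ext V can q) + lin_ext V can q" by simp
  also have "\<dots> = lin_ext V can (p + q)" unfolding p(2) slinD(2)[OF can_ext_lin p(1) qV] ..
  finally show ?case using p(1) qV by (intro image_eqI[of _ _ "p + q"]) auto
qed

lemma can_ext_bij: "bij_betw (lin_ext V can) (fspace V) (fspace V)"
  unfolding bij_betw_def
proof (intro conjI equalityI subsetI inj_onI)
  fix u v assume uv: "u \<in> fspace V" "v \<in> fspace V" "lin_ext V can u = lin_ext V can v"
  then have "lin_ext V can (u - v) = 0" using slin_minus[OF can_ext_lin] by simp
  then have "u - v = 0" using can_ext_inj[of "u - v"] uv by simp
  then show "u = v" by simp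
next
  fix v assume "v \<in> lin_ext V can ` fspace V"
  then show "v \<in> fspace V" using slinD(1)[OF can_ext_lin] by auto
next
  fix v assume v: "v \<in> fspace V"
  have "h y < Suc (Max (h ` V))" if "y \<in> V" for y
    using Max_ge[of "h ` V" "h y"] that finV by (auto simp: less_Suc_eq_le)
  then have "v \<in> fspace {y \<in> V. h y < Suc (Max (h ` V))}" using v by (auto simp: fspace_def)
  then show "v \<in> lin_ext V can ` fspace V" by (rule can_ext_surj)
qed

end

locale gelfand = two_ranks t n "2 * n" cA cD for t n cA cD
begin

lemma Gset_eq: "Gset t n = G"
proof (intro set_eqI)
  fix z
  have i: "{1..2 * int n} = {1..int (2 * n)}" by simp
  \<comment> \<open>A position \<open>i > n\<close> with \<open>z i < - i\<close> would be a visible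
    descent, so counting up to \<open>n\<close> or up to \<open>2 n\<close> makes no
    difference.\<close>
  have vd: "negp (2 * n) z = {i \<in> {1..int n}. z i < - i}" if "\<forall>i. i > int n \<longrightarrow> \<not> visdes z i"
  proof (intro set_eqI iffI)
    fix i assume "i \<in> negp (2 * n) z"
    then show "i \<in> {i \<in> {1..int n}. z i < - i}"
      using that[rule_format, of i] by (cases "i > int n") (auto simp: negp_def visdes_def)
  qed (auto simp: negp_def)
  have iv: "inv z = z \<longleftrightarrow> (\<forall>i. z (z i) = i)" if "signed_perm (2 * n) z"
  proof
    assume "inv z = z"
    then show "\<forall>i. z (z i) = i" using that by (metis bij_is_surj signed_perm_def surj_f_inv_f)
  next
    assume "\<forall>i. z (z i) = i"
    then show "inv z = z" by (intro inv_unique_comp) (auto simp: fun_eq_iff comp_apply)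
  qed
  show "z \<in> Gset t n \<longleftrightarrow> z \<in> G"
  proof (cases "signed_perm (2 * n) z")
    case False
    then show ?thesis by (auto simp: Gset_def Fset_def Wgrp_def Gg_def fpf_inv_def split: ctype.splits)
  next
    case True
    then show ?thesis
    proof (cases t)
      case TypeA
      have "(\<forall>i\<in>{1..int (2 * n)}. z i > 0) \<Longrightarrow>
          (\<forall>i\<in>{1..int (2 * n)}. z i \<noteq> i) \<longleftrightarrow> (\<forall>i\<in>{1..int (2 * n)}. \<bar>z i\<bar> \<noteq> i)" by force
      then show ?thesis using True iv[OF True] TypeA unfolding Gset_def Fset_def Wgrp_def Gg_def fpf_inv_def i by auto
    next
      case TypeBC
      then show ?thesis using True iv[OF True] unfolding Gset_def Fset_def Wgrp_def Gg_def fpf_inv_def i by auto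
    next
      case TypeD
      then show ?thesis using True iv[OF True] vd unfolding Gset_def Fset_def Wgrp_def Gg_def fpf_inv_def i by auto
    qed
  qed
qed

lemma DesEq_eq: "DesEq t n z = {s \<in> S. DE s z}" by (simp add: DesEq_def DE_def)
lemma AscEq_eq: "AscEq t n z = {s \<in> S. AE s z}" by (simp add: AscEq_def AE_def)
lemma DesLt_eq: "DesLt t n z = {s \<in> S. Dn s z}"
  by (auto simp: DesLt_def DesEq_eq AscEq_eq lenG_def Dn_def N.LD_def)
lemma AscLt_eq: assumes "z \<in> G" shows "AscLt t n z = {s \<in> S. Up s z}"
proof -
  have "h z < h (s \<circ> z) \<longleftrightarrow> \<not> N.LD s z" if "s \<in> S" for s
    using N.len_S[OF G_W[OF assms] S_N[OF that]] by (cases "N.LD s z") auto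
  then show ?thesis by (auto simp: AscLt_def DesEq_eq AscEq_eq lenG_def Up_def)
qed

lemma DE_not_AE: assumes "s \<in> S" "z \<in> G" "DE s z" shows "\<not> AE s z"
proof -
  obtain a b where ab: "(a, b) \<in> P" "s = swp a b" using assms S_swp by auto
  show ?thesis using assms(3) DE_iff[OF ab(1) assms(2)] AE_iff[OF ab(1) assms(2)] spair_bound[OF n2 ab(1)] ab(2)
    by (auto simp: aeq_def)
qed

definition A :: "perm \<Rightarrow> vec \<Rightarrow> vec" where "A s = lin_ext (Gset t n) (qpb t n cA cD s)"

lemma A_T: assumes s: "s \<in> S" shows "A s = T s"
proof -
  have "qpb t n cA cD s z = qb s z" if z: "z \<in> G" for z
    using s not_Dn[of s z] up_dn[OF s z] loop_iff[of s z]
    by (auto simp: qpb_def qb_def AscLt_eq[OF z] DesLt_eq AscEq_eq DesEq_eq lc_def act_def)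
  then have "lin_ext G (qpb t n cA cD s) = lin_ext G (qb s)"
    unfolding lin_ext_def by (intro ext sum.cong) auto
  then show ?thesis by (simp add: A_def T_def Gset_eq)
qed

lemma hact_A: "hact t n A a v = hact t n T a v"
proof -
  have "List.foldr A ws v = List.foldr T ws v" if "set ws \<subseteq> S" for ws
    using that by (induction ws) (auto simp: A_T)
  then show ?thesis unfolding hact_def using redword by (intro ext sum.cong) (auto simp: reduced_def)
qed

definition wgI :: "perm \<Rightarrow> perm set" where
  "wgI z = {s \<in> S. Up s z \<or> (\<not> Up s z \<and> \<not> Dn s z \<and> lc s z = - xinv)}"

theorem gelfand_Wgraph:
  assumes I: "\<And>z. z \<in> G \<Longrightarrow> I z = wgI z"
  shows "is_Wgraph t n (Gset t n) (omega t n A I) I"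
    "quasi_admissible (Gset t n) (omega t n A I) I"
    "H_iso t n (Gset t n) (YT (Gset t n) (omega t n A I) I) A (lin_ext (Gset t n) (canon t n A))"
proof -
  obtain \<beta> where \<beta>: "slin lbar G G \<beta>" "\<And>s z. s \<in> S \<Longrightarrow> z \<in> G \<Longrightarrow> \<beta> (T s (bv z)) = Ti s (\<beta> (bv z))"
    "\<And>z. z \<in> G \<Longrightarrow> minimal z \<Longrightarrow> \<beta> (bv z) = bv z"
    using bar_exists by blast
  interpret b: bar_graph G S act Up Dn lc h \<beta>
    by unfold_locales (use \<beta> in \<open>auto simp: T'_Ti minimal_def\<close>)
  \<comment> \<open>\<open>antilin_on\<close> prescribes the value 0 outside the module, which makes
    the description in \<open>modbar\<close> unique.\<close>
  define \<beta>0 where "\<beta>0 v = (if v \<in> fspace G then \<beta> v else (\<lambda>_. 0))" for v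
  have mb: "modbar t n A = \<beta>0"
    unfolding modbar_def Gset_eq hact_A DesLt_eq
  proof (rule the_equality)
    have h: "\<forall>a\<in>Hset t n. \<forall>v\<in>fspace G. \<beta> (hact t n T a v) = hact t n T (hbar t n a) (\<beta> v)"
      using bar_hact_iff[OF \<beta>(1)] b.bar_T T'_Ti by metis
    have cl: "hact t n T a v \<in> fspace G" if "v \<in> fspace G" for a v
      using Hact_closed[OF that] by (simp add: hact_Hact)
    have "antilin_on (fspace G) \<beta>0"
      by (auto simp: antilin_on_def \<beta>0_def slinD[OF \<beta>(1)])
    moreover have "\<beta>0 (hact t n T a v) = hact t n T (hbar t n a) (\<beta>0 v)" if "a \<in> Hset t n" "v \<in> fspace G" for a v
      using h that cl[OF that(2)] by (simp add: \<beta>0_def)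
    moreover have "\<beta>0 (bv z) = bv z" if "z \<in> G" "{s \<in> S. Dn s z} = {}" for z
      using b.bar_min[of z] that by (auto simp: \<beta>0_def)
    ultimately show "antilin_on (fspace G) \<beta>0 \<and> (\<forall>a\<in>Hset t n. \<forall>v\<in>fspace G. \<beta>0 (hact t n T a v) = hact t n T (hbar t n a) (\<beta>0 v)) \<and>
        (\<forall>z\<in>G. {s \<in> S. Dn s z} = {} \<longrightarrow> \<beta>0 (bv z) = bv z)" by blast
    fix \<gamma> assume g: "antilin_on (fspace G) \<gamma> \<and> (\<forall>a\<in>Hset t n. \<forall>v\<in>fspace G. \<gamma> (hact t n T a v) = hact t n T (hbar t n a) (\<gamma> v)) \<and>
        (\<forall>z\<in>G. {s \<in> S. Dn s z} = {} \<longrightarrow> \<gamma> (bv z) = bv z)"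
    have gs: "slin lbar G G \<gamma>" using g by (simp add: antilin_on_def slin_def)
    have gT: "\<gamma> (T s v) = Ti s (\<gamma> v)" if "s \<in> S" "v \<in> fspace G" for s v
      using bar_hact_iff[OF gs] g that by blast
    have "\<gamma> v = \<beta> v" if "v \<in> fspace G" for v
    proof (rule slin_determined[OF gs \<beta>(1) _ _ _ that, where X=Ti])
      fix z assume "z \<in> G" "\<forall>s\<in>S. \<not> Dn s z"
      then show "\<gamma> (bv z) = \<beta> (bv z)" using g b.bar_min[of z] by auto
    qed (use gT \<beta>(2) in auto)
    moreover have "\<gamma> v = (\<lambda>_. 0)" if "v \<notin> fspace G" for v using g that by (simp add: antilin_on_def)
    ultimately show "\<gamma> = \<beta>0" by (auto simp: \<beta>0_def)
  qed
  have can: "canon t n A z = b.can z" for z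
  proof -
    have "(\<lambda>c. c \<in> fspace (Gset t n) \<and> modbar t n A c = c \<and> c z = 1 \<and>
      (\<forall>y\<in>Gset t n. y \<noteq> z \<longrightarrow> c y \<in> negpart \<and> (c y \<noteq> 0 \<longrightarrow> lenG t n y < lenG t n z))) = b.is_can z"
      unfolding mb Gset_eq b.is_can_def lenG_def \<beta>0_def by (intro ext) auto
    then show ?thesis unfolding canon_def b.can_def by simp
  qed
  have Ii: "s \<in> I z \<longleftrightarrow> b.In s z" if "z \<in> G" "s \<in> S" for s z
    using I[OF that(1)] that by (auto simp: wgI_def b.In_def)
  have IS: "I z \<subseteq> S" if "z \<in> G" for z using I[OF that] by (auto simp: wgI_def)
  define w where "w = omega t n A I"
  define Y where "Y = YT G w I"
  let ?\<phi> = "lin_ext G b.can"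
  have w: "w u v = lconst (coeff_xinv (b.can v u) + coeff_xinv (b.can u v))" if "\<not> I u \<subseteq> I v" for u v
    using that by (simp add: w_def omega_def mu_def can)
  note \<phi>l = b.can_ext_lin
  have \<phi>b: "?\<phi> (bv u) = b.can u" if "u \<in> G" for u by (rule lin_ext_bv[OF finite_G that])
  have YbG: "YTb G w I s u \<in> fspace G" if "u \<in> G" for s u using that by (auto simp: YTb_def fspace_def vec_apply bv_def)
  have Yl: "lin G G (Y s)" for s unfolding Y_def YT_def by (rule lin_lin_ext[OF YbG])
  have \<phi>Yb: "?\<phi> (YTb G w I s u) = T s (b.can u)" if s: "s \<in> S" and u: "u \<in> G" for s u
  proof (cases "s \<in> I u")
    case False
    then show ?thesis using b.can_eigen[OF s u] Ii[OF u s] slinD(3)[OF \<phi>l, of "bv u"] \<phi>b[OF u] u by (simp add: YTb_def)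
  next
    case True
    define g where "g v = (if s \<in> I v then 0 else w u v)" for v
    have "?\<phi> (YTb G w I s u) = (\<lambda>y. \<Sum>v\<in>G. ((if v = u then - xinv else 0) + g v) * b.can v y)"
      unfolding lin_ext_def using True by (intro ext sum.cong) (auto simp: YTb_def g_def)
    also have "\<dots> = vscale (- xinv) (b.can u) + (\<Sum>v\<in>G. vscale (g v) (b.can v))"
    proof
      fix y
      have "(\<Sum>v\<in>G. (if v = u then - xinv else 0) * b.can v y) = (\<Sum>v\<in>G. if v = u then - xinv * b.can u y else 0)"
        by (rule sum.cong) auto
      also have "\<dots> = - xinv * b.can u y" using u finite_G by simp
      finally show "(\<Sum>v\<in>G. ((if v = u then - xinv else 0) + g v) * b.can v y)
          = (vscale (- xinv) (b.can u) + (\<Sum>v\<in>G. vscale (g v) (b.can v))) y"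
        by (simp add: distrib_right sum.distrib vec_apply sum_apply)
    qed
    also have "(\<Sum>v\<in>G. vscale (g v) (b.can v)) = (\<Sum>v\<in>G. vscale (if b.In s v then 0
        else lconst (coeff_xinv (b.can v u) + coeff_xinv (b.can u v))) (b.can v))"
    proof (rule sum.cong)
      fix v assume v: "v \<in> G"
      show "vscale (g v) (b.can v) = vscale (if b.In s v then 0
        else lconst (coeff_xinv (b.can v u) + coeff_xinv (b.can u v))) (b.can v)"
      proof (cases "s \<in> I v")
        case True
        then show ?thesis using Ii[OF v s] by (simp add: g_def)
      next
        case False
        then have "\<not> I u \<subseteq> I v" using \<open>s \<in> I u\<close> by blast
        then show ?thesis using False Ii[OF v s] w[of u v] by (simp add: g_def)
      qed
    qed simp
    finally show ?thesis using b.can_action[OF s u] Ii[OF u s] True by simp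
  qed
  have \<phi>Y: "?\<phi> (Y s v) = T s (?\<phi> v)" if s: "s \<in> S" and v: "v \<in> fspace G" for s v
  proof (rule slin_eqI[OF finite_G lin_comp[OF Yl \<phi>l] lin_comp[OF \<phi>l T_lin[OF s]] _ v])
    fix u assume u: "u \<in> G"
    show "?\<phi> (Y s (bv u)) = T s (?\<phi> (bv u))"
      unfolding \<phi>b[OF u] \<phi>Yb[OF s u, symmetric] Y_def YT_def lin_ext_bv[OF finite_G u] ..
  qed
  have inj: "u = v" if "u \<in> fspace G" "v \<in> fspace G" "?\<phi> u = ?\<phi> v" for u v
    using b.can_ext_bij that by (auto simp: bij_betw_def inj_on_def)
  note Yc = slinD(1)[OF Yl] and \<phi>c = slinD(1)[OF \<phi>l]
  \<comment> \<open>All relations for \<open>Y\<close> are pulled back along the injective map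
    \<open>?\<phi>\<close>, which intertwines \<open>Y s\<close> with \<open>T s\<close>.\<close>
  interpret Y: hecke_module t n G Y
  proof
    show "finite G" by (rule finite_G)
    show "lin G G (Y s)" for s by (rule Yl)
    show "Y s (Y s v) = v + vscale dd (Y s v)" if "s \<in> S" "v \<in> fspace G" for s v
      by (rule inj) (use that in \<open>auto simp: Yc \<phi>Y T_quad slinD(2,3)[OF \<phi>l] \<phi>c\<close>)
    fix r s v assume v: "v \<in> fspace G"
    show "Y r (Y s v) = Y s (Y r v)" if c: "cf2 r s"
      by (rule inj) (use v cf_S(1)[OF c] T_braid2[OF c] in \<open>auto simp: Yc \<phi>Y \<phi>c\<close>)
    show "Y r (Y s (Y r v)) = Y s (Y r (Y s v))" if c: "cf3 r s"
      by (rule inj) (use v cf_S(2)[OF c] T_braid3[OF c] in \<open>auto simp: Yc \<phi>Y \<phi>c\<close>)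
    show "Y r (Y s (Y r (Y s v))) = Y s (Y r (Y s (Y r v)))" if c: "cf4 r s"
      by (rule inj) (use v cf_S(3)[OF c] T_braid4[OF c] in \<open>auto simp: Yc \<phi>Y \<phi>c\<close>)
  qed
  show "is_Wgraph t n (Gset t n) (omega t n A I) I"
    unfolding is_Wgraph_def Gset_eq w_def[symmetric] Y_def[symmetric]
    using Y.is_Hmodule_rep_hact Y.hact_bv_S IS by blast
  show "H_iso t n (Gset t n) (YT (Gset t n) (omega t n A I) I) A (lin_ext (Gset t n) (canon t n A))"
    unfolding H_iso_def Gset_eq w_def[symmetric] Y_def[symmetric] can hact_A
  proof (intro conjI ballI)
    show "bij_betw ?\<phi> (fspace G) (fspace G)" by (rule b.can_ext_bij)
    fix a v assume v: "v \<in> fspace G"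
    show "?\<phi> (hact t n Y a v) = hact t n T a (?\<phi> v)"
      unfolding hact_Hact by (rule Hact_intertwine[OF \<phi>l ringhom_id _ _ v]) (erule Yc, erule (1) \<phi>Y)
  qed
  \<comment> \<open>A nonzero weight needs a nonzero coefficient of \<open>x^-1\<close> in one of
    the two directions, and either one forces opposite parities of the halved heights; these give
    the bipartition.\<close>
  have par: "odd (h u div 2 + h v div 2)" if "u \<in> G" "v \<in> G" "w u v \<noteq> 0" for u v
  proof -
    have "coeff_xinv (b.can v u) \<noteq> 0 \<or> coeff_xinv (b.can u v) \<noteq> 0"
      using that(3) by (auto simp: w_def omega_def mu_def can lconst_simps split: if_splits)
    then show ?thesis using b.can_parity[of v u] b.can_parity[of u v] that by auto
  qed
  show "quasi_admissible (Gset t n) (omega t n A I) I"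
    unfolding quasi_admissible_def Gset_eq w_def[symmetric]
  proof (intro conjI ballI impI)
    show "\<exists>A B. A \<inter> B = {} \<and> A \<union> B = G \<and>
        (\<forall>u\<in>G. \<forall>v\<in>G. w u v \<noteq> 0 \<longrightarrow> u \<in> A \<and> v \<in> B \<or> u \<in> B \<and> v \<in> A)"
      by (rule exI[of _ "{z \<in> G. even (h z div 2)}"], rule exI[of _ "{z \<in> G. odd (h z div 2)}"])
        (use par in auto)
    fix u v assume "u \<in> G" "v \<in> G"
    show "w u v \<in> range lconst"
      by (auto simp: w_def omega_def lconst_simps(1)[symmetric] simp del: lconst_simps)
    show "w u v = 0" if "I u \<subseteq> I v" using that by (simp add: w_def omega_def)
    show "w u v = w v u" if "\<not> I u \<subseteq> I v \<and> \<not> I v \<subseteq> I u"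
      using that by (simp add: w add.commute)
  qed
qed

end

theorem mainTheorem4:
  fixes t :: ctype and n :: nat
  assumes "n \<ge> 2"
  shows "is_Wgraph t n (Gset t n) (omega t n (Mact t n) (AscM t n)) (AscM t n)
       \<and> quasi_admissible (Gset t n) (omega t n (Mact t n) (AscM t n)) (AscM t n)
       \<and> is_Wgraph t n (Gset t n) (omega t n (Nact t n) (AscN t n)) (AscN t n)
       \<and> quasi_admissible (Gset t n) (omega t n (Nact t n) (AscN t n)) (AscN t n)
       \<and> H_iso t n (Gset t n) (YT (Gset t n) (omega t n (Mact t n) (AscM t n)) (AscM t n))
             (Mact t n) (lin_ext (Gset t n) (canon t n (Mact t n)))
       \<and> H_iso t n (Gset t n) (YT (Gset t n) (omega t n (Nact t n) (AscN t n)) (AscN t n))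
             (Nact t n) (lin_ext (Gset t n) (canon t n (Nact t n)))"
proof -
  interpret M: gelfand t n "- xinv" xx by unfold_locales (use assms in auto)
  interpret N: gelfand t n xx "- xinv" by unfold_locales (use assms in auto)
  have M: "Mact t n = M.A" by (simp add: fun_eq_iff Mact_def M.A_def)
  have N: "Nact t n = N.A" by (simp add: fun_eq_iff Nact_def N.A_def)
  \<comment> \<open>The loops with scalar \<open>- xinv\<close> belong to the label set. For M these
    are the \<open>AE\<close> loops and for N the \<open>DE\<close> loops; \<open>xx_neq\<close>
    keeps the two kinds apart.\<close>
  have IM: "AscM t n z = M.wgI z" if z: "z \<in> Gg t n (2 * n)" for z
    using M.loop_iff[of _ z] M.DE_not_AE[OF _ z] xx_neq
    by (auto simp: AscM_def M.AscLt_eq[OF z] M.AscEq_eq M.wgI_def M.lc_def split: if_splits)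
  have IN: "AscN t n z = N.wgI z" if z: "z \<in> Gg t n (2 * n)" for z
    using N.loop_iff[of _ z] N.DE_not_AE[OF _ z] xx_neq
    by (auto simp: AscN_def N.AscLt_eq[OF z] N.DesEq_eq N.wgI_def N.lc_def split: if_splits)
  show ?thesis
    unfolding M N using M.gelfand_Wgraph[of "AscM t n", OF IM] N.gelfand_Wgraph[of "AscN t n", OF IN] by blast
qed

end
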